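(* Let $d\ge2$, let $O\subseteq\mathbb R^d$ be open and $D\subseteq\partial O$ closed. Suppose that $O$ satisfies (UITC) and consists of only one component. Then the dual space of $\mathrm{VMO}_D$ is $\mathrm H^1_D$ up to equivalent norms, where $f\in\mathrm H^1_D$ acts on $\phi\in \mathrm C_{\mathrm c}(O)$ by $\int_Of\phi\,dx$ (and on $\mathrm{VMO}_D$ by continuous extension).
   Context: $\mathrm B(x,r)$ is the Euclidean ball and $\mathrm d(O)=\operatorname{diam}(O)\in(0,\infty]$. (UITC): $\exists c>0\ \forall x\in O,\ r<\mathrm d(O)$: $|\mathrm B(x,r)\cap O|\ge cr^d$. Components: let $\{O_m\}_{m\in I}$ enumerate the bounded connected components $O'$ of $O$ with $\partial O'\cap D=\varnothing$, and $O_D=O\setminus\bigcup_mO_m$. The components of $O$ are the nonempty sets among $O_D$ and the $O_m$; here there is exactly one, namely $O$ itself. Balls and atoms: for $x$ in a component $O'$ and $r>0$ put $B^\Sigma(x,r)=\mathrm B(x,r)\cap O'$ (a usual ball); it is near $D$ if $\mathrm B(x,2r)\cap(D\cap\partial O')\ne\varnothing$. A measurable $a:O\to\mathbb C$ is an $\mathrm H^1_D$-atom if for some usual ball $B$ one has $\operatorname{supp}a\subseteq\overline B$, $\|a\|_2\le|B|^{-1/2}$, and either $\int_Oa=0$ or $B$ is near $D$. $\mathrm H^1_D$ consists of all $f=\sum_j\lambda_ja_j$ (a.e.) with $(\lambda_j)\in\ell^1$ and $\mathrm H^1_D$-atoms $a_j$, with norm $\inf\|(\lambda_j)\|_{\ell^1}$.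 $\mathrm{BMO}_D$: all measurable $f$ that are square integrable on bounded subsets of $O$ and for which $\|f\|_{\mathrm{BMO}_D}=\max\Big\{\sup_{B\text{ usual}}\Big(\frac1{|B|}\int_B|f-(f)_B|^2\Big)^{1/2},\ \sup_{B\text{ near }D}\Big(\frac1{|B|}\int_B|f|^2\Big)^{1/2}\Big\}<\infty$, where $(f)_B=\frac1{|B|}\int_Bf$ (a seminorm in general; functions of vanishing seminorm are identified with $0$). $\mathrm{VMO}_D$ is the closure of $\mathrm C_{\mathrm c}(O)$ (continuous functions with compact support in $O$) in $\mathrm{BMO}_D$ with respect to $\|\cdot\|_{\mathrm{BMO}_D}$. *)

theory Defs
  imports "HOL-Analysis.Analysis"
begin

text \<open>
  Functions on an open set \<open>\<Omega>\<close> are represented by total functions \<open>'a \<Rightarrow> complex\<close> whose values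
  outside \<open>\<Omega>\<close> play no role: measurability and integrals refer to \<^term>\<open>lebesgue_on \<Omega>\<close>.
\<close>

section \<open>Geometry\<close>

definition ediam :: "'a::metric_space set \<Rightarrow> ereal" where
  "ediam S = (if bounded S then ereal (diameter S) else \<infinity>)"

definition UITC :: "'a::euclidean_space set \<Rightarrow> bool" where
  "UITC \<Omega> \<longleftrightarrow> (\<exists>c>0. \<forall>x\<in>\<Omega>. \<forall>r>0. ereal r < ediam \<Omega> \<longrightarrow>
     measure lebesgue (ball x r \<inter> \<Omega>) \<ge> c * r ^ DIM('a))"

definition pure_components :: "'a::euclidean_space set \<Rightarrow> 'a set \<Rightarrow> 'a set set" where
  "pure_components \<Omega> D = {C \<in> components \<Omega>. bounded C \<and> frontier C \<inter> D = {}}"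

definition D_component :: "'a::euclidean_space set \<Rightarrow> 'a set \<Rightarrow> 'a set" where
  "D_component \<Omega> D = \<Omega> - \<Union>(pure_components \<Omega> D)"

text \<open>The member \<^term>\<open>D_component \<Omega> D\<close> need not be connected.\<close>

definition sigma_components :: "'a::euclidean_space set \<Rightarrow> 'a set \<Rightarrow> 'a set set" where
  "sigma_components \<Omega> D = insert (D_component \<Omega> D) (pure_components \<Omega> D) - {{}}"

text \<open>
  A usual ball is recorded as a triple of a component, a centre in it and a radius, because being
  near \<open>D\<close> depends on these data and not only on the underlying point set \<open>usual_ball_set\<close>.
\<close>

definition usual_balls :: "'a::euclidean_space set \<Rightarrow> 'a set \<Rightarrow> ('a set \<times> 'a \<times> real) set" where
  "usual_balls \<Omega> D = {(C, x, r). C \<in> sigma_components \<Omega> D \<and> x \<in> C \<and> r > 0}"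

definition usual_ball_set :: "'a::euclidean_space set \<times> 'a \<times> real \<Rightarrow> 'a set" where
  "usual_ball_set = (\<lambda>(C, x, r). ball x r \<inter> C)"

definition near_balls :: "'a::euclidean_space set \<Rightarrow> 'a set \<Rightarrow> ('a set \<times> 'a \<times> real) set" where
  "near_balls \<Omega> D = {(C, x, r) \<in> usual_balls \<Omega> D. ball x (2 * r) \<inter> (D \<inter> frontier C) \<noteq> {}}"

section \<open>The Hardy space\<close>

text \<open>
  The support is taken pointwise; as atomic decompositions are required almost everywhere only,
  using the essential support would give the same space and norm.
\<close>

definition h1_atom :: "'a::euclidean_space set \<Rightarrow> 'a set \<Rightarrow> ('a \<Rightarrow> complex) \<Rightarrow> bool" where
  "h1_atom \<Omega> D a \<longleftrightarrow>
     a \<in> borel_measurable (lebesgue_on \<Omega>) \<and>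
     (\<exists>b \<in> usual_balls \<Omega> D.
        closure {x \<in> \<Omega>. a x \<noteq> 0} \<subseteq> closure (usual_ball_set b) \<and>
        integrable (lebesgue_on \<Omega>) (\<lambda>x. (cmod (a x))\<^sup>2) \<and>
        sqrt (LINT x|lebesgue_on \<Omega>. (cmod (a x))\<^sup>2)
          \<le> measure lebesgue (usual_ball_set b) powr (- (1/2)) \<and>
        ((LINT x|lebesgue_on \<Omega>. a x) = 0 \<or> b \<in> near_balls \<Omega> D))"

definition atomic_representation ::
    "'a::euclidean_space set \<Rightarrow> 'a set \<Rightarrow> ('a \<Rightarrow> complex) \<Rightarrow> (nat \<Rightarrow> complex) \<Rightarrow> (nat \<Rightarrow> 'a \<Rightarrow> complex) \<Rightarrow> bool"
  where
  "atomic_representation \<Omega> D f c a \<longleftrightarrow>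
     summable (\<lambda>j. cmod (c j)) \<and> (\<forall>j. h1_atom \<Omega> D (a j)) \<and>
     (AE x in lebesgue_on \<Omega>. (\<lambda>j. c j * a j x) sums f x)"

definition H1 :: "'a::euclidean_space set \<Rightarrow> 'a set \<Rightarrow> ('a \<Rightarrow> complex) set" where
  "H1 \<Omega> D = {f. \<exists>c a. atomic_representation \<Omega> D f c a}"

definition h1_norm :: "'a::euclidean_space set \<Rightarrow> 'a set \<Rightarrow> ('a \<Rightarrow> complex) \<Rightarrow> real" where
  "h1_norm \<Omega> D f = Inf {(\<Sum>j. cmod (c j)) | c a. atomic_representation \<Omega> D f c a}"

section \<open>BMO and VMO\<close>

definition average :: "'a::euclidean_space set \<Rightarrow> ('a \<Rightarrow> complex) \<Rightarrow> complex" where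
  "average B f = (LINT x|lebesgue_on B. f x) /\<^sub>R measure lebesgue B"

definition root_mean_square :: "'a::euclidean_space set \<Rightarrow> ('a \<Rightarrow> complex) \<Rightarrow> real" where
  "root_mean_square B f = sqrt ((LINT x|lebesgue_on B. (cmod (f x))\<^sup>2) / measure lebesgue B)"

text \<open>
  Only meaningful for functions that are square integrable on bounded sets. The suprema are taken
  in \<^typ>\<open>ennreal\<close>, so that the second one is 0 if no ball is near \<open>D\<close>.
\<close>

definition bmo_enorm :: "'a::euclidean_space set \<Rightarrow> 'a set \<Rightarrow> ('a \<Rightarrow> complex) \<Rightarrow> ennreal" where
  "bmo_enorm \<Omega> D f =
     max (SUP b\<in>usual_balls \<Omega> D.
            ennreal (root_mean_square (usual_ball_set b) (\<lambda>x. f x - average (usual_ball_set b) f)))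
         (SUP b\<in>near_balls \<Omega> D. ennreal (root_mean_square (usual_ball_set b) f))"

definition bmo_norm :: "'a::euclidean_space set \<Rightarrow> 'a set \<Rightarrow> ('a \<Rightarrow> complex) \<Rightarrow> real" where
  "bmo_norm \<Omega> D f = enn2real (bmo_enorm \<Omega> D f)"

definition BMO :: "'a::euclidean_space set \<Rightarrow> 'a set \<Rightarrow> ('a \<Rightarrow> complex) set" where
  "BMO \<Omega> D = {f. f \<in> borel_measurable (lebesgue_on \<Omega>) \<and>
     (\<forall>A \<in> sets lebesgue. A \<subseteq> \<Omega> \<longrightarrow> bounded A \<longrightarrow> integrable (lebesgue_on A) (\<lambda>x. (cmod (f x))\<^sup>2)) \<and>
     bmo_enorm \<Omega> D f < \<infinity>}"

definition Cc :: "'a::euclidean_space set \<Rightarrow> ('a \<Rightarrow> complex) set" where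
  "Cc \<Omega> = {\<phi>. continuous_on \<Omega> \<phi> \<and> (\<exists>K. compact K \<and> K \<subseteq> \<Omega> \<and> (\<forall>x \<in> \<Omega> - K. \<phi> x = 0))}"

definition VMO :: "'a::euclidean_space set \<Rightarrow> 'a set \<Rightarrow> ('a \<Rightarrow> complex) set" where
  "VMO \<Omega> D = {f \<in> BMO \<Omega> D. \<forall>\<epsilon>>0. \<exists>\<phi>\<in>Cc \<Omega>. bmo_norm \<Omega> D (\<lambda>x. f x - \<phi> x) < \<epsilon>}"

section \<open>Dual of a seminormed function space\<close>

text \<open>
  Boundedness forces a functional to agree on functions whose difference has seminorm 0, so this is
  the dual of the quotient by the null space of \<open>p\<close>. Functionals are normalised to be 0 outside of
  \<open>V\<close>, so that equality of elements of the dual is equality of HOL functions.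
\<close>

definition dual_space ::
    "('a \<Rightarrow> complex) set \<Rightarrow> (('a \<Rightarrow> complex) \<Rightarrow> real) \<Rightarrow> (('a \<Rightarrow> complex) \<Rightarrow> complex) set" where
  "dual_space V p = {l.
     (\<forall>\<phi>\<in>V. \<forall>\<psi>\<in>V. l (\<lambda>x. \<phi> x + \<psi> x) = l \<phi> + l \<psi>) \<and>
     (\<forall>c. \<forall>\<phi>\<in>V. l (\<lambda>x. c * \<phi> x) = c * l \<phi>) \<and>
     (\<exists>K. \<forall>\<phi>\<in>V. cmod (l \<phi>) \<le> K * p \<phi>) \<and>
     (\<forall>\<phi>. \<phi> \<notin> V \<longrightarrow> l \<phi> = 0)}"

definition dual_norm ::
    "('a \<Rightarrow> complex) set \<Rightarrow> (('a \<Rightarrow> complex) \<Rightarrow> real) \<Rightarrow> (('a \<Rightarrow> complex) \<Rightarrow> complex) \<Rightarrow> real" where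
  "dual_norm V p l = (SUP \<phi>\<in>{\<phi> \<in> V. p \<phi> \<le> 1}. cmod (l \<phi>))"

end

theory Submission
  imports Defs
begin

text \<open>
  UITC makes the balls doubling, so the BMO norm of a compactly supported continuous \<open>\<phi>\<close> is
  comparable to a supremum over one countable, locally finite family of balls \<open>B\<^sub>n\<close> (centres in nets at
  dyadic scales) of the normalised \<open>L\<^sup>2\<close> norms of \<open>\<phi> - (\<phi>)\<^bsub>B\<^sub>n\<^esub>\<close>, or of \<open>\<phi>\<close> itself if \<open>B\<^sub>n\<close> is near \<open>D\<close>.
  These norms tend to 0, so \<open>\<phi>\<close> embeds into the \<open>c\<^sub>0\<close> sum of the spaces \<open>L\<^sup>2(B\<^sub>n)\<close>. A bounded
  functional on VMO extends by Hahn-Banach to this sum, whose dual is the \<open>\<ell>\<^sup>1\<close> sum of the \<open>L\<^sup>2(B\<^sub>n)\<close>;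
  its components, after subtracting means on the balls not near \<open>D\<close>, are multiples of atoms, and
  the \<open>\<ell>\<^sup>1\<close> bound says that they add up to an element of the Hardy space. No compactness argument
  and no separate proof of the duality between the Hardy space and BMO is needed.
\<close>

section \<open>Square integrable functions\<close>

text \<open>The \<open>c0\<close> condition is what rules out singular functionals. The sup-normed
  sum of the L2 spaces carries bounded functionals that vanish on all finitely supported sequences,
  and no Hardy function represents those; on sequences whose norms tend to 0 they are invisible. So
  the heart of the matter is the decay of the normalised L2 norms, which needs a family of balls
  that is rich enough to control every ball and yet has few members at each place and scale. The
  constant of the norm equivalence has one source. The mean is the best constant in L2, so
  oscillation over a ball is bounded by oscillation over a larger member of the family, times the
  square root of the volume ratio. Hahn-Banach and Riesz are used over the reals, for the real part
  of the functional; testing with \<i> times \<phi> returns the imaginary part. Working with graphs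
  removes any need to show that the embedding of test functions is injective: a linear graph
  dominated by a sublinear function is single valued.\<close>

definition L2 :: "'b measure \<Rightarrow> ('b \<Rightarrow> 'c::euclidean_space) set" where
  "L2 M = {f \<in> borel_measurable M. integrable M (\<lambda>x. (norm (f x))\<^sup>2)}"

text \<open>Functions are not identified modulo null sets, so this is a seminorm only. The arguments
  below are arranged so that a seminorm suffices.\<close>

definition l2_norm :: "'b measure \<Rightarrow> ('b \<Rightarrow> 'c::euclidean_space) \<Rightarrow> real" where
  "l2_norm M f = sqrt (LINT x|M. (norm (f x))\<^sup>2)"

text \<open>For complex values the inner product of \<complex> as a real plane is meant, so this is
  the real part of the hermitian product.\<close>

definition l2_inner :: "'b measure \<Rightarrow> ('b \<Rightarrow> 'c::euclidean_space) \<Rightarrow> ('b \<Rightarrow> 'c) \<Rightarrow> real" where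
  "l2_inner M f g = (LINT x|M. f x \<bullet> g x)"

lemma L2_measurable: "f \<in> L2 M \<Longrightarrow> f \<in> borel_measurable M"
  and L2_integrable: "f \<in> L2 M \<Longrightarrow> integrable M (\<lambda>x. (norm (f x))\<^sup>2)"
  by (auto simp: L2_def)

lemma L2_bound:
  assumes "f \<in> borel_measurable M" "integrable M h" "\<And>x. x \<in> space M \<Longrightarrow> (norm (f x))\<^sup>2 \<le> h x"
  shows "f \<in> L2 M"
  unfolding L2_def
proof (intro CollectI conjI assms(1))
  note [measurable] = assms(1)
  show "integrable M (\<lambda>x. (norm (f x))\<^sup>2)"
    by (rule Bochner_Integration.integrable_bound[OF assms(2)])
      (use assms(3) in \<open>auto intro!: AE_I2 order_trans[OF _ abs_ge_self]\<close>)
qed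

lemma L2_add:
  assumes "f \<in> L2 M" "g \<in> L2 M"
  shows "(\<lambda>x. f x + g x) \<in> L2 M"
proof (rule L2_bound)
  note [measurable] = assms[THEN L2_measurable]
  show "(\<lambda>x. f x + g x) \<in> borel_measurable M" by measurable
  show "integrable M (\<lambda>x. 2 * ((norm (f x))\<^sup>2 + (norm (g x))\<^sup>2))"
    using assms[THEN L2_integrable] by auto
  fix x
  have "norm (f x + g x) ^ 2 \<le> (norm (f x) + norm (g x))^2"
    by (intro power_mono norm_triangle_ineq) auto
  also have "\<dots> \<le> 2 * ((norm (f x))\<^sup>2 + (norm (g x))\<^sup>2)"
    using sum_squares_bound[of "norm (f x)" "norm (g x)"] by (simp add: power2_sum)
  finally show "norm (f x + g x) ^ 2 \<le> 2 * ((norm (f x))\<^sup>2 + (norm (g x))\<^sup>2)" .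
qed

lemma L2_scaleR: "f \<in> L2 M \<Longrightarrow> (\<lambda>x. c *\<^sub>R f x) \<in> L2 M"
  by (auto simp: L2_def power_mult_distrib)

lemma L2_cmult:
  fixes f :: "'b \<Rightarrow> complex"
  shows "f \<in> L2 M \<Longrightarrow> (\<lambda>x. c * f x) \<in> L2 M"
  by (auto simp: L2_def norm_mult power_mult_distrib)

lemma L2_zero: "(\<lambda>x. 0) \<in> L2 M"
  by (auto simp: L2_def)

lemma L2_diff: "f \<in> L2 M \<Longrightarrow> g \<in> L2 M \<Longrightarrow> (\<lambda>x. f x - g x) \<in> L2 M"
  using L2_add[of f M "\<lambda>x. (-1) *\<^sub>R g x"] L2_scaleR[of g M "-1"] by simp

lemma L2_norm_fun:
  "f \<in> L2 M \<Longrightarrow> (\<lambda>x. norm (f x)) \<in> L2 M"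
  by (auto simp: L2_def)

lemma l2_inner_integrable:
  assumes "f \<in> L2 M" "g \<in> L2 M"
  shows "integrable M (\<lambda>x. f x \<bullet> g x)"
proof (rule Bochner_Integration.integrable_bound)
  note [measurable] = assms[THEN L2_measurable]
  show "integrable M (\<lambda>x. (norm (f x))\<^sup>2 + (norm (g x))\<^sup>2)"
    using assms[THEN L2_integrable] by auto
  show "(\<lambda>x. f x \<bullet> g x) \<in> borel_measurable M" by measurable
  have "\<bar>f x \<bullet> g x\<bar> \<le> (norm (f x))\<^sup>2 + (norm (g x))\<^sup>2" for x
    using Cauchy_Schwarz_ineq2[of "f x" "g x"] sum_squares_bound[of "norm (f x)" "norm (g x)"]
      mult_nonneg_nonneg[OF norm_ge_zero[of "f x"] norm_ge_zero[of "g x"]] by linarith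
  then show "AE x in M. norm (f x \<bullet> g x) \<le> norm ((norm (f x))\<^sup>2 + (norm (g x))\<^sup>2)"
    by simp
qed

lemma l2_norm_nonneg [simp]: "0 \<le> l2_norm M f"
  by (simp add: l2_norm_def)

lemma l2_norm_power2: "(l2_norm M f)\<^sup>2 = (LINT x|M. (norm (f x))\<^sup>2)"
  by (simp add: l2_norm_def)

lemma l2_norm_scaleR: "l2_norm M (\<lambda>x. c *\<^sub>R f x) = \<bar>c\<bar> * l2_norm M f"
  by (simp add: l2_norm_def power_mult_distrib real_sqrt_mult)

lemma l2_norm_zero [simp]: "l2_norm M (\<lambda>x. 0) = 0"
  by (simp add: l2_norm_def)

lemma l2_inner_self: "l2_inner M f f = (l2_norm M f)\<^sup>2"
  by (simp add: l2_inner_def l2_norm_power2 power2_norm_eq_inner)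

lemma l2_inner_commute: "l2_inner M f g = l2_inner M g f"
  by (simp add: l2_inner_def inner_commute)

lemma l2_inner_add_left:
  "f \<in> L2 M \<Longrightarrow> g \<in> L2 M \<Longrightarrow> h \<in> L2 M \<Longrightarrow>
    l2_inner M (\<lambda>x. f x + g x) h = l2_inner M f h + l2_inner M g h"
  by (simp add: l2_inner_def inner_add_left l2_inner_integrable)

lemma l2_inner_add_right:
  "f \<in> L2 M \<Longrightarrow> g \<in> L2 M \<Longrightarrow> h \<in> L2 M \<Longrightarrow>
    l2_inner M h (\<lambda>x. f x + g x) = l2_inner M h f + l2_inner M h g"
  by (simp add: l2_inner_def inner_add_right l2_inner_integrable)

lemma l2_inner_scaleR_right: "l2_inner M f (\<lambda>x. c *\<^sub>R g x) = c * l2_inner M f g"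
  by (simp add: l2_inner_def)

lemma l2_norm_add_power2:
  assumes "f \<in> L2 M" "g \<in> L2 M"
  shows "(l2_norm M (\<lambda>x. f x + g x))\<^sup>2 = (l2_norm M f)\<^sup>2 + 2 * l2_inner M f g + (l2_norm M g)\<^sup>2"
  using assms
  by (simp add: l2_inner_self[symmetric] l2_inner_add_left l2_inner_add_right L2_add
      l2_inner_commute[of M g f])

text \<open>The usual discriminant argument for the nonnegative quadratic polynomial t \<mapsto>
  \<open>(l2_norm M (f + t g))\<close> squared.\<close>

lemma l2_cauchy_schwarz:
  assumes "f \<in> L2 M" "g \<in> L2 M"
  shows "\<bar>l2_inner M f g\<bar> \<le> l2_norm M f * l2_norm M g"
proof -
  define A B C where "A = (l2_norm M f)\<^sup>2" and "B = l2_inner M f g" and "C = (l2_norm M g)\<^sup>2"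
  have q: "0 \<le> A + 2 * t * B + t\<^sup>2 * C" for t
  proof -
    have "0 \<le> (l2_norm M (\<lambda>x. f x + t *\<^sub>R g x))\<^sup>2" by simp
    also have "\<dots> = A + 2 * t * B + t\<^sup>2 * C"
      using assms by (subst l2_norm_add_power2)
        (auto intro: L2_scaleR simp: l2_norm_scaleR l2_inner_scaleR_right A_def B_def C_def power_mult_distrib)
    finally show ?thesis .
  qed
  have C0: "0 \<le> C" by (simp add: C_def)
  have "B\<^sup>2 \<le> A * C"
  proof (cases "C = 0")
    case True
    \<comment> \<open>A function of seminorm 0 need not vanish, so this case is not trivial. The
      polynomial is affine here, and at the chosen point it would take the value -1.\<close>
    have "B = 0"
    proof (rule ccontr)
      assume "B \<noteq> 0"
      then show False using q[of "- (A + 1) / (2 * B)"] True by (simp add: field_simps)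
    qed
    then show ?thesis using True by simp
  next
    case False
    then show ?thesis using q[of "- B / C"] C0
      by (simp add: field_simps power2_eq_square)
  qed
  also have "A * C = (l2_norm M f * l2_norm M g)\<^sup>2"
    by (simp add: A_def C_def power_mult_distrib)
  finally show ?thesis
    unfolding B_def by (metis abs_le_square_iff abs_of_nonneg l2_norm_nonneg mult_nonneg_nonneg)
qed

lemma l2_norm_triangle:
  assumes "f \<in> L2 M" "g \<in> L2 M"
  shows "l2_norm M (\<lambda>x. f x + g x) \<le> l2_norm M f + l2_norm M g"
proof (rule power2_le_imp_le)
  show "(l2_norm M (\<lambda>x. f x + g x))\<^sup>2 \<le> (l2_norm M f + l2_norm M g)\<^sup>2"
    using l2_cauchy_schwarz[OF assms] by (simp add: l2_norm_add_power2[OF assms] power2_sum)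
qed auto

lemma l2_norm_triangle_diff:
  assumes "f \<in> L2 M" "g \<in> L2 M"
  shows "l2_norm M (\<lambda>x. f x - g x) \<le> l2_norm M f + l2_norm M g"
  using l2_norm_triangle[OF assms(1) L2_scaleR[OF assms(2), of "-1"]] l2_norm_scaleR[of M "-1" g] by simp

lemma l2_parallelogram:
  assumes "f \<in> L2 M" "g \<in> L2 M"
  shows "(l2_norm M (\<lambda>x. f x - g x))\<^sup>2 + (l2_norm M (\<lambda>x. f x + g x))\<^sup>2
    = 2 * (l2_norm M f)\<^sup>2 + 2 * (l2_norm M g)\<^sup>2"
  using l2_norm_add_power2[OF assms] l2_norm_add_power2[OF assms(1) L2_scaleR[OF assms(2), of "-1"]]
    l2_norm_scaleR[of M "-1" g] l2_inner_scaleR_right[of M f "-1" g] by simp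

lemma l2_norm_mono:
  assumes "g \<in> L2 M" "f \<in> borel_measurable M" "\<And>x. x \<in> space M \<Longrightarrow> norm (f x) \<le> norm (g x)"
  shows "f \<in> L2 M" "l2_norm M f \<le> l2_norm M g"
proof -
  show f: "f \<in> L2 M"
    by (rule L2_bound[OF assms(2) L2_integrable[OF assms(1)]]) (use assms(3) in auto)
  show "l2_norm M f \<le> l2_norm M g"
    unfolding l2_norm_def
    by (intro real_sqrt_le_mono integral_mono L2_integrable f assms power_mono) auto
qed

text \<open>Lower semicontinuity of the norm under pointwise convergence almost everywhere. It lets
  a Cauchy estimate pass to the limit without a dominating function.\<close>

lemma l2_fatou:
  assumes f: "\<And>n. f n \<in> L2 M" and g: "g \<in> borel_measurable M"
    and lim: "AE x in M. (\<lambda>n. f n x) \<longlonglongrightarrow> g x" and le: "\<And>n. l2_norm M (f n) \<le> B"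
  shows "g \<in> L2 M" "l2_norm M g \<le> B"
proof -
  note [measurable] = L2_measurable[OF f] g
  have B0: "0 \<le> B" using le[of 0] l2_norm_nonneg[of M "f 0"] by linarith
  have "(\<integral>\<^sup>+x. ennreal ((norm (g x))\<^sup>2) \<partial>M) = (\<integral>\<^sup>+x. liminf (\<lambda>n. ennreal ((norm (f n x))\<^sup>2)) \<partial>M)"
  proof (rule nn_integral_cong_AE, use lim in eventually_elim)
    fix x assume "(\<lambda>n. f n x) \<longlonglongrightarrow> g x"
    then have "(\<lambda>n. ennreal ((norm (f n x))\<^sup>2)) \<longlonglongrightarrow> ennreal ((norm (g x))\<^sup>2)"
      by (intro tendsto_intros tendsto_ennrealI)
    then show "ennreal ((norm (g x))\<^sup>2) = liminf (\<lambda>n. ennreal ((norm (f n x))\<^sup>2))"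
      by (metis lim_imp_Liminf trivial_limit_sequentially)
  qed
  also have "\<dots> \<le> liminf (\<lambda>n. \<integral>\<^sup>+x. ennreal ((norm (f n x))\<^sup>2) \<partial>M)"
    by (rule nn_integral_liminf) measurable
  also have "\<dots> \<le> limsup (\<lambda>n. \<integral>\<^sup>+x. ennreal ((norm (f n x))\<^sup>2) \<partial>M)"
    by (rule Liminf_le_Limsup) simp
  also have "\<dots> \<le> ennreal (B\<^sup>2)"
  proof (rule Limsup_bounded, intro always_eventually allI)
    fix n
    have "(\<integral>\<^sup>+x. ennreal ((norm (f n x))\<^sup>2) \<partial>M) = ennreal ((l2_norm M (f n))\<^sup>2)"
      by (simp add: l2_norm_power2 nn_integral_eq_integral[OF L2_integrable[OF f]])
    also have "\<dots> \<le> ennreal (B\<^sup>2)"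
      by (intro ennreal_leI power_mono le) auto
    finally show "(\<integral>\<^sup>+x. ennreal ((norm (f n x))\<^sup>2) \<partial>M) \<le> ennreal (B\<^sup>2)" .
  qed
  finally have *: "(\<integral>\<^sup>+x. ennreal ((norm (g x))\<^sup>2) \<partial>M) \<le> ennreal (B\<^sup>2)" .
  have int: "integrable M (\<lambda>x. (norm (g x))\<^sup>2)"
    by (rule integrableI_bounded) (use * in \<open>auto simp: le_less_trans\<close>)
  then show "g \<in> L2 M" by (simp add: L2_def g)
  have "ennreal (LINT x|M. (norm (g x))\<^sup>2) \<le> ennreal (B\<^sup>2)"
    using * by (simp add: nn_integral_eq_integral[OF int])
  then have "(LINT x|M. (norm (g x))\<^sup>2) \<le> B\<^sup>2"
    by (simp add: ennreal_le_iff)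
  then show "l2_norm M g \<le> B"
    unfolding l2_norm_def using B0 by (simp add: real_le_lsqrt)
qed

text \<open>With the weights \<open>4^n\<close> the integrals of the squared increments still sum
  like \<open>(1/2)^n\<close>. Hence almost everywhere the weighted sum is finite; it bounds each of
  its terms, so the increments decay like \<open>(1/2)^n\<close> and telescope to a convergent
  sequence.\<close>

lemma l2_fast_cauchy_AE_convergent:
  fixes f :: "nat \<Rightarrow> 'b \<Rightarrow> 'c::euclidean_space"
  assumes f: "\<And>n. f n \<in> L2 M"
    and fast: "\<And>n. (l2_norm M (\<lambda>x. f (Suc n) x - f n x))\<^sup>2 \<le> (1/8)^n"
  shows "AE x in M. convergent (\<lambda>n. f n x)"
proof -
  note [measurable] = L2_measurable[OF f]
  let ?d = "\<lambda>n x. f (Suc n) x - f n x"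
  have eq: "(\<integral>\<^sup>+x. ennreal (4^n * (norm (?d n x))\<^sup>2) \<partial>M) \<le> ennreal ((1/2)^n)" for n
  proof -
    have int: "integrable M (\<lambda>x. 4^n * (norm (?d n x))\<^sup>2)"
      by (intro integrable_mult_right L2_integrable L2_diff f)
    have "(LINT x|M. 4^n * (norm (?d n x))\<^sup>2) \<le> 4^n * (1/8)^n"
      using fast[of n] by (simp add: l2_norm_power2)
    also have "4^n * (1/8)^n = (1/2::real)^n"
      by (simp add: power_mult_distrib[symmetric])
    finally show ?thesis
      by (subst nn_integral_eq_integral[OF int]) (auto intro: ennreal_leI)
  qed
  have "(\<integral>\<^sup>+x. (\<Sum>n. ennreal (4^n * (norm (?d n x))\<^sup>2)) \<partial>M)
      = (\<Sum>n. \<integral>\<^sup>+x. ennreal (4^n * (norm (?d n x))\<^sup>2) \<partial>M)"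
    by (rule nn_integral_suminf) measurable
  also have "\<dots> \<le> (\<Sum>n. ennreal ((1/2)^n))"
    by (intro suminf_le eq) auto
  also have "\<dots> = ennreal (\<Sum>n. (1/2)^n)"
    by (rule suminf_ennreal2) (auto intro: summable_geometric)
  also have "\<dots> < \<infinity>" by simp
  finally have "AE x in M. (\<Sum>n. ennreal (4^n * (norm (?d n x))\<^sup>2)) \<noteq> \<infinity>"
    by (intro nn_integral_PInf_AE) auto
  then show ?thesis
  proof eventually_elim
    fix x
    assume "(\<Sum>n. ennreal (4^n * (norm (?d n x))\<^sup>2)) \<noteq> \<infinity>"
    then have s: "summable (\<lambda>n. 4^n * (norm (?d n x))\<^sup>2)"
      by (intro summable_suminf_not_top) auto
    define S where "S = (\<Sum>n. 4^n * (norm (?d n x))\<^sup>2)"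
    have "4^n * (norm (?d n x))\<^sup>2 \<le> S" for n
      unfolding S_def using sum_le_suminf[OF s, of "{n}"] by simp
    then have dle: "norm (?d n x) \<le> sqrt S * (1/2)^n" for n
    proof -
      have "(2^n * norm (?d n x))\<^sup>2 \<le> S"
        using \<open>4^n * (norm (?d n x))\<^sup>2 \<le> S\<close>
        by (simp add: power_mult_distrib power_mult[symmetric] mult.commute[of n] power_mult)
      then have "2^n * norm (?d n x) \<le> sqrt S" by (rule real_le_rsqrt)
      then show ?thesis by (simp add: field_simps power_one_over)
    qed
    have "summable (\<lambda>n. ?d n x)"
    proof (rule summable_comparison_test'[where N = 0])
      show "summable (\<lambda>n. sqrt S * (1/2)^n)"
        by (rule summable_mult[OF summable_geometric]) simp
      show "norm (?d n x) \<le> sqrt S * (1/2)^n" for n by (rule dle)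
    qed
    then have "convergent (\<lambda>n. f n x - f 0 x)"
      unfolding summable_iff_convergent sum_lessThan_telescope[of "\<lambda>n. f n x"] .
    then show "convergent (\<lambda>n. f n x)"
      using convergent_diff_const_right_iff[of "\<lambda>n. f n x" "f 0 x"] by blast
  qed
qed

lemma l2_complete:
  fixes f :: "nat \<Rightarrow> 'b \<Rightarrow> 'c::euclidean_space"
  assumes f: "\<And>n. f n \<in> L2 M"
    and cauchy: "\<And>e. e > 0 \<Longrightarrow> \<exists>N. \<forall>m\<ge>N. \<forall>n\<ge>N. l2_norm M (\<lambda>x. f m x - f n x) < e"
  obtains g where "g \<in> L2 M" "(\<lambda>n. l2_norm M (\<lambda>x. f n x - g x)) \<longlonglongrightarrow> 0"
proof -
  have "\<exists>N. \<forall>m\<ge>N. \<forall>n\<ge>N. (l2_norm M (\<lambda>x. f m x - f n x))\<^sup>2 \<le> (1/8)^k" for k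
  proof -
    obtain N where N: "\<forall>m\<ge>N. \<forall>n\<ge>N. l2_norm M (\<lambda>x. f m x - f n x) < sqrt ((1/8)^k)"
      using cauchy[of "sqrt ((1/8)^k)"] by auto
    show ?thesis
    proof (intro exI[of _ N] allI impI)
      fix m n assume "N \<le> m" "N \<le> n"
      then have "(l2_norm M (\<lambda>x. f m x - f n x))\<^sup>2 \<le> (sqrt ((1/8)^k))\<^sup>2"
        using N by (intro power_mono) (auto intro: less_imp_le)
      then show "(l2_norm M (\<lambda>x. f m x - f n x))\<^sup>2 \<le> (1/8)^k" by simp
    qed
  qed
  then obtain N where N: "\<And>k m n. m \<ge> N k \<Longrightarrow> n \<ge> N k \<Longrightarrow> (l2_norm M (\<lambda>x. f m x - f n x))\<^sup>2 \<le> (1/8)^k"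
    by metis
  \<comment> \<open>The sum makes \<open>r\<close> monotone and at least \<open>N k\<close>, so that
    both \<open>r k\<close> and \<open>r (Suc k)\<close> lie beyond \<open>N k\<close>; the summand
    \<open>k\<close> forces \<open>r\<close> to infinity.\<close>
  define r where "r k = k + (\<Sum>j\<le>k. N j)" for k
  have r: "N k \<le> r k" "r k \<le> r (Suc k)" "k \<le> r k" for k
    using member_le_sum[of k "{..k}" N] by (auto simp: r_def)
  define h where "h k = f (r k)" for k
  have h: "h k \<in> L2 M" for k by (simp add: h_def f)
  have "AE x in M. convergent (\<lambda>k. h k x)"
  proof (rule l2_fast_cauchy_AE_convergent[OF h])
    fix n
    show "(l2_norm M (\<lambda>x. h (Suc n) x - h n x))\<^sup>2 \<le> (1/8)^n"
      unfolding h_def using r[of n] by (intro N) auto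
  qed
  then have lim: "AE x in M. (\<lambda>k. h k x) \<longlonglongrightarrow> lim (\<lambda>k. h k x)"
    by (simp add: convergent_LIMSEQ_iff)
  define g where "g x = lim (\<lambda>k. h k x)" for x
  note [measurable] = L2_measurable[OF h] L2_measurable[OF f]
  have g[measurable]: "g \<in> borel_measurable M" unfolding g_def by measurable
  \<comment> \<open>For fixed \<open>n\<close>, Fatou in the index of the subsequence
    \<open>h\<close> turns the Cauchy estimate into one for the distance to the limit.\<close>
  have *: "(\<lambda>x. f n x - g x) \<in> L2 M \<and> l2_norm M (\<lambda>x. f n x - g x) \<le> e"
    if "\<forall>m\<ge>K. \<forall>n\<ge>K. l2_norm M (\<lambda>x. f m x - f n x) < e" "n \<ge> K" for n K e
  proof -
    have "AE x in M. (\<lambda>k. f n x - h (k + K) x) \<longlonglongrightarrow> f n x - g x"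
      using lim unfolding g_def
      by eventually_elim (intro tendsto_intros LIMSEQ_ignore_initial_segment)
    moreover have "l2_norm M (\<lambda>x. f n x - h (k + K) x) \<le> e" for k
    proof -
      have "r (k + K) \<ge> K" using r(3)[of "k + K"] by linarith
      then show ?thesis unfolding h_def using that by (intro less_imp_le) auto
    qed
    ultimately show ?thesis
      using l2_fatou[of "\<lambda>k x. f n x - h (k + K) x" M "\<lambda>x. f n x - g x" e] by (auto intro: L2_diff f h)
  qed
  obtain K where K: "\<forall>m\<ge>K. \<forall>n\<ge>K. l2_norm M (\<lambda>x. f m x - f n x) < 1"
    using cauchy[of 1] by auto
  have gL: "g \<in> L2 M" using L2_diff[OF f[of K] conjunct1[OF *[OF K order_refl]]] by simp
  show thesis
  proof
    show "g \<in> L2 M" by fact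
    show "(\<lambda>n. l2_norm M (\<lambda>x. f n x - g x)) \<longlonglongrightarrow> 0"
    proof (rule LIMSEQ_I)
      fix e :: real assume "e > 0"
      then obtain K where "\<forall>m\<ge>K. \<forall>n\<ge>K. l2_norm M (\<lambda>x. f m x - f n x) < e/2"
        using cauchy[of "e/2"] by auto
      from *[OF this] show "\<exists>no. \<forall>n\<ge>no. norm (l2_norm M (\<lambda>x. f n x - g x) - 0) < e"
        using \<open>e > 0\<close> by (intro exI[of _ K]) force
    qed
  qed
qed

lemma l2_riesz:
  fixes L :: "('b \<Rightarrow> 'c::euclidean_space) \<Rightarrow> real"
  assumes add: "\<And>f g. f \<in> L2 M \<Longrightarrow> g \<in> L2 M \<Longrightarrow> L (\<lambda>x. f x + g x) = L f + L g"
    and scale: "\<And>c f. f \<in> L2 M \<Longrightarrow> L (\<lambda>x. c *\<^sub>R f x) = c * L f"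
    and bdd: "\<And>f. f \<in> L2 M \<Longrightarrow> L f \<le> K * l2_norm M f"
  obtains g where "g \<in> L2 M" "\<And>f. f \<in> L2 M \<Longrightarrow> L f = l2_inner M g f"
proof -
  \<comment> \<open>The representing function minimises the quadratic functional below.\<close>
  define Q where "Q f = (l2_norm M f)\<^sup>2 - 2 * L f" for f
  \<comment> \<open>Completing the square: \<open>Q f\<close> is at least the square of
    \<open>l2_norm M f - K\<close>, minus \<open>K\<close> squared.\<close>
  have Qlow: "Q f \<ge> - K\<^sup>2" if "f \<in> L2 M" for f
    using bdd[OF that] zero_le_power2[of "l2_norm M f - K"]
    by (simp add: Q_def power2_diff algebra_simps)
  define m where "m = Inf (Q ` L2 M)"
  have bb: "bdd_below (Q ` L2 M)" using Qlow by (intro bdd_belowI2)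
  have mle: "m \<le> Q f" if "f \<in> L2 M" for f
    unfolding m_def using bb that by (rule cINF_lower)
  have "\<exists>f\<in>L2 M. Q f < m + 1 / Suc n" for n
  proof -
    have "m < m + 1 / Suc n" by simp
    then show ?thesis unfolding m_def using bb L2_zero[of M]
      by (subst (asm) (1) cINF_less_iff) auto
  qed
  then obtain f where f: "\<And>n. f n \<in> L2 M" and fQ: "\<And>n. Q (f n) < m + 1 / Suc n" by metis
  \<comment> \<open>The midpoint of \<open>u\<close> and \<open>v\<close> also has \<open>Q\<close>
    at least \<open>m\<close>, so the parallelogram law makes near-minimisers close to each other.
    Minimising sequences are therefore Cauchy.\<close>
  have dist: "(l2_norm M (\<lambda>x. u x - v x))\<^sup>2 \<le> 2 * (Q u - m) + 2 * (Q v - m)"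
    if u: "u \<in> L2 M" and v: "v \<in> L2 M" for u v
  proof -
    have "m \<le> Q (\<lambda>x. (1/2) *\<^sub>R (u x + v x))" by (intro mle L2_scaleR L2_add u v)
    also have "\<dots> = (l2_norm M (\<lambda>x. u x + v x))\<^sup>2 / 4 - (L u + L v)"
      unfolding Q_def l2_norm_scaleR scale[OF L2_add[OF u v]] add[OF u v]
      by (simp add: power_mult_distrib power_divide add_divide_distrib)
    finally show ?thesis using l2_parallelogram[OF u v] by (simp add: Q_def)
  qed
  obtain g where g: "g \<in> L2 M" and lim: "(\<lambda>n. l2_norm M (\<lambda>x. f n x - g x)) \<longlonglongrightarrow> 0"
  proof (rule l2_complete[OF f])
    fix e :: real assume e: "e > 0"
    then obtain N :: nat where N: "4 / e\<^sup>2 < real N"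
      using reals_Archimedean2 by blast
    show "\<exists>N. \<forall>m\<ge>N. \<forall>n\<ge>N. l2_norm M (\<lambda>x. f m x - f n x) < e"
    proof (intro exI[of _ N] allI impI)
      fix i j assume ij: "N \<le> i" "N \<le> j"
      have small: "1 / Suc k < e\<^sup>2 / 4" if "N \<le> k" for k
      proof -
        have "4 / e\<^sup>2 < Suc k" using N that by linarith
        then show ?thesis using e by (simp add: field_simps)
      qed
      have "Q (f i) - m < e\<^sup>2 / 4" "Q (f j) - m < e\<^sup>2 / 4"
        using fQ[of i] fQ[of j] small[OF ij(1)] small[OF ij(2)] by linarith+
      then have "2 * (Q (f i) - m) + 2 * (Q (f j) - m) < 2 * (e\<^sup>2 / 4) + 2 * (e\<^sup>2 / 4)"
        by (intro add_strict_mono mult_strict_left_mono) auto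
      also have "\<dots> = e\<^sup>2" by simp
      finally have "(l2_norm M (\<lambda>x. f i x - f j x))\<^sup>2 < e\<^sup>2"
        by (rule le_less_trans[OF dist[OF f f]])
      then show "l2_norm M (\<lambda>x. f i x - f j x) < e"
        using e by (simp add: power2_less_imp_less)
    qed
  qed
  have Qg: "Q g \<le> m"
  proof (rule LIMSEQ_le_const)
    let ?d = "\<lambda>n. l2_norm M (\<lambda>x. f n x - g x)"
    \<comment> \<open>The error terms: \<open>1 / Suc n\<close> from near-minimality of
      \<open>f n\<close>, the terms with the square of \<open>?d n\<close> and with
      \<open>l2_norm M g\<close> from expanding the square of \<open>l2_norm M (f n) + ?d n\<close>,
      and \<open>2 * K * ?d n\<close> from the bound on \<open>L\<close>. Only an upper bound for
      \<open>L (f n - g)\<close> is needed.\<close>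
    let ?b = "\<lambda>n. m + inverse (real (Suc n)) + 2 * (l2_norm M g + ?d n) * ?d n + (?d n)\<^sup>2 + 2 * K * ?d n"
    have "?b \<longlonglongrightarrow> m + 0 + 2 * (l2_norm M g + 0) * 0 + 0\<^sup>2 + 2 * K * 0"
      by (intro tendsto_intros lim LIMSEQ_inverse_real_of_nat)
    then show "?b \<longlonglongrightarrow> m" by simp
    have "Q g \<le> ?b n" for n
    proof -
      have d: "(\<lambda>x. f n x - g x) \<in> L2 M" by (intro L2_diff f g)
      have ng: "l2_norm M g \<le> l2_norm M (f n) + ?d n"
        using l2_norm_triangle_diff[OF f d, of n] by simp
      have nf: "l2_norm M (f n) \<le> l2_norm M g + ?d n"
        using l2_norm_triangle[OF g d] by simp
      have "L (f n) = L g + L (\<lambda>x. f n x - g x)"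
        using add[OF g d] by simp
      then have "Q g \<le> (l2_norm M g)\<^sup>2 - 2 * (L (f n) - K * ?d n)"
        using bdd[OF d] by (simp add: Q_def)
      moreover have "(l2_norm M g)\<^sup>2 \<le> (l2_norm M (f n) + ?d n)\<^sup>2"
        using ng by (intro power_mono) auto
      moreover have "2 * l2_norm M (f n) * ?d n \<le> 2 * (l2_norm M g + ?d n) * ?d n"
        using nf by (intro mult_right_mono) auto
      ultimately show ?thesis
        using fQ[of n] by (simp add: Q_def power2_sum inverse_eq_divide algebra_simps)
    qed
    then show "\<exists>N. \<forall>n\<ge>N. Q g \<le> ?b n" by blast
  qed
  have "L h = l2_inner M g h" if h: "h \<in> L2 M" for h
  proof -
    define b where "b = l2_inner M g h - L h"
    define C where "C = (l2_norm M h)\<^sup>2"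
    \<comment> \<open>First variation at the minimiser in direction \<open>h\<close>. Below,
      \<open>C + 1\<close> takes the place of \<open>C\<close> in the optimal \<open>t\<close>,
      since \<open>C\<close> may vanish.\<close>
    have q: "0 \<le> 2 * t * b + t\<^sup>2 * C" for t
    proof -
      have th: "(\<lambda>x. t *\<^sub>R h x) \<in> L2 M" by (intro L2_scaleR h)
      have "Q g \<le> Q (\<lambda>x. g x + t *\<^sub>R h x)"
        using Qg mle[OF L2_add[OF g th]] by linarith
      then show ?thesis
        by (simp add: Q_def l2_norm_add_power2[OF g th] add[OF g th] scale[OF h] l2_norm_scaleR
            l2_inner_scaleR_right power_mult_distrib b_def C_def algebra_simps)
    qed
    have C: "0 \<le> C" by (simp add: C_def)
    have "0 \<le> - (b\<^sup>2 * (C + 2)) / (C + 1)\<^sup>2"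
    proof -
      have "2 * (- b / (C + 1)) * b + (- b / (C + 1))\<^sup>2 * C = - (b\<^sup>2 * (C + 2)) / (C + 1)\<^sup>2"
        using C by (simp add: divide_simps) (simp add: power2_eq_square algebra_simps)
      then show ?thesis using q[of "- b / (C + 1)"] by simp
    qed
    then have "b\<^sup>2 * (C + 2) \<le> 0"
      using C by (simp add: field_simps zero_le_divide_iff mult_le_0_iff)
    then have "b = 0"
      using C by (simp add: mult_le_0_iff)
    then show ?thesis by (simp add: b_def)
  qed
  with g show thesis by (rule that)
qed

section \<open>The Hahn-Banach theorem\<close>

definition fun_subspace :: "('i \<Rightarrow> 'c::real_vector) set \<Rightarrow> bool" where
  "fun_subspace V \<longleftrightarrow> V \<noteq> {} \<and> (\<forall>x\<in>V. \<forall>y\<in>V. (\<lambda>i. x i + y i) \<in> V) \<and> (\<forall>c. \<forall>x\<in>V. (\<lambda>i. c *\<^sub>R x i) \<in> V)"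

text \<open>Partially defined functionals are represented by their graphs, which Zorn's lemma orders by inclusion.\<close>

definition graph_subspace :: "(('i \<Rightarrow> 'c::real_vector) \<times> real) set \<Rightarrow> bool" where
  "graph_subspace G \<longleftrightarrow> G \<noteq> {} \<and>
     (\<forall>x r y s. (x, r) \<in> G \<longrightarrow> (y, s) \<in> G \<longrightarrow> (\<lambda>i. x i + y i, r + s) \<in> G) \<and>
     (\<forall>c x r. (x, r) \<in> G \<longrightarrow> (\<lambda>i. c *\<^sub>R x i, c * r) \<in> G)"

lemma graph_subspace_add:
  "graph_subspace G \<Longrightarrow> (x, r) \<in> G \<Longrightarrow> (y, s) \<in> G \<Longrightarrow> (\<lambda>i. x i + y i, r + s) \<in> G"
  and graph_subspace_scale: "graph_subspace G \<Longrightarrow> (x, r) \<in> G \<Longrightarrow> (\<lambda>i. c *\<^sub>R x i, c * r) \<in> G"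
  by (auto simp: graph_subspace_def)

lemma graph_subspace_diff:
  "graph_subspace G \<Longrightarrow> (x, r) \<in> G \<Longrightarrow> (y, s) \<in> G \<Longrightarrow> (\<lambda>i. x i - y i, r - s) \<in> G"
  using graph_subspace_add[of G x r "\<lambda>i. (-1) *\<^sub>R y i" "(-1) * s"] graph_subspace_scale[of G y s "-1"]
  by simp

lemma graph_subspace_zero: "graph_subspace G \<Longrightarrow> (\<lambda>i. 0, 0) \<in> G"
  using graph_subspace_scale[of G _ _ 0] by (fastforce simp: graph_subspace_def)

text \<open>Adjoining one vector. Its value must lie above every \<open>s - p (y - v)\<close> and
  below every \<open>p (x + v) - r\<close>, and subadditivity says that these requirements are
  compatible. It is not excluded that \<open>v\<close> already lies in the domain of
  \<open>G\<close>.\<close>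

lemma hahn_banach_extend:
  fixes p :: "('i \<Rightarrow> 'c::real_vector) \<Rightarrow> real"
  assumes V: "fun_subspace V"
    and sub: "\<And>x y. x \<in> V \<Longrightarrow> y \<in> V \<Longrightarrow> p (\<lambda>i. x i + y i) \<le> p x + p y"
    and hom: "\<And>c x. x \<in> V \<Longrightarrow> c > 0 \<Longrightarrow> p (\<lambda>i. c *\<^sub>R x i) = c * p x"
    and G: "graph_subspace G" "fst ` G \<subseteq> V" and le: "\<And>x r. (x, r) \<in> G \<Longrightarrow> r \<le> p x"
    and v: "v \<in> V"
  obtains H where "graph_subspace H" "fst ` H \<subseteq> V" "\<And>x r. (x, r) \<in> H \<Longrightarrow> r \<le> p x" "G \<subseteq> H" "v \<in> fst ` H"
proof -
  have Vadd: "\<And>x y. x \<in> V \<Longrightarrow> y \<in> V \<Longrightarrow> (\<lambda>i. x i + y i) \<in> V"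
    and Vsc: "\<And>c x. x \<in> V \<Longrightarrow> (\<lambda>i. c *\<^sub>R x i) \<in> V"
    using V by (auto simp: fun_subspace_def)
  have Vdiff: "(\<lambda>i. x i - y i) \<in> V" if "x \<in> V" "y \<in> V" for x y
    using Vadd[OF that(1) Vsc[OF that(2), of "-1"]] by simp
  have GV: "x \<in> V" if "(x, r) \<in> G" for x r using G(2) that by force
  let ?lo = "\<lambda>(y, s). s - p (\<lambda>i. y i - v i)"
  have sep: "s - p (\<lambda>i. y i - v i) \<le> p (\<lambda>i. x i + v i) - r" if "(x, r) \<in> G" "(y, s) \<in> G" for x r y s
  proof -
    have "r + s \<le> p (\<lambda>i. x i + y i)" using graph_subspace_add[OF G(1) that] by (rule le)
    also have "(\<lambda>i. x i + y i) = (\<lambda>i. (x i + v i) + (y i - v i))" by auto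
    also have "p \<dots> \<le> p (\<lambda>i. x i + v i) + p (\<lambda>i. y i - v i)"
      by (intro sub Vadd Vdiff v) (use GV that in auto)
    finally show ?thesis by simp
  qed
  \<comment> \<open>Any number between the lower and the upper bounds would do; the least one is
    taken.\<close>
  define \<alpha> where "\<alpha> = Sup (?lo ` G)"
  have z: "(\<lambda>i. 0, 0) \<in> G" by (rule graph_subspace_zero[OF G(1)])
  have bdd: "bdd_above (?lo ` G)"
    using sep[OF z] by (auto intro!: bdd_aboveI2)
  have \<alpha>1: "s - p (\<lambda>i. y i - v i) \<le> \<alpha>" if "(y, s) \<in> G" for y s
    unfolding \<alpha>_def using cSUP_upper[OF that bdd] by simp
  have \<alpha>2: "\<alpha> \<le> p (\<lambda>i. x i + v i) - r" if "(x, r) \<in> G" for x r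
    unfolding \<alpha>_def using z sep[OF that] by (intro cSUP_least) auto
  define H where "H = {(\<lambda>i. x i + t *\<^sub>R v i, r + t * \<alpha>) | x r t. (x, r) \<in> G}"
  have HI: "(\<lambda>i. x i + t *\<^sub>R v i, r + t * \<alpha>) \<in> H" if "(x, r) \<in> G" for x r t
    unfolding H_def using that by blast
  show thesis
  proof
    show "graph_subspace H"
      unfolding graph_subspace_def
    proof (intro conjI allI impI)
      show "H \<noteq> {}" using HI[OF z] by auto
    next
      fix x r y s assume "(x, r) \<in> H" "(y, s) \<in> H"
      then obtain x' r' t y' s' t' where *: "(x', r') \<in> G" "(y', s') \<in> G"
        "x = (\<lambda>i. x' i + t *\<^sub>R v i)" "r = r' + t * \<alpha>" "y = (\<lambda>i. y' i + t' *\<^sub>R v i)" "s = s' + t' * \<alpha>"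
        unfolding H_def by auto
      then show "(\<lambda>i. x i + y i, r + s) \<in> H"
        using HI[OF graph_subspace_add[OF G(1) *(1,2)], of "t + t'"] by (simp add: algebra_simps)
    next
      fix c x r assume "(x, r) \<in> H"
      then obtain x' r' t where *: "(x', r') \<in> G" "x = (\<lambda>i. x' i + t *\<^sub>R v i)" "r = r' + t * \<alpha>"
        unfolding H_def by auto
      then show "(\<lambda>i. c *\<^sub>R x i, c * r) \<in> H"
        using HI[OF graph_subspace_scale[OF G(1) *(1), of c], of "c * t"] by (simp add: algebra_simps)
    qed
    show "fst ` H \<subseteq> V" unfolding H_def using GV by (auto intro!: Vadd Vsc v)
    show "G \<subseteq> H" using HI[of _ _ 0] by auto
    show "v \<in> fst ` H" using HI[OF z, of 1] by force
    fix y s assume "(y, s) \<in> H"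
    then obtain x r t where *: "(x, r) \<in> G" "y = (\<lambda>i. x i + t *\<^sub>R v i)" "s = r + t * \<alpha>"
      unfolding H_def by auto
    \<comment> \<open>Dividing by the modulus of \<open>t\<close> reduces to a coefficient 1 or -1
      of \<open>v\<close>: the first is governed by the upper bounds on \<alpha>, the second by the
      lower ones.\<close>
    consider "t = 0" | "t > 0" | "t < 0" by linarith
    then show "s \<le> p y"
    proof cases
      case 1
      then show ?thesis using * le by simp
    next
      case 2
      have "(\<lambda>i. inverse t *\<^sub>R x i, inverse t * r) \<in> G" by (rule graph_subspace_scale[OF G(1) *(1)])
      from \<alpha>2[OF this] have "t * \<alpha> \<le> t * (p (\<lambda>i. inverse t *\<^sub>R x i + v i) - inverse t * r)"
        using 2 by (intro mult_left_mono) auto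
      moreover have "t * p (\<lambda>i. inverse t *\<^sub>R x i + v i) = p (\<lambda>i. t *\<^sub>R (inverse t *\<^sub>R x i + v i))"
        using 2 by (intro hom[symmetric] Vadd Vsc v GV[OF *(1)])
      ultimately show ?thesis using 2 * by (simp add: algebra_simps)
    next
      case 3
      define u where "u = - t"
      have u: "u > 0" "t = - u" using 3 by (auto simp: u_def)
      have "(\<lambda>i. inverse u *\<^sub>R x i, inverse u * r) \<in> G" by (rule graph_subspace_scale[OF G(1) *(1)])
      from \<alpha>1[OF this] have "u * (inverse u * r - p (\<lambda>i. inverse u *\<^sub>R x i - v i)) \<le> u * \<alpha>"
        using u by (intro mult_left_mono) auto
      moreover have "u * p (\<lambda>i. inverse u *\<^sub>R x i - v i) = p (\<lambda>i. u *\<^sub>R (inverse u *\<^sub>R x i - v i))"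
        using u by (intro hom[symmetric] Vdiff Vsc v GV[OF *(1)])
      ultimately show ?thesis using u * by (simp add: algebra_simps)
    qed
  qed
qed

theorem hahn_banach:
  fixes p :: "('i \<Rightarrow> 'c::real_vector) \<Rightarrow> real"
  assumes V: "fun_subspace V"
    and sub: "\<And>x y. x \<in> V \<Longrightarrow> y \<in> V \<Longrightarrow> p (\<lambda>i. x i + y i) \<le> p x + p y"
    and hom: "\<And>c x. x \<in> V \<Longrightarrow> c > 0 \<Longrightarrow> p (\<lambda>i. c *\<^sub>R x i) = c * p x"
    and G: "graph_subspace G" "fst ` G \<subseteq> V" and le: "\<And>x r. (x, r) \<in> G \<Longrightarrow> r \<le> p x"
  obtains L where "\<And>x y. x \<in> V \<Longrightarrow> y \<in> V \<Longrightarrow> L (\<lambda>i. x i + y i) = L x + L y"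
    "\<And>c x. x \<in> V \<Longrightarrow> L (\<lambda>i. c *\<^sub>R x i) = c * L x"
    "\<And>x. x \<in> V \<Longrightarrow> L x \<le> p x" "\<And>x r. (x, r) \<in> G \<Longrightarrow> L x = r"
proof -
  define \<G> where "\<G> = {H. graph_subspace H \<and> fst ` H \<subseteq> V \<and> (\<forall>x r. (x, r) \<in> H \<longrightarrow> r \<le> p x) \<and> G \<subseteq> H}"
  have "\<exists>M\<in>\<G>. \<forall>X\<in>\<G>. M \<subseteq> X \<longrightarrow> X = M"
  proof (rule subset_Zorn_nonempty)
    show "\<G> \<noteq> {}" using G le by (auto simp: \<G>_def)
    fix \<C> assume ne: "\<C> \<noteq> {}" and ch: "subset.chain \<G> \<C>"
    have CG: "\<C> \<subseteq> \<G>" using ch by (auto simp: subset.chain_def)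
    \<comment> \<open>The closure conditions of a graph involve at most two elements, and in a chain
      two elements always share a member.\<close>
    have two: "\<exists>H\<in>\<C>. a \<in> H \<and> b \<in> H" if ab: "a \<in> \<Union>\<C>" "b \<in> \<Union>\<C>" for a b
    proof -
      obtain A B where "A \<in> \<C>" "B \<in> \<C>" "a \<in> A" "b \<in> B" using ab by blast
      moreover have "A \<subseteq> B \<or> B \<subseteq> A"
        using subset_chain_def ch calculation by metis
      ultimately show ?thesis by blast
    qed
    have "graph_subspace (\<Union>\<C>)"
      unfolding graph_subspace_def
    proof (intro conjI allI impI)
      show "\<Union>\<C> \<noteq> {}" using ne CG graph_subspace_zero by (force simp: \<G>_def)
    next
      fix x r y s assume "(x, r) \<in> \<Union>\<C>" "(y, s) \<in> \<Union>\<C>"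
      then obtain H where "H \<in> \<C>" "(x, r) \<in> H" "(y, s) \<in> H" using two by blast
      moreover from this have "(\<lambda>i. x i + y i, r + s) \<in> H"
        using CG by (intro graph_subspace_add) (auto simp: \<G>_def)
      ultimately show "(\<lambda>i. x i + y i, r + s) \<in> \<Union>\<C>" by blast
    next
      fix c x r assume "(x, r) \<in> \<Union>\<C>"
      then obtain H where "H \<in> \<C>" "(x, r) \<in> H" by blast
      moreover from this have "(\<lambda>i. c *\<^sub>R x i, c * r) \<in> H"
        using CG by (intro graph_subspace_scale) (auto simp: \<G>_def)
      ultimately show "(\<lambda>i. c *\<^sub>R x i, c * r) \<in> \<Union>\<C>" by blast
    qed
    then show "\<Union>\<C> \<in> \<G>"
      using CG ne unfolding \<G>_def by blast
  qed
  then obtain H where H: "H \<in> \<G>" and max: "\<And>X. X \<in> \<G> \<Longrightarrow> H \<subseteq> X \<Longrightarrow> X = H" by blast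
  have H1: "graph_subspace H" and H2: "fst ` H \<subseteq> V" and H3: "\<And>x r. (x, r) \<in> H \<Longrightarrow> r \<le> p x" and H4: "G \<subseteq> H"
    using H by (auto simp: \<G>_def)
  have total: "\<exists>r. (x, r) \<in> H" if x: "x \<in> V" for x
  proof -
    obtain X where "graph_subspace X" "fst ` X \<subseteq> V" "\<And>x r. (x, r) \<in> X \<Longrightarrow> r \<le> p x" "H \<subseteq> X" "x \<in> fst ` X"
      using hahn_banach_extend[where p = p, OF V sub hom H1 H2 H3 x] by blast
    then have "X = H" using H4 by (intro max) (auto simp: \<G>_def)
    then show ?thesis using \<open>x \<in> fst ` X\<close> by force
  qed
  \<comment> \<open>Here domination supplies the single-valuedness that
    \<open>graph_subspace\<close> does not demand: the zero function is paired with both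
    \<open>r - s\<close> and \<open>s - r\<close>, and \<open>p\<close> vanishes at zero.\<close>
  have unique: "r = s" if r: "(x, r) \<in> H" and s: "(x, s) \<in> H" for x r s
  proof -
    have zV: "(\<lambda>i. 0) \<in> V" using H2 graph_subspace_zero[OF H1] by force
    have p0: "p (\<lambda>i. 0) = 0" using hom[OF zV, of 2] by simp
    show ?thesis
      using H3[OF graph_subspace_diff[OF H1 r s]] H3[OF graph_subspace_diff[OF H1 s r]] p0 by simp
  qed
  define L where "L x = (THE r. (x, r) \<in> H)" for x
  have L: "L x = r" if "(x, r) \<in> H" for x r
    unfolding L_def using that unique by blast
  show thesis
  proof
    fix x y assume "x \<in> V" "y \<in> V"
    then obtain r s where rs: "(x, r) \<in> H" "(y, s) \<in> H" using total by blast
    then show "L (\<lambda>i. x i + y i) = L x + L y" by (simp add: L[OF graph_subspace_add[OF H1 rs]] L)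
  next
    fix c x assume "x \<in> V"
    then obtain r where r: "(x, r) \<in> H" using total by blast
    then show "L (\<lambda>i. c *\<^sub>R x i) = c * L x" by (simp add: L[OF graph_subspace_scale[OF H1 r]] L)
  next
    fix x assume "x \<in> V"
    then obtain r where r: "(x, r) \<in> H" using total by blast
    then show "L x \<le> p x" using H3[OF r] by (simp add: L)
  next
    fix x r assume "(x, r) \<in> G"
    then show "L x = r" using H4 L by blast
  qed
qed

section \<open>The dual of a \<open>c\<^sub>0\<close> sum of Hilbert spaces\<close>

text \<open>A sequence \<open>y\<close> of functions is uncurried to a function on pairs; its \<open>n\<close>-th term is \<open>\<lambda>x. y (n, x)\<close>.\<close>

theorem c0_sum_dual:
  fixes M :: "nat \<Rightarrow> 'b measure" and G :: "((nat \<times> 'b \<Rightarrow> 'c::euclidean_space) \<times> real) set"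
  assumes G: "graph_subspace G" and K: "0 \<le> K"
    and L2: "\<And>y r n. (y, r) \<in> G \<Longrightarrow> (\<lambda>x. y (n, x)) \<in> L2 (M n)"
    and lim: "\<And>y r. (y, r) \<in> G \<Longrightarrow> (\<lambda>n. l2_norm (M n) (\<lambda>x. y (n, x))) \<longlonglongrightarrow> 0"
    and le: "\<And>y r B. (y, r) \<in> G \<Longrightarrow> (\<And>n. l2_norm (M n) (\<lambda>x. y (n, x)) \<le> B) \<Longrightarrow> r \<le> K * B"
  obtains g where "\<And>n. g n \<in> L2 (M n)" "\<And>N. (\<Sum>n<N. l2_norm (M n) (g n)) \<le> K"
    "\<And>y r. (y, r) \<in> G \<Longrightarrow> (\<lambda>n. l2_inner (M n) (g n) (\<lambda>x. y (n, x))) sums r"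
proof -
  define N where "N y n = l2_norm (M n) (\<lambda>x. y (n, x))" for y :: "nat \<times> 'b \<Rightarrow> 'c" and n
  \<comment> \<open>The extension is made to the whole sup-normed sum. Decay of the norms is
    demanded of the members of \<open>G\<close> only.\<close>
  define V where "V = {y :: nat \<times> 'b \<Rightarrow> 'c. (\<forall>n. (\<lambda>x. y (n, x)) \<in> L2 (M n)) \<and> bdd_above (range (N y))}"
  define p where "p y = K * (SUP n. N y n)" for y
  have VI: "y \<in> V" if "\<And>n. (\<lambda>x. y (n, x)) \<in> L2 (M n)" "\<And>n. N y n \<le> B" for y B
    unfolding V_def using that by (auto intro!: bdd_aboveI2)
  have VL2: "(\<lambda>x. y (n, x)) \<in> L2 (M n)" if "y \<in> V" for y n
    using that by (auto simp: V_def)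
  have Nle: "N y n \<le> (SUP n. N y n)" if "y \<in> V" for y n
    by (rule cSUP_upper) (use that in \<open>auto simp: V_def\<close>)
  have ple: "p y \<le> K * B" if "\<And>n. N y n \<le> B" for y B
    unfolding p_def using that K by (intro mult_left_mono cSUP_least) auto
  have Nadd: "N (\<lambda>i. x i + y i) n \<le> N x n + N y n" if "x \<in> V" "y \<in> V" for x y n
    unfolding N_def using that by (intro l2_norm_triangle VL2)
  have Nsc: "N (\<lambda>i. c *\<^sub>R x i) n = \<bar>c\<bar> * N x n" for c x n
    unfolding N_def by (rule l2_norm_scaleR)
  have N0: "0 \<le> N y n" for y n by (simp add: N_def)
  have Vadd: "(\<lambda>i. x i + y i) \<in> V" if "x \<in> V" "y \<in> V" for x y
    by (rule VI[OF L2_add[OF VL2[OF that(1)] VL2[OF that(2)]] order_trans[OF Nadd[OF that]]])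
      (rule add_mono[OF Nle[OF that(1)] Nle[OF that(2)]])
  have Vsc: "(\<lambda>i. c *\<^sub>R x i) \<in> V" if "x \<in> V" for x c
    by (rule VI[OF L2_scaleR[OF VL2[OF that]], of _ "\<bar>c\<bar> * (SUP n. N x n)"])
      (auto simp: Nsc intro!: mult_left_mono Nle that)
  have Vdiff: "(\<lambda>i. x i - y i) \<in> V" if "x \<in> V" "y \<in> V" for x y
    using Vadd[OF that(1) Vsc[OF that(2), of "-1"]] by simp
  have "(\<lambda>i. 0) \<in> V" by (rule VI[of _ 0]) (auto simp: L2_zero N_def)
  then have V: "fun_subspace V"
    unfolding fun_subspace_def using Vadd Vsc by auto
  have GV: "y \<in> V" if "(y, r) \<in> G" for y r
  proof -
    have "Bseq (N y)" using lim[OF that] unfolding N_def by (rule convergentI[THEN convergent_imp_Bseq])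
    then show ?thesis
      unfolding V_def using L2[OF that] by (auto dest: Bseq_bdd_above)
  qed
  have psub: "p (\<lambda>i. x i + y i) \<le> p x + p y" if "x \<in> V" "y \<in> V" for x y
  proof -
    have "p (\<lambda>i. x i + y i) \<le> K * ((SUP n. N x n) + (SUP n. N y n))"
      by (rule ple[OF order_trans[OF Nadd[OF that]]]) (intro add_mono Nle that)
    then show ?thesis by (simp add: p_def algebra_simps)
  qed
  have phom1: "p (\<lambda>i. c *\<^sub>R x i) \<le> c * p x" if "x \<in> V" "c > 0" for c x
  proof -
    have "p (\<lambda>i. c *\<^sub>R x i) \<le> K * (c * (SUP n. N x n))"
      using that by (intro ple) (auto simp: Nsc intro!: mult_left_mono Nle)
    then show ?thesis by (simp add: p_def algebra_simps)
  qed
  have phom: "p (\<lambda>i. c *\<^sub>R x i) = c * p x" if x: "x \<in> V" and c: "c > 0" for c x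
  proof (rule antisym[OF phom1[OF x c]])
    have "p (\<lambda>i. inverse c *\<^sub>R (c *\<^sub>R x i)) \<le> inverse c * p (\<lambda>i. c *\<^sub>R x i)"
      using c by (intro phom1 Vsc x) auto
    then show "c * p x \<le> p (\<lambda>i. c *\<^sub>R x i)" using c by (simp add: field_simps)
  qed
  have GsubV: "fst ` G \<subseteq> V" using GV by auto
  have Gp: "r \<le> p x" if "(x, r) \<in> G" for x r
    unfolding p_def using le[OF that Nle[OF GV[OF that], unfolded N_def]] by (simp add: N_def)
  obtain L where Ladd: "\<And>x y. x \<in> V \<Longrightarrow> y \<in> V \<Longrightarrow> L (\<lambda>i. x i + y i) = L x + L y"
    and Lsc: "\<And>c x. x \<in> V \<Longrightarrow> L (\<lambda>i. c *\<^sub>R x i) = c * L x"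
    and Lp: "\<And>x. x \<in> V \<Longrightarrow> L x \<le> p x" and LG: "\<And>x r. (x, r) \<in> G \<Longrightarrow> L x = r"
    by (rule hahn_banach[where p = p, OF V psub phom G GsubV Gp]; (assumption | (rule that; assumption)))
  \<comment> \<open>Domination by \<open>p\<close> is one-sided; applying it to the negative of
    \<open>y\<close> as well bounds the absolute value.\<close>
  have Lle: "\<bar>L y\<bar> \<le> K * B" if y: "y \<in> V" and B: "\<And>n. N y n \<le> B" for y B
    using order_trans[OF Lp[OF y] ple[OF B]] order_trans[OF Lp[OF Vsc[OF y, of "-1"]] ple, of B]
      Lsc[OF y, of "-1"] B Nsc[of "-1" y] by auto
  define e where "e n h = (\<lambda>(m, x). if m = n then h x else 0)" for n :: nat and h :: "'b \<Rightarrow> 'c"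
  have eV: "e n h \<in> V" and eN: "N (e n h) m \<le> l2_norm (M n) h" if "h \<in> L2 (M n)" for n h m
  proof -
    have eN: "N (e n h) m \<le> l2_norm (M n) h" for m
      by (cases "m = n") (simp_all add: e_def N_def)
    show "N (e n h) m \<le> l2_norm (M n) h" by (rule eN)
    show "e n h \<in> V" by (rule VI[OF _ eN], rename_tac m, case_tac "m = n") (simp_all add: e_def L2_zero that)
  qed
  \<comment> \<open>Restricted to sequences concentrated in one coordinate, \<open>L\<close> is a
    bounded functional on a single L2 space, where Riesz applies.\<close>
  have "\<exists>g. g \<in> L2 (M n) \<and> (\<forall>h\<in>L2 (M n). L (e n h) = l2_inner (M n) g h)" for n
  proof (rule l2_riesz[of "M n" "\<lambda>h. L (e n h)" K])
    fix f h :: "'b \<Rightarrow> 'c" assume "f \<in> L2 (M n)" "h \<in> L2 (M n)"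
    then have "L (\<lambda>i. e n f i + e n h i) = L (e n f) + L (e n h)" by (intro Ladd eV)
    moreover have "(\<lambda>i. e n f i + e n h i) = e n (\<lambda>x. f x + h x)" by (auto simp: e_def)
    ultimately show "L (e n (\<lambda>x. f x + h x)) = L (e n f) + L (e n h)" by simp
  next
    fix c and f :: "'b \<Rightarrow> 'c" assume "f \<in> L2 (M n)"
    then have "L (\<lambda>i. c *\<^sub>R e n f i) = c * L (e n f)" by (intro Lsc eV)
    moreover have "(\<lambda>i. c *\<^sub>R e n f i) = e n (\<lambda>x. c *\<^sub>R f x)" by (auto simp: e_def)
    ultimately show "L (e n (\<lambda>x. c *\<^sub>R f x)) = c * L (e n f)" by simp
  next
    fix f :: "'b \<Rightarrow> 'c" assume "f \<in> L2 (M n)"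
    then show "L (e n f) \<le> K * l2_norm (M n) f"
      using Lle[OF eV eN] by (metis abs_le_D1)
  qed blast
  then obtain g where g: "\<And>n. g n \<in> L2 (M n)"
    and gL: "\<And>n h. h \<in> L2 (M n) \<Longrightarrow> L (e n h) = l2_inner (M n) (g n) h" by metis
  define tr where "tr k y = (\<lambda>(m, x). if m < k then y (m, x) else 0)" for k :: nat and y :: "nat \<times> 'b \<Rightarrow> 'c"
  have trV: "tr k y \<in> V" if "\<And>n. (\<lambda>x. y (n, x)) \<in> L2 (M n)" for k y
  proof (rule VI[of _ "\<Sum>n<k. N y n"])
    show "(\<lambda>x. tr k y (n, x)) \<in> L2 (M n)" for n
      using that[of n] by (cases "n < k") (simp_all add: tr_def L2_zero)
    show "N (tr k y) n \<le> (\<Sum>n<k. N y n)" for n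
      using member_le_sum[of n "{..<k}" "N y"] N0[of y]
      by (cases "n < k") (simp_all add: tr_def N_def sum_nonneg)
  qed
  have trL: "L (tr k y) = (\<Sum>n<k. l2_inner (M n) (g n) (\<lambda>x. y (n, x)))"
    if "\<And>n. (\<lambda>x. y (n, x)) \<in> L2 (M n)" for k y
  proof (induction k)
    case 0
    have "tr 0 y = (\<lambda>i. 0 *\<^sub>R tr 0 y i)" by (auto simp: tr_def)
    then show ?case using Lsc[OF trV[OF that], of 0 0] by simp
  next
    case (Suc k)
    have "tr (Suc k) y = (\<lambda>i. tr k y i + e k (\<lambda>x. y (k, x)) i)"
      by (auto simp: tr_def e_def less_Suc_eq)
    then show ?case using Suc Ladd[OF trV[OF that] eV[OF that]] gL[OF that] by simp
  qed
  show thesis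
  proof (rule that[OF g])
    fix k
    \<comment> \<open>The extremal test sequence: each entry is \<open>g n\<close> normalised, so
      that the first \<open>k\<close> entries recover the sum of the norms. Where the norm is 0 the
      entry is 0, because \<open>inverse 0 = 0\<close>.\<close>
    define y where "y = (\<lambda>(n, x). inverse (l2_norm (M n) (g n)) *\<^sub>R g n x)"
    have yL: "(\<lambda>x. y (n, x)) \<in> L2 (M n)" for n
      by (auto simp: y_def intro: L2_scaleR g)
    have "N (tr k y) n \<le> 1" for n
      by (cases "n < k"; cases "l2_norm (M n) (g n) = 0") (simp_all add: N_def tr_def y_def l2_norm_scaleR)
    from Lle[OF trV[OF yL] this] have "L (tr k y) \<le> K" by simp
    also have "L (tr k y) = (\<Sum>n<k. l2_norm (M n) (g n))"
      unfolding trL[OF yL]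
    proof (rule sum.cong[OF refl])
      show "l2_inner (M n) (g n) (\<lambda>x. y (n, x)) = l2_norm (M n) (g n)" for n
        by (cases "l2_norm (M n) (g n) = 0")
          (simp_all add: y_def l2_inner_scaleR_right l2_inner_self power2_eq_square l2_inner_def[of _ _ "\<lambda>x. 0"])
    qed
    finally show "(\<Sum>n<k. l2_norm (M n) (g n)) \<le> K" .
  next
    fix y r assume yr: "(y, r) \<in> G"
    have yL: "\<And>n. (\<lambda>x. y (n, x)) \<in> L2 (M n)" by (rule L2[OF yr])
    show "(\<lambda>n. l2_inner (M n) (g n) (\<lambda>x. y (n, x))) sums r"
      unfolding sums_def
    proof (rule LIMSEQ_I)
      fix \<epsilon> :: real assume \<epsilon>: "\<epsilon> > 0"
      \<comment> \<open>The \<open>+ 1\<close> keeps the denominator positive when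
        \<open>K = 0\<close>.\<close>
      define \<delta> where "\<delta> = \<epsilon> / (2 * (K + 1))"
      have \<delta>: "\<delta> > 0" "K * \<delta> < \<epsilon>" using \<epsilon> K by (auto simp: \<delta>_def field_simps add_nonneg_pos)
      obtain k0 where k0: "\<And>n. n \<ge> k0 \<Longrightarrow> N y n < \<delta>"
        using LIMSEQ_D[OF lim[OF yr] \<delta>(1)] by (auto simp: N_def)
      show "\<exists>no. \<forall>k\<ge>no. norm ((\<Sum>n<k. l2_inner (M n) (g n) (\<lambda>x. y (n, x))) - r) < \<epsilon>"
      proof (intro exI[of _ k0] allI impI)
        fix k assume k: "k0 \<le> k"
        let ?z = "\<lambda>i. y i - tr k y i"
        have zV: "?z \<in> V" by (intro Vdiff GV[OF yr] trV yL)
        \<comment> \<open>The one place where decay is used: cutting off finitely many entries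
          leaves a remainder that is small in the sup norm, so \<open>L\<close> is small on it
          whatever it does at infinity.\<close>
        have zN: "N ?z n \<le> \<delta>" for n
          using k0[of n] k \<delta>(1) by (cases "n < k") (auto simp: N_def tr_def less_imp_le)
        have "L y = L ?z + L (tr k y)"
          using Ladd[OF zV trV[OF yL], of k] by simp
        then have "r - (\<Sum>n<k. l2_inner (M n) (g n) (\<lambda>x. y (n, x))) = L ?z"
          using LG[OF yr] trL[OF yL, of k] by simp
        then show "norm ((\<Sum>n<k. l2_inner (M n) (g n) (\<lambda>x. y (n, x))) - r) < \<epsilon>"
          using Lle[OF zV zN] \<delta> by simp
      qed
    qed
  qed
qed

section \<open>Locally finite families of balls\<close>

text \<open>A bounded component \<open>C\<close> away from \<open>D\<close> is nonempty, hence by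
  uniqueness the sole member. The rest of \<Omega> cannot coincide with \<open>C\<close>, so it is
  empty and \<open>C\<close> is \<Omega>.\<close>

lemma sigma_components_eq:
  assumes "\<exists>!C. C \<in> sigma_components \<Omega> D"
  shows "sigma_components \<Omega> D = {\<Omega>}"
proof (cases "pure_components \<Omega> D = {}")
  case True
  then have "sigma_components \<Omega> D = {\<Omega>} - {{}}"
    by (simp add: sigma_components_def D_component_def)
  with assms show ?thesis by auto
next
  case False
  then obtain C where C: "C \<in> pure_components \<Omega> D" by blast
  have ne: "C' \<noteq> {}" if "C' \<in> pure_components \<Omega> D" for C'
    using that in_components_nonempty by (auto simp: pure_components_def)
  have uniq: "C' = C" if "C' \<in> sigma_components \<Omega> D" for C'
    using assms that C ne[OF C] by (auto simp: sigma_components_def)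
  have pure: "pure_components \<Omega> D = {C}"
    using uniq C ne by (auto simp: sigma_components_def)
  have "D_component \<Omega> D = {}"
  proof (rule ccontr)
    assume "D_component \<Omega> D \<noteq> {}"
    then have "D_component \<Omega> D = C" by (intro uniq) (auto simp: sigma_components_def)
    then show False using ne[OF C] by (auto simp: D_component_def pure)
  qed
  moreover have "C \<subseteq> \<Omega>" using C in_components_subset by (auto simp: pure_components_def)
  ultimately have "\<Omega> = C" by (auto simp: D_component_def pure)
  then show ?thesis using ne[OF C] \<open>D_component \<Omega> D = {}\<close> pure by (auto simp: sigma_components_def)
qed

text \<open>Each unit shell is totally bounded and has a finite net of its own; a bounded set
  reaches only finitely many shells.\<close>

lemma locally_finite_net:
  fixes S :: "'a::euclidean_space set"
  assumes e: "e > 0"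
  obtains F where "F \<subseteq> S" "countable F" "\<And>x. x \<in> S \<Longrightarrow> \<exists>y\<in>F. dist x y < e" "\<And>T. bounded T \<Longrightarrow> finite (F \<inter> T)"
proof -
  define A where "A n = {x\<in>S. real n \<le> norm x \<and> norm x < real n + 1}" for n
  have "\<exists>F. finite F \<and> F \<subseteq> A n \<and> (\<forall>x\<in>A n. \<exists>y\<in>F. dist x y < e)" for n
  proof -
    have "bounded (A n)" by (rule boundedI[of _ "real n + 1"]) (auto simp: A_def)
    then have "compact (closure (A n))" by simp
    \<comment> \<open>The cover consists of balls centred in \<open>A n\<close> itself, so that the
      net stays inside \<open>S\<close>.\<close>
    moreover have "closure (A n) \<subseteq> (\<Union>y\<in>A n. ball y e)"
      using e by (auto simp: closure_approachable)
    ultimately obtain F where F: "F \<subseteq> A n" "finite F" "closure (A n) \<subseteq> (\<Union>y\<in>F. ball y e)"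
      by (metis compactE_image open_ball)
    then have "\<exists>y\<in>F. dist x y < e" if "x \<in> A n" for x
      using that closure_subset[of "A n"] by (force simp: dist_commute)
    with F show ?thesis by auto
  qed
  then obtain F where F: "\<And>n. finite (F n)" "\<And>n. F n \<subseteq> A n" "\<And>n x. x \<in> A n \<Longrightarrow> \<exists>y\<in>F n. dist x y < e"
    by metis
  show thesis
  proof
    show "(\<Union>n. F n) \<subseteq> S" using F(2) by (force simp: A_def)
    show "countable (\<Union>n. F n)" using F(1) by (auto intro: countable_finite)
    fix x assume x: "x \<in> S"
    have "x \<in> A (nat \<lfloor>norm x\<rfloor>)" using x by (auto simp: A_def)
    then show "\<exists>y\<in>\<Union>n. F n. dist x y < e" using F(3) by blast
  next
    fix T :: "'a set" assume "bounded T"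
    then obtain b where b: "\<And>x. x \<in> T \<Longrightarrow> norm x \<le> b" by (auto simp: bounded_iff)
    have "(\<Union>n. F n) \<inter> T \<subseteq> (\<Union>n\<le>nat \<lceil>b\<rceil>. F n)"
    proof
      fix x assume "x \<in> (\<Union>n. F n) \<inter> T"
      then obtain n where n: "x \<in> F n" "norm x \<le> b" using b by auto
      then have "real n \<le> b" using F(2)[of n] by (force simp: A_def)
      then have "n \<le> nat \<lceil>b\<rceil>" by linarith
      with n show "x \<in> (\<Union>n\<le>nat \<lceil>b\<rceil>. F n)" by auto
    qed
    then show "finite ((\<Union>n. F n) \<inter> T)" by (rule finite_subset) (use F(1) in auto)
  qed
qed

lemma finite_dyadic_exponents:
  assumes "0 < a"
  shows "finite {k::int. a \<le> 2 powr k \<and> 2 powr k \<le> b}"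
proof (cases "0 < b")
  case True
  have "{k::int. a \<le> 2 powr k \<and> 2 powr k \<le> b} \<subseteq> {\<lfloor>log 2 a\<rfloor>..\<lceil>log 2 b\<rceil>}"
  proof safe
    fix k :: int assume k: "a \<le> 2 powr k" "2 powr k \<le> b"
    have "log 2 a \<le> k" "k \<le> log 2 b"
      using k assms True by (simp_all add: log_le_iff le_log_iff)
    then show "k \<in> {\<lfloor>log 2 a\<rfloor>..\<lceil>log 2 b\<rceil>}" by simp linarith
  qed
  then show ?thesis by (rule finite_subset) simp
next
  case False
  then have "\<not> 2 powr real_of_int k \<le> b" for k
    using powr_gt_zero[of 2 "real_of_int k"] by linarith
  then show ?thesis by simp
qed

text \<open>The single component is recorded in the form in which it is used: every usual ball is a
  Euclidean ball intersected with \<Omega>.\<close>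

locale uitc_domain =
  fixes \<Omega> D :: "'a::euclidean_space set"
  assumes open_\<Omega>: "open \<Omega>" and D_subset: "D \<subseteq> frontier \<Omega>"
    and uitc: "UITC \<Omega>" and sigma_eq: "sigma_components \<Omega> D = {\<Omega>}"
begin

abbreviation B :: "'a \<Rightarrow> real \<Rightarrow> 'a set" where "B x r \<equiv> ball x r \<inter> \<Omega>"

abbreviation near :: "'a \<Rightarrow> real \<Rightarrow> bool" where "near x r \<equiv> ball x (2 * r) \<inter> D \<noteq> {}"

lemma \<Omega>_nonempty: "\<Omega> \<noteq> {}"
  using sigma_eq by (auto simp: sigma_components_def)

lemma D_disjoint: "D \<inter> \<Omega> = {}"
  using D_subset open_\<Omega> by (auto simp: frontier_def interior_open)

lemma usual_balls_eq: "usual_balls \<Omega> D = {(\<Omega>, x, r) | x r. x \<in> \<Omega> \<and> r > 0}"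
  by (auto simp: usual_balls_def sigma_eq)

lemma near_balls_eq: "near_balls \<Omega> D = {(\<Omega>, x, r) | x r. x \<in> \<Omega> \<and> r > 0 \<and> near x r}"
proof -
  have "D \<inter> frontier \<Omega> = D" using D_subset by auto
  then show ?thesis by (auto simp: near_balls_def usual_balls_eq)
qed

lemma usual_ball_set_eq [simp]: "usual_ball_set (\<Omega>, x, r) = B x r"
  by (simp add: usual_ball_set_def)

lemma B_lmeasurable [simp]: "B x r \<in> lmeasurable"
  by (intro bounded_set_imp_lmeasurable) (auto simp: open_\<Omega> bounded_Int)

lemma B_sets [simp]: "B x r \<in> sets lebesgue"
  using open_\<Omega> by auto

lemma \<Omega>_sets [simp]: "\<Omega> \<in> sets lebesgue"
  using open_\<Omega> by auto

lemma measure_B_pos: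
  assumes "x \<in> \<Omega>" "r > 0"
  shows "measure lebesgue (B x r) > 0"
proof -
  have "open (B x r)" using open_\<Omega> by auto
  moreover have "B x r \<noteq> {}" using assms centre_in_ball[of x r] by blast
  ultimately have "\<not> negligible (B x r)" by (rule open_not_negligible)
  then show ?thesis by (simp add: negligible_iff_measure zero_less_measure_iff)
qed

lemma measure_B_le: "r \<ge> 0 \<Longrightarrow> measure lebesgue (B x r) \<le> unit_ball_vol DIM('a) * r ^ DIM('a)"
  using measure_mono_fmeasurable[of "B x r" "ball x r" lebesgue] content_ball[of r x] by simp

lemma measure_B_mono: "r \<le> s \<Longrightarrow> measure lebesgue (B x r) \<le> measure lebesgue (B x s)"
  by (intro measure_mono_fmeasurable) auto

lemma diameter_pos:
  assumes "bounded \<Omega>"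
  shows "diameter \<Omega> > 0"
proof -
  obtain x where x: "x \<in> \<Omega>" using \<Omega>_nonempty by auto
  then obtain e where e: "e > 0" "ball x e \<subseteq> \<Omega>" using open_\<Omega> open_contains_ball by blast
  obtain b :: 'a where b: "b \<in> Basis" using nonempty_Basis by blast
  have "dist x (x + (e / 2) *\<^sub>R b) = e / 2" using b e by (simp add: dist_norm)
  moreover from this have "x + (e / 2) *\<^sub>R b \<in> \<Omega>" using e by auto
  ultimately show ?thesis
    using diameter_bounded_bound[OF assms x, of "x + (e / 2) *\<^sub>R b"] e by linarith
qed

text \<open>\<open>UITC\<close> speaks only of radii below the diameter. In a bounded domain, radii
  up to a prescribed \<open>R\<close> are reached by shrinking the ball by a fixed factor \<theta>,
  which costs a power of \<theta> in the constant.\<close>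

lemma measure_B_ge:
  assumes "R > 0"
  obtains c where "c > 0" "\<And>x r. x \<in> \<Omega> \<Longrightarrow> r > 0 \<Longrightarrow> (bounded \<Omega> \<Longrightarrow> r \<le> R) \<Longrightarrow> c * r ^ DIM('a) \<le> measure lebesgue (B x r)"
proof -
  obtain c where c: "c > 0" and low: "\<And>x r. x \<in> \<Omega> \<Longrightarrow> r > 0 \<Longrightarrow> ereal r < ediam \<Omega> \<Longrightarrow> c * r ^ DIM('a) \<le> measure lebesgue (B x r)"
    using uitc unfolding UITC_def by blast
  \<comment> \<open>The 2 brings \<theta> times \<open>r\<close> down to at most half the diameter,
    so that the inequality required by \<open>UITC\<close> is strict.\<close>
  define \<theta> where "\<theta> = (if bounded \<Omega> then min 1 (diameter \<Omega> / (2 * R)) else 1)"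
  have \<theta>: "\<theta> > 0" "\<theta> \<le> 1" using assms diameter_pos by (auto simp: \<theta>_def)
  show thesis
  proof (rule that[of "c * \<theta> ^ DIM('a)"])
    show "c * \<theta> ^ DIM('a) > 0" using c \<theta> by simp
    fix x r assume x: "x \<in> \<Omega>" and r: "r > 0" and rR: "bounded \<Omega> \<Longrightarrow> r \<le> R"
    have "\<theta> * r < diameter \<Omega>" if b: "bounded \<Omega>"
    proof -
      have "\<theta> * r \<le> (diameter \<Omega> / (2 * R)) * R"
        using \<theta> r rR[OF b] b diameter_pos[OF b] assms by (intro mult_mono) (auto simp: \<theta>_def)
      also have "\<dots> < diameter \<Omega>" using assms diameter_pos[OF b] by simp
      finally show ?thesis .
    qed
    then have "ereal (\<theta> * r) < ediam \<Omega>" by (auto simp: ediam_def)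
    then have "c * (\<theta> * r) ^ DIM('a) \<le> measure lebesgue (B x (\<theta> * r))"
      using low x r \<theta> by simp
    also have "\<dots> \<le> measure lebesgue (B x r)"
      using \<theta> r by (intro measure_B_mono) (simp add: mult_left_le_one_le)
    finally show "c * \<theta> ^ DIM('a) * r ^ DIM('a) \<le> measure lebesgue (B x r)"
      by (simp add: power_mult_distrib mult.assoc)
  qed
qed

text \<open>Centres form a net of mesh \<open>2 powr k\<close> at each integer scale
  \<open>k\<close>, with radius twice the mesh. In a bounded domain the scales stop once one ball
  contains everything; otherwise infinitely many members would equal \<Omega>, and local finiteness
  with radii bounded above would not lead to decay.\<close>

lemma ball_family:
  obtains X :: "nat \<Rightarrow> 'a" and R :: "nat \<Rightarrow> real" and M :: real
  where "\<And>n. X n \<in> \<Omega>" "\<And>n. R n > 0" "M > 0"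
    "\<And>x r. x \<in> \<Omega> \<Longrightarrow> r > 0 \<Longrightarrow> \<exists>n. B x r \<subseteq> B (X n) (R n) \<and>
       measure lebesgue (B (X n) (R n)) \<le> M * measure lebesgue (B x r) \<and> (near x r \<longrightarrow> near (X n) (R n))"
    "\<And>S a b. bounded S \<Longrightarrow> a > 0 \<Longrightarrow> finite {n. a \<le> R n \<and> R n \<le> b \<and> ball (X n) (R n) \<inter> S \<noteq> {}}"
    "bounded \<Omega> \<Longrightarrow> \<exists>b. \<forall>n. R n \<le> b"
proof -
  have "\<exists>F. F \<subseteq> \<Omega> \<and> countable F \<and> (\<forall>x\<in>\<Omega>. \<exists>y\<in>F. dist x y < 2 powr k) \<and> (\<forall>T. bounded T \<longrightarrow> finite (F \<inter> T))"
    for k :: int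
    by (rule locally_finite_net[of "2 powr k" \<Omega>]) auto
  then obtain F :: "int \<Rightarrow> 'a set" where F: "\<And>k. F k \<subseteq> \<Omega>" "\<And>k. countable (F k)"
    "\<And>k x. x \<in> \<Omega> \<Longrightarrow> \<exists>y\<in>F k. dist x y < 2 powr k" "\<And>k T. bounded T \<Longrightarrow> finite (F k \<inter> T)"
    by metis
  \<comment> \<open>The last scale for a bounded domain: \<open>2 powr km\<close> exceeds the
    diameter.\<close>
  define km where "km = \<lceil>log 2 (diameter \<Omega> + 1)\<rceil>"
  have km: "diameter \<Omega> < 2 powr km" if "bounded \<Omega>"
  proof -
    have "diameter \<Omega> + 1 = 2 powr (log 2 (diameter \<Omega> + 1))"
      using diameter_pos[OF that] by simp
    also have "\<dots> \<le> 2 powr km" unfolding km_def by (intro powr_mono) auto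
    finally show ?thesis by simp
  qed
  define ks where "ks = {k::int. bounded \<Omega> \<longrightarrow> k \<le> km}"
  define I where "I = Sigma ks F"
  have cI: "countable I" unfolding I_def using F(2) by auto
  \<comment> \<open>Arbitrarily negative scales always occur. Infinity of \<open>I\<close> permits
    an enumeration by all natural numbers without repetition, on which the finiteness claim
    relies.\<close>
  have "infinite I"
  proof
    assume "finite I"
    then have "finite (fst ` I)" by simp
    moreover have "{..km} \<subseteq> fst ` I"
    proof
      fix k assume k: "k \<in> {..km}"
      obtain x where "x \<in> \<Omega>" using \<Omega>_nonempty by auto
      then obtain y where "y \<in> F k" using F(3) by blast
      then have "(k, y) \<in> I" using k by (auto simp: I_def ks_def)
      then show "k \<in> fst ` I" by force
    qed
    ultimately show False using infinite_Iic finite_subset by blast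
  qed
  then have bij: "bij_betw (from_nat_into I) UNIV I"
    using cI by (intro bij_betw_from_nat_into)
  define X where "X n = snd (from_nat_into I n)" for n
  define R where "R n = 2 * 2 powr (fst (from_nat_into I n))" for n
  have XI: "(fst (from_nat_into I n), X n) \<in> I" for n
    using bij by (auto simp: X_def bij_betw_def)
  have index: "\<exists>n. X n = y \<and> R n = 2 * 2 powr k" if "k \<in> ks" "y \<in> F k" for k y
  proof -
    have "(k, y) \<in> range (from_nat_into I)"
      using bij that by (auto simp: bij_betw_def I_def)
    then obtain n where "(k, y) = from_nat_into I n" by blast
    then show ?thesis by (intro exI[of _ n]) (simp add: X_def R_def flip: \<open>(k, y) = _\<close>)
  qed
  define d where "d = DIM('a)"
  define \<omega> where "\<omega> = unit_ball_vol d"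
  have \<omega>: "\<omega> > 0" by (simp add: \<omega>_def)
  have up: "measure lebesgue (B x r) \<le> \<omega> * r ^ d" if "r \<ge> 0" for x r
    using measure_B_le[OF that] by (simp add: \<omega>_def d_def)
  obtain c where c: "c > 0" and low: "\<And>x r. x \<in> \<Omega> \<Longrightarrow> r > 0 \<Longrightarrow> (bounded \<Omega> \<Longrightarrow> r \<le> 2 powr km) \<Longrightarrow>
      c * r ^ d \<le> measure lebesgue (B x r)"
    by (rule measure_B_ge[of "2 powr km"]) (auto simp: d_def)
  show thesis
  \<comment> \<open>The member found for radius \<open>r\<close> has radius at most
    \<open>8 * r\<close>: its volume is at most \<omega> times \<open>(8 * r) ^ d\<close>, while the
    given ball has at least \<open>c\<close> times \<open>r ^ d\<close> as long as the lower bound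
    applies.\<close>
  proof (rule that[of X R "\<omega> * 8 ^ d / c"])
    show "X n \<in> \<Omega>" for n using XI[of n] F(1) by (auto simp: I_def)
    show "R n > 0" for n by (simp add: R_def)
    show "\<omega> * 8 ^ d / c > 0" using \<omega> c by simp
    show "\<exists>b. \<forall>n. R n \<le> b" if "bounded \<Omega>"
      using XI that by (intro exI[of _ "2 * 2 powr km"]) (auto simp: R_def I_def ks_def intro: powr_mono)
  next
    fix S :: "'a set" and a b :: real assume S: "bounded S" and a: "a > 0"
    \<comment> \<open>Centres of balls of radius at most \<open>b\<close> that meet \<open>S\<close>
      lie in this neighbourhood, and each net has only finitely many points there.\<close>
    define T where "T = (\<Union>z\<in>S. cball z b)"
    have T: "bounded T"
    proof -
      obtain M where "\<And>z. z \<in> S \<Longrightarrow> norm z \<le> M" using S by (auto simp: bounded_iff)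
      then have "norm y \<le> M + b" if "y \<in> T" for y
        using that unfolding T_def
        by (auto simp: dist_norm) (smt (verit) norm_minus_commute norm_triangle_sub)
      then show ?thesis by (auto simp: bounded_iff)
    qed
    have "from_nat_into I ` {n. a \<le> R n \<and> R n \<le> b \<and> ball (X n) (R n) \<inter> S \<noteq> {}}
        \<subseteq> Sigma {k::int. a / 2 \<le> 2 powr k \<and> 2 powr k \<le> b / 2} (\<lambda>k. F k \<inter> T)" (is "_ ` ?N \<subseteq> ?J")
    proof (rule image_subsetI)
      fix n assume "n \<in> ?N"
      then obtain z where n: "a \<le> R n" "R n \<le> b" and z: "z \<in> ball (X n) (R n)" "z \<in> S" by blast
      have "X n \<in> F (fst (from_nat_into I n))" using XI[of n] by (simp add: I_def)
      moreover have "X n \<in> T" unfolding T_def using z n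
        by (auto intro!: bexI[of _ z] simp: dist_commute)
      ultimately have "(fst (from_nat_into I n), X n) \<in> ?J" using n by (auto simp: R_def)
      then show "from_nat_into I n \<in> ?J" by (simp only: X_def prod.collapse)
    qed
    moreover have "finite ?J"
      by (intro finite_SigmaI finite_dyadic_exponents F(4) T) (use a in simp)
    ultimately have "finite (from_nat_into I ` ?N)" by (rule finite_subset)
    then show "finite ?N"
      by (rule finite_imageD) (use bij in \<open>auto simp: bij_betw_def intro: inj_on_subset\<close>)
  next
    fix x r assume x: "x \<in> \<Omega>" and r: "(r::real) > 0"
    \<comment> \<open>The least integer scale with \<open>2 * r \<le> 2 powr k0\<close>. A centre
      within \<open>2 powr k0\<close> of \<open>x\<close> then leaves room for both
      \<open>ball x r\<close> and its double, and minimality gives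
      \<open>2 powr k0 < 4 * r\<close>.\<close>
    define k0 where "k0 = \<lceil>log 2 (2 * r)\<rceil>"
    have "2 * r = 2 powr (log 2 (2 * r))" using r by simp
    also have "\<dots> \<le> 2 powr k0" unfolding k0_def by (intro powr_mono) auto
    finally have k0: "2 * r \<le> 2 powr k0" .
    have "2 powr k0 < 2 powr (log 2 (2 * r) + 1)"
      unfolding k0_def by (intro powr_less_mono) linarith+
    also have "\<dots> = 4 * r" using r by (simp add: powr_add)
    finally have k0': "2 powr k0 < 4 * r" .
    show "\<exists>n. B x r \<subseteq> B (X n) (R n) \<and> measure lebesgue (B (X n) (R n)) \<le> \<omega> * 8 ^ d / c * measure lebesgue (B x r) \<and>
        (near x r \<longrightarrow> near (X n) (R n))"
    proof (cases "k0 \<in> ks")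
      case True
      obtain y where y: "y \<in> F k0" "dist x y < 2 powr k0" using F(3)[OF x] by blast
      obtain n where n: "X n = y" "R n = 2 * 2 powr k0" using index[OF True y(1)] by blast
      have sub: "ball x s \<subseteq> ball y t" if "s + 2 powr k0 \<le> t" for s t
        using that y(2) by (auto simp: subset_iff) (smt (verit) dist_commute dist_triangle)
      have "ball x r \<subseteq> ball y (2 * 2 powr k0)" "ball x (2 * r) \<subseteq> ball y (2 * (2 * 2 powr k0))"
        using k0 r by (intro sub; simp)+
      moreover have "measure lebesgue (B y (2 * 2 powr k0)) \<le> \<omega> * 8 ^ d / c * measure lebesgue (B x r)"
      proof -
        have "measure lebesgue (B y (2 * 2 powr k0)) \<le> \<omega> * (2 * 2 powr k0) ^ d" by (rule up) simp
        also have "\<dots> \<le> \<omega> * (8 * r) ^ d"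
          using k0' \<omega> r by (intro mult_left_mono power_mono) auto
        also have "\<dots> = \<omega> * 8 ^ d / c * (c * r ^ d)"
          using c by (simp add: power_mult_distrib)
        also have "\<dots> \<le> \<omega> * 8 ^ d / c * measure lebesgue (B x r)"
        proof (intro mult_left_mono low x r)
          assume "bounded \<Omega>"
          then have "2 powr k0 \<le> 2 powr km" using True by (intro powr_mono) (auto simp: ks_def)
          then show "r \<le> 2 powr km" using k0 r by linarith
        qed (use \<omega> c in auto)
        finally show ?thesis .
      qed
      ultimately show ?thesis using n by (intro exI[of _ n]) auto
    next
      case False
      \<comment> \<open>The radius is beyond the last scale. The chosen member is all of \<Omega>,
        and volumes are compared at radius \<open>2 powr km / 2\<close>, where the lower bound is
        still available. Nearness is preserved since \<open>D\<close> lies in the closure of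
        \<Omega>.\<close>
      then have b: "bounded \<Omega>" and "km + 1 \<le> k0" by (auto simp: ks_def)
      then have "2 powr (km + 1) \<le> 2 powr k0" by (intro powr_mono) auto
      then have rkm: "2 powr km / 2 \<le> r" using k0' by (simp add: powr_add)
      obtain y where y: "y \<in> F km" "dist x y < 2 powr km" using F(3)[OF x] by blast
      obtain n where n: "X n = y" "R n = 2 * 2 powr km" using index[of km y] y by (auto simp: ks_def)
      have y\<Omega>: "y \<in> \<Omega>" using y F(1) by auto
      have far: "dist y z < 2 powr km" if "z \<in> closure \<Omega>" for z
      proof -
        have "dist y z \<le> diameter (closure \<Omega>)"
          using b y\<Omega> that closure_subset by (intro diameter_bounded_bound) auto
        then show ?thesis using b km by (simp add: diameter_closure)
      qed
      have pos: "(0::real) < 2 powr km" by simp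
      have "\<Omega> \<subseteq> ball y (2 * 2 powr km)"
      proof
        fix z assume "z \<in> \<Omega>"
        then have "dist y z < 2 powr km" using closure_subset by (intro far) blast
        then show "z \<in> ball y (2 * 2 powr km)" using pos unfolding mem_ball by linarith
      qed
      moreover have "near x r \<longrightarrow> ball y (2 * (2 * 2 powr km)) \<inter> D \<noteq> {}"
      proof
        assume "near x r"
        then obtain z where "z \<in> D" by blast
        moreover from this have "dist y z < 2 powr km"
          using D_subset by (intro far) (auto simp: frontier_def)
        then have "z \<in> ball y (2 * (2 * 2 powr km))" using pos unfolding mem_ball by linarith
        ultimately show "ball y (2 * (2 * 2 powr km)) \<inter> D \<noteq> {}" by blast
      qed
      moreover have "measure lebesgue (B y (2 * 2 powr km)) \<le> \<omega> * 8 ^ d / c * measure lebesgue (B x r)"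
      proof -
        have "measure lebesgue (B y (2 * 2 powr km)) \<le> \<omega> * (2 * 2 powr km) ^ d" by (rule up) simp
        also have "\<dots> \<le> \<omega> * (8 * (2 powr km / 2)) ^ d"
          using \<omega> by (intro mult_left_mono power_mono) auto
        also have "\<dots> = \<omega> * 8 ^ d / c * (c * (2 powr km / 2) ^ d)"
          using c by (simp only: power_mult_distrib) simp
        also have "\<dots> \<le> \<omega> * 8 ^ d / c * measure lebesgue (B x (2 powr km / 2))"
          using \<omega> c x by (intro mult_left_mono low) auto
        also have "\<dots> \<le> \<omega> * 8 ^ d / c * measure lebesgue (B x r)"
          using \<omega> c rkm by (intro mult_left_mono measure_B_mono) auto
        finally show ?thesis .
      qed
      ultimately show ?thesis using n by (intro exI[of _ n]) auto
    qed
  qed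
qed

end

section \<open>Mean oscillation\<close>

text \<open>Monotone convergence: the sum of the norms has finite integral and is therefore finite
  almost everywhere.\<close>

lemma AE_summable_norm:
  fixes f :: "nat \<Rightarrow> 'b \<Rightarrow> 'c::{banach, second_countable_topology}"
  assumes int: "\<And>n. integrable M (f n)" and sum: "summable (\<lambda>n. LINT x|M. norm (f n x))"
  shows "AE x in M. summable (\<lambda>n. norm (f n x))"
proof -
  have [measurable]: "f n \<in> borel_measurable M" for n using int by auto
  have "(\<integral>\<^sup>+x. (\<Sum>n. ennreal (norm (f n x))) \<partial>M) = (\<Sum>n. \<integral>\<^sup>+x. ennreal (norm (f n x)) \<partial>M)"
    by (rule nn_integral_suminf) measurable
  also have "\<dots> = (\<Sum>n. ennreal (LINT x|M. norm (f n x)))"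
    by (simp add: nn_integral_eq_integral int)
  also have "\<dots> = ennreal (\<Sum>n. LINT x|M. norm (f n x))"
    by (rule suminf_ennreal2[OF _ sum]) simp
  also have "\<dots> < \<infinity>" by simp
  finally have "AE x in M. (\<Sum>n. ennreal (norm (f n x))) \<noteq> \<infinity>"
    by (intro nn_integral_PInf_AE) auto
  then show ?thesis
    by eventually_elim (auto intro: summable_suminf_not_top)
qed

text \<open>True because Lebesgue measure is complete. It is needed since a Hardy function is given
  only as an almost everywhere limit and carries no measurability assumption.\<close>

lemma lebesgue_on_measurable_AE:
  fixes f g :: "'a::euclidean_space \<Rightarrow> 'b::euclidean_space"
  assumes "S \<in> sets lebesgue" "f \<in> borel_measurable (lebesgue_on S)" "AE x in lebesgue_on S. f x = g x"
  shows "g \<in> borel_measurable (lebesgue_on S)"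
proof -
  have "AE x in lebesgue. (if x \<in> S then f x else 0) = (if x \<in> S then g x else 0)"
    using assms(1,3) by (subst (asm) AE_restrict_space_iff) auto
  from borel_measurable_AE[OF _ this] show ?thesis
    using assms by (simp add: borel_measurable_if)
qed

lemma lebesgue_on_vanishing_outside:
  fixes h :: "'a::euclidean_space \<Rightarrow> 'b::{banach, second_countable_topology}"
  assumes S: "S \<in> sets lebesgue" and B: "B \<in> sets lebesgue" "B \<subseteq> S"
    and h: "h \<in> borel_measurable (lebesgue_on S)" and z: "AE x in lebesgue_on S. x \<notin> B \<longrightarrow> h x = 0"
  shows "integrable (lebesgue_on S) h \<longleftrightarrow> integrable (lebesgue_on B) h"
    "(LINT x|lebesgue_on S. h x) = (LINT x|lebesgue_on B. h x)"
proof -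
  have r: "lebesgue_on B = restrict_space (lebesgue_on S) B"
    using S B by (subst restrict_restrict_space) (auto simp: Int_absorb1)
  have BS: "B \<inter> space (lebesgue_on S) \<in> sets (lebesgue_on S)"
    using S B by (auto simp: sets_restrict_space_iff Int_absorb1 Int_absorb2)
  have hB: "(\<lambda>x. indicator B x *\<^sub>R h x) \<in> borel_measurable (lebesgue_on S)"
    using B BS by (intro borel_measurable_scaleR[OF borel_measurable_indicator h]) (simp add: Int_absorb2)
  have ae: "AE x in lebesgue_on S. h x = indicator B x *\<^sub>R h x"
    using z by eventually_elim (auto simp: indicator_def)
  show "integrable (lebesgue_on S) h \<longleftrightarrow> integrable (lebesgue_on B) h"
    unfolding r integrable_restrict_space[OF BS] by (rule integrable_cong_AE[OF h hB ae])
  show "(LINT x|lebesgue_on S. h x) = (LINT x|lebesgue_on B. h x)"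
    unfolding r integral_restrict_space[OF BS] by (rule integral_cong_AE[OF h hB ae])
qed

lemma L2_lebesgue_on_subset:
  fixes f :: "'a::euclidean_space \<Rightarrow> 'b::euclidean_space"
  assumes S: "S \<in> sets lebesgue" and B: "B \<in> sets lebesgue" "B \<subseteq> S" and f: "f \<in> L2 (lebesgue_on S)"
  shows "f \<in> L2 (lebesgue_on B)" "l2_norm (lebesgue_on B) f \<le> l2_norm (lebesgue_on S) f"
proof -
  have r: "lebesgue_on B = restrict_space (lebesgue_on S) B"
    using S B by (subst restrict_restrict_space) (auto simp: Int_absorb1)
  have BS: "B \<inter> space (lebesgue_on S) \<in> sets (lebesgue_on S)"
    using S B by (auto simp: sets_restrict_space_iff Int_absorb1 Int_absorb2)
  have BS': "B \<in> sets (lebesgue_on S)"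
    using BS B by (simp add: Int_absorb2)
  have i: "integrable (lebesgue_on S) (\<lambda>x. indicator B x *\<^sub>R (norm (f x))\<^sup>2)"
    using integrable_mult_indicator[OF BS' L2_integrable[OF f]] by simp
  show "f \<in> L2 (lebesgue_on B)"
    unfolding L2_def using i B L2_measurable[OF f] measurable_restrict_mono[OF _ B(2)]
    by (auto simp: r integrable_restrict_space[OF BS] intro: measurable_restrict_space1)
  show "l2_norm (lebesgue_on B) f \<le> l2_norm (lebesgue_on S) f"
    unfolding l2_norm_def r integral_restrict_space[OF BS]
    by (intro real_sqrt_le_mono integral_mono i L2_integrable[OF f]) (auto simp: indicator_def)
qed

lemma (in finite_measure) L2_imp_integrable:
  assumes f: "f \<in> L2 M"
  shows "integrable M f"
proof (rule Bochner_Integration.integrable_bound[OF _ L2_measurable[OF f]])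
  show "integrable M (\<lambda>x. 1 + (norm (f x))\<^sup>2)" using L2_integrable[OF f] by simp
  have "norm (f x) \<le> norm (1 + (norm (f x))\<^sup>2)" for x
    using sum_squares_bound[of 1 "norm (f x)"] norm_ge_zero[of "f x"] by (simp del: norm_ge_zero)
  then show "AE x in M. norm (f x) \<le> norm (1 + (norm (f x))\<^sup>2)" by simp
qed

lemma (in finite_measure) L2_const: "(\<lambda>x. c) \<in> L2 M"
  by (simp add: L2_def)

lemma (in finite_measure) l2_norm_const: "l2_norm M (\<lambda>x. c) = norm c * sqrt (measure M (space M))"
  by (simp add: l2_norm_def real_sqrt_mult)

text \<open>Subtracting the mean leaves a function orthogonal to the constants, and Pythagoras
  applies. The mean is specified by a product, which avoids dividing by the total mass.\<close>

lemma (in finite_measure) l2_norm_mean_le: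
  assumes f: "f \<in> L2 M" and m: "measure M (space M) *\<^sub>R m = (LINT x|M. f x)"
  shows "l2_norm M (\<lambda>x. f x - m) \<le> l2_norm M (\<lambda>x. f x - c)"
proof (rule power2_le_imp_le)
  have fm: "(\<lambda>x. f x - m) \<in> L2 M" by (intro L2_diff L2_const f)
  have "l2_inner M (\<lambda>x. f x - m) (\<lambda>x. m - c) = (LINT x|M. f x - m) \<bullet> (m - c)"
    unfolding l2_inner_def by (intro integral_inner_left L2_imp_integrable fm)
  also have "(LINT x|M. f x - m) = 0"
    using L2_imp_integrable[OF f] by (simp add: m)
  finally have "l2_inner M (\<lambda>x. f x - m) (\<lambda>x. m - c) = 0" by simp
  then show "(l2_norm M (\<lambda>x. f x - m))\<^sup>2 \<le> (l2_norm M (\<lambda>x. f x - c))\<^sup>2"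
    using l2_norm_add_power2[OF fm L2_const[of "m - c"]] by simp
qed auto

lemma root_mean_square_eq: "root_mean_square B f = l2_norm (lebesgue_on B) f / sqrt (measure lebesgue B)"
  by (simp add: root_mean_square_def l2_norm_def real_sqrt_divide)

lemma root_mean_square_nonneg [simp]: "0 \<le> root_mean_square B f"
  by (simp add: root_mean_square_eq)

definition mean_oscillation :: "'a::euclidean_space set \<Rightarrow> ('a \<Rightarrow> complex) \<Rightarrow> real" where
  "mean_oscillation B f = root_mean_square B (\<lambda>x. f x - average B f)"

lemma mean_oscillation_nonneg [simp]: "0 \<le> mean_oscillation B f"
  by (simp add: mean_oscillation_def)

section \<open>Averages and oscillation on one set of positive finite measure\<close>

context
  fixes B :: "'a::euclidean_space set"
  assumes B: "B \<in> lmeasurable" and Bpos: "measure lebesgue B > 0"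
begin

lemma finite_measure_on: "finite_measure (lebesgue_on B)"
  by (rule finite_measure_lebesgue_on[OF B])

lemma measure_on_space: "measure (lebesgue_on B) (space (lebesgue_on B)) = measure lebesgue B"
  using B by (simp add: measure_restrict_space)

lemmas L2_on_integrable = finite_measure.L2_imp_integrable[OF finite_measure_on]
  and L2_on_const = finite_measure.L2_const[OF finite_measure_on]

lemma average_integral: "measure lebesgue B *\<^sub>R average B f = (LINT x|lebesgue_on B. f x)"
  using Bpos by (simp add: average_def)

lemma average_add:
  "f \<in> L2 (lebesgue_on B) \<Longrightarrow> g \<in> L2 (lebesgue_on B) \<Longrightarrow> average B (\<lambda>x. f x + g x) = average B f + average B g"
  by (simp add: average_def L2_on_integrable scaleR_add_right)

lemma average_cmult: "average B (\<lambda>x. c * f x) = c * average B f"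
  by (simp add: average_def)

lemma root_mean_square_add:
  assumes "f \<in> L2 (lebesgue_on B)" "g \<in> L2 (lebesgue_on B)"
  shows "root_mean_square B (\<lambda>x. f x + g x) \<le> root_mean_square B f + root_mean_square B g"
  using divide_right_mono[OF l2_norm_triangle[OF assms], of "sqrt (measure lebesgue B)"]
  by (simp add: root_mean_square_eq add_divide_distrib)

lemma root_mean_square_cmult: "root_mean_square B (\<lambda>x. c * f x) = cmod c * root_mean_square B f"
  by (simp add: root_mean_square_def norm_mult power_mult_distrib real_sqrt_mult real_sqrt_divide)

lemma L2_sub_average: "f \<in> L2 (lebesgue_on B) \<Longrightarrow> (\<lambda>x. f x - average B f) \<in> L2 (lebesgue_on B)"
  by (intro L2_diff L2_on_const)

lemma mean_oscillation_add:
  assumes f: "f \<in> L2 (lebesgue_on B)" and g: "g \<in> L2 (lebesgue_on B)"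
  shows "mean_oscillation B (\<lambda>x. f x + g x) \<le> mean_oscillation B f + mean_oscillation B g"
  using root_mean_square_add[OF L2_sub_average[OF f] L2_sub_average[OF g]]
  by (simp add: mean_oscillation_def average_add[OF f g] algebra_simps)

lemma mean_oscillation_cmult: "mean_oscillation B (\<lambda>x. c * f x) = cmod c * mean_oscillation B f"
  using root_mean_square_cmult[of c "\<lambda>x. f x - average B f"]
  by (simp add: mean_oscillation_def average_cmult algebra_simps)

lemma mean_oscillation_le_const:
  assumes f: "f \<in> L2 (lebesgue_on B)"
  shows "mean_oscillation B f \<le> root_mean_square B (\<lambda>x. f x - c)"
  unfolding mean_oscillation_def root_mean_square_eq
  by (intro divide_right_mono finite_measure.l2_norm_mean_le finite_measure_on f)
    (simp_all only: measure_on_space average_integral, simp)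

lemma mean_oscillation_le: "f \<in> L2 (lebesgue_on B) \<Longrightarrow> mean_oscillation B f \<le> root_mean_square B f"
  using mean_oscillation_le_const[of f 0] by simp

lemma root_mean_square_le_bound:
  assumes "f \<in> borel_measurable (lebesgue_on B)" "\<And>x. x \<in> B \<Longrightarrow> cmod (f x) \<le> t" "0 \<le> t"
  shows "f \<in> L2 (lebesgue_on B)" "root_mean_square B f \<le> t"
proof -
  have *: "norm (f x) \<le> norm (complex_of_real t)" if "x \<in> space (lebesgue_on B)" for x
    using assms(2)[of x] assms(3) that by simp
  show "f \<in> L2 (lebesgue_on B)"
    by (rule l2_norm_mono[OF L2_on_const assms(1) *])
  have "l2_norm (lebesgue_on B) f \<le> l2_norm (lebesgue_on B) (\<lambda>x. complex_of_real t)"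
    by (rule l2_norm_mono[OF L2_on_const assms(1) *])
  also have "\<dots> = t * sqrt (measure lebesgue B)"
    using assms(3) by (simp add: finite_measure.l2_norm_const[OF finite_measure_on] measure_on_space[simplified])
  finally show "root_mean_square B f \<le> t"
    using Bpos by (simp add: root_mean_square_eq divide_le_eq)
qed

text \<open>The integral grows with the set, and the denominators differ by at most the factor
  \<open>sqrt M\<close>.\<close>

lemma root_mean_square_enlarge:
  assumes B': "B' \<in> lmeasurable" "B \<subseteq> B'" "measure lebesgue B' \<le> M * measure lebesgue B"
    and f: "f \<in> L2 (lebesgue_on B')"
  shows "root_mean_square B f \<le> sqrt M * root_mean_square B' f"
proof -
  have B'pos: "measure lebesgue B' > 0"
    using measure_mono_fmeasurable[OF B'(2) _ B'(1)] B Bpos by (auto simp: fmeasurable_def)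
  have "sqrt (measure lebesgue B') \<le> sqrt (M * measure lebesgue B)"
    by (rule real_sqrt_le_mono[OF B'(3)])
  then have s: "sqrt (measure lebesgue B') \<le> sqrt M * sqrt (measure lebesgue B)"
    by (simp add: real_sqrt_mult)
  have "l2_norm (lebesgue_on B) f \<le> l2_norm (lebesgue_on B') f"
    using B B' by (intro L2_lebesgue_on_subset(2)[OF _ _ _ f]) (auto simp: fmeasurable_def)
  then have "l2_norm (lebesgue_on B) f * sqrt (measure lebesgue B')
      \<le> l2_norm (lebesgue_on B') f * (sqrt M * sqrt (measure lebesgue B))"
    by (intro mult_mono s) auto
  then show ?thesis
    using Bpos B'pos by (simp add: root_mean_square_eq divide_simps mult_ac)
qed

text \<open>The average over the larger set is an admissible constant on the smaller one, so
  changing the average costs nothing beyond \<open>sqrt M\<close>.\<close>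

lemma mean_oscillation_enlarge:
  assumes B': "B' \<in> lmeasurable" "B \<subseteq> B'" "measure lebesgue B' \<le> M * measure lebesgue B"
    and f: "f \<in> L2 (lebesgue_on B')"
  shows "mean_oscillation B f \<le> sqrt M * mean_oscillation B' f"
proof -
  have fB: "f \<in> L2 (lebesgue_on B)"
    using B B' by (intro L2_lebesgue_on_subset(1)[OF _ _ _ f]) (auto simp: fmeasurable_def)
  have fin: "finite_measure (lebesgue_on B')" by (rule finite_measure_lebesgue_on[OF B'(1)])
  have "mean_oscillation B f \<le> root_mean_square B (\<lambda>x. f x - average B' f)"
    by (rule mean_oscillation_le_const[OF fB])
  also have "\<dots> \<le> sqrt M * root_mean_square B' (\<lambda>x. f x - average B' f)"
    by (intro root_mean_square_enlarge B' L2_diff f finite_measure.L2_const[OF fin])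
  finally show ?thesis by (simp add: mean_oscillation_def)
qed

end

section \<open>Bilinear pairings and functions with vanishing integrals\<close>

lemma integrable_mult_L2:
  fixes f g :: "'b \<Rightarrow> complex"
  assumes f: "f \<in> L2 M" and g: "g \<in> L2 M"
  shows "integrable M (\<lambda>x. f x * g x)" "cmod (LINT x|M. f x * g x) \<le> l2_norm M f * l2_norm M g"
proof -
  note [measurable] = f[THEN L2_measurable] g[THEN L2_measurable]
  have i: "integrable M (\<lambda>x. cmod (f x) * cmod (g x))"
    using l2_inner_integrable[OF L2_norm_fun[OF f] L2_norm_fun[OF g]] by simp
  then show "integrable M (\<lambda>x. f x * g x)"
    by (rule Bochner_Integration.integrable_bound) (auto simp: norm_mult)
  have "cmod (LINT x|M. f x * g x) \<le> (LINT x|M. cmod (f x * g x))" by (rule integral_norm_bound)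
  also have "\<dots> = l2_inner M (\<lambda>x. cmod (f x)) (\<lambda>x. cmod (g x))" by (simp add: l2_inner_def norm_mult)
  also have "\<dots> \<le> l2_norm M (\<lambda>x. cmod (f x)) * l2_norm M (\<lambda>x. cmod (g x))"
    using l2_cauchy_schwarz[OF L2_norm_fun[OF f] L2_norm_fun[OF g]] by linarith
  finally show "cmod (LINT x|M. f x * g x) \<le> l2_norm M f * l2_norm M g" by (simp add: l2_norm_def)
qed

text \<open>The Riesz step yields a real inner product, while the duality is stated with the
  bilinear pairing; the conjugate mediates between the two.\<close>

lemma l2_inner_cnj:
  fixes f g :: "'b \<Rightarrow> complex"
  assumes f: "f \<in> L2 M" and g: "g \<in> L2 M"
  shows "l2_inner M (\<lambda>x. cnj (f x)) g = Re (LINT x|M. f x * g x)"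
  using integral_Re[OF integrable_mult_L2(1)[OF f g]] by (simp add: l2_inner_def inner_complex_def)

lemma L2_cnj:
  fixes f :: "'b \<Rightarrow> complex"
  assumes "f \<in> L2 M"
  shows "(\<lambda>x. cnj (f x)) \<in> L2 M" "l2_norm M (\<lambda>x. cnj (f x)) = l2_norm M f"
  using assms borel_measurable_continuous_onI[OF continuous_on_cnj[OF continuous_on_id]]
  by (auto simp: L2_def l2_norm_def intro: measurable_compose)

text \<open>The set where \<open>h\<close> is positive is, up to a null set, a countable union of
  compact sets. On each of them a positive function has integral 0, so each is null.\<close>

lemma integral_zero_on_compacts:
  fixes h :: "'a::euclidean_space \<Rightarrow> real"
  assumes S: "S \<in> sets lebesgue" and h: "integrable (lebesgue_on S) h"
    and z: "\<And>K. compact K \<Longrightarrow> K \<subseteq> S \<Longrightarrow> (LINT x|lebesgue_on S. indicator K x * h x) = 0"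
  shows "AE x in lebesgue_on S. h x \<le> 0"
proof -
  define P where "P = {x\<in>S. 0 < h x}"
  have hm[measurable]: "h \<in> borel_measurable (lebesgue_on S)" using h by auto
  have PS: "P \<in> sets (lebesgue_on S)"
    using borel_measurable_less[OF borel_measurable_const hm, of 0] by (simp add: P_def)
  have P: "P \<in> sets lebesgue" using PS S by (simp add: sets_restrict_space_iff)
  have PsubS: "P \<subseteq> S" by (auto simp: P_def)
  obtain C T where CT: "fsigma C" "T \<in> null_sets lebesgue" "C \<union> T = P" by (rule lebesgue_set_almost_fsigma[OF P])
  from \<open>fsigma C\<close> obtain G :: "nat \<Rightarrow> 'a set" where G: "\<And>n. closed (G n)" "C = (\<Union>n. G n)"
    by (cases rule: fsigma.cases) blast
  define F where "F i j = G i \<inter> cball 0 (real j)" for i j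
  have F: "compact (F i j)" "F i j \<subseteq> P" for i j
    using G CT(3) by (auto simp: F_def)
  have "AE x in lebesgue_on S. x \<in> F i j \<longrightarrow> h x = 0" for i j
  proof -
    note FP = F(2)[of i j]
    have FS: "F i j \<inter> space (lebesgue_on S) \<in> sets (lebesgue_on S)"
      using F(1)[of i j] S by (auto simp: sets_restrict_space_iff compact_imp_closed lmeasurable_compact fmeasurableD)
    have nn: "0 \<le> indicator (F i j) x * h x" for x
      using FP by (auto simp: indicator_def P_def)
    have i: "integrable (lebesgue_on S) (\<lambda>x. indicator (F i j) x * h x)"
      using integrable_mult_indicator[of "F i j" "lebesgue_on S" h] FS h FP PsubS
      by (auto simp: Int_absorb2)
    have "AE x in lebesgue_on S. indicator (F i j) x * h x = 0"
      using integral_nonneg_eq_0_iff_AE[OF i] nn z[OF F(1), of i j] FP PsubS by auto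
    then show ?thesis by eventually_elim (auto simp: indicator_def)
  qed
  then have "AE x in lebesgue_on S. \<forall>i j. x \<in> F i j \<longrightarrow> h x = 0"
    unfolding AE_all_countable by blast
  moreover have "AE x in lebesgue_on S. x \<notin> T"
  proof -
    have "AE x in lebesgue. x \<notin> T" by (rule AE_not_in[OF CT(2)])
    then show ?thesis using S by (subst AE_restrict_space_iff) (simp_all add: eventually_mono)
  qed
  moreover have "AE x in lebesgue_on S. x \<in> S" by (rule AE_I2) simp
  ultimately show ?thesis
  proof eventually_elim
    fix x assume "\<forall>i j. x \<in> F i j \<longrightarrow> h x = 0" "x \<notin> T" "x \<in> S"
    moreover have "\<exists>i j. x \<in> F i j" if "x \<in> C"
      using that G(2) real_arch_simple[of "norm x"] by (auto simp: F_def)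
    ultimately have "x \<notin> P \<or> h x = 0" using CT(3) by blast
    then show "h x \<le> 0" using \<open>x \<in> S\<close> by (auto simp: P_def)
  qed
qed

section \<open>Atoms and BMO\<close>

lemma atomic_representation_cong_AE:
  assumes "atomic_representation \<Omega> D f c a" "AE x in lebesgue_on \<Omega>. f x = g x"
  shows "atomic_representation \<Omega> D g c a"
proof -
  have "AE x in lebesgue_on \<Omega>. (\<lambda>j. c j * a j x) sums g x"
    using assms unfolding atomic_representation_def by (auto elim: eventually_elim2)
  then show ?thesis using assms by (auto simp: atomic_representation_def)
qed

text \<open>Two atomic representations are merged by alternating their terms. Real and imaginary
  parts are treated separately.\<close>

lemma sums_interleave:
  fixes f g :: "nat \<Rightarrow> complex"
  assumes "f sums x" "g sums y"
  shows "(\<lambda>n. if even n then f (n div 2) else g ((n - 1) div 2)) sums (x + y)"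
proof -
  have *: "P (if even n then u else v) = (if even n then P u else P v)" for P :: "complex \<Rightarrow> real" and n :: nat and u v
    by simp
  show ?thesis
    using sums_if[of "\<lambda>n. Re (g n)" "Re y" "\<lambda>n. Re (f n)" "Re x"]
      sums_if[of "\<lambda>n. Im (g n)" "Im y" "\<lambda>n. Im (f n)" "Im x"] assms
    by (simp add: sums_complex_iff * add.commute)
qed

lemma H1_add:
  assumes "f \<in> H1 \<Omega> D" "g \<in> H1 \<Omega> D"
  shows "(\<lambda>x. f x + g x) \<in> H1 \<Omega> D"
proof -
  obtain c a d b where r: "atomic_representation \<Omega> D f c a" "atomic_representation \<Omega> D g d b"
    using assms by (auto simp: H1_def)
  define e where "e n = (if even n then c (n div 2) else d ((n - 1) div 2))" for n
  define h where "h n = (if even n then a (n div 2) else b ((n - 1) div 2))" for n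
  \<comment> \<open>The moduli are viewed as complex numbers so that the interleaving lemma also
    merges the two coefficient series.\<close>
  have "summable (\<lambda>n. complex_of_real (cmod (c n)))" "summable (\<lambda>n. complex_of_real (cmod (d n)))"
    using r by (auto simp: atomic_representation_def summable_of_real)
  from sums_interleave[OF this[THEN summable_sums]]
  have "summable (\<lambda>n. complex_of_real (cmod (e n)))"
    by (auto simp: sums_iff e_def if_distrib cong: if_cong)
  then have "summable (\<lambda>n. Re (complex_of_real (cmod (e n))))" by (rule summable_Re)
  then have "summable (\<lambda>n. cmod (e n))" by simp
  moreover have "h1_atom \<Omega> D (h n)" for n
    using r by (auto simp: h_def atomic_representation_def)
  moreover have "AE x in lebesgue_on \<Omega>. (\<lambda>j. c j * a j x) sums f x" "AE x in lebesgue_on \<Omega>. (\<lambda>j. d j * b j x) sums g x"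
    using r by (auto simp: atomic_representation_def)
  then have "AE x in lebesgue_on \<Omega>. (\<lambda>j. e j * h j x) sums (f x + g x)"
  proof eventually_elim
    fix x assume "(\<lambda>j. c j * a j x) sums f x" "(\<lambda>j. d j * b j x) sums g x"
    from sums_interleave[OF this]
    have "(\<lambda>n. if even n then c (n div 2) * a (n div 2) x else d ((n - 1) div 2) * b ((n - 1) div 2) x) sums (f x + g x)" .
    moreover have "(\<lambda>n. if even n then c (n div 2) * a (n div 2) x else d ((n - 1) div 2) * b ((n - 1) div 2) x)
        = (\<lambda>j. e j * h j x)"
      by (auto simp: e_def h_def)
    ultimately show "(\<lambda>j. e j * h j x) sums (f x + g x)" by simp
  qed
  ultimately have "atomic_representation \<Omega> D (\<lambda>x. f x + g x) e h"
    by (auto simp: atomic_representation_def)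
  then show ?thesis by (auto simp: H1_def)
qed

lemma H1_cmult:
  assumes "f \<in> H1 \<Omega> D"
  shows "(\<lambda>x. k * f x) \<in> H1 \<Omega> D"
proof -
  obtain c a where r: "atomic_representation \<Omega> D f c a"
    using assms by (auto simp: H1_def)
  have "AE x in lebesgue_on \<Omega>. (\<lambda>j. c j * a j x) sums f x"
    using r by (auto simp: atomic_representation_def)
  then have "AE x in lebesgue_on \<Omega>. (\<lambda>j. k * c j * a j x) sums (k * f x)"
    by eventually_elim (auto simp: mult.assoc intro: sums_mult)
  then have "atomic_representation \<Omega> D (\<lambda>x. k * f x) (\<lambda>j. k * c j) a"
    using r by (auto simp: atomic_representation_def norm_mult intro: summable_mult)
  then show ?thesis by (auto simp: H1_def)
qed

section \<open>Linear structure and boundedness of test functions\<close>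

lemma Cc_add:
  assumes "\<phi> \<in> Cc \<Omega>" "\<psi> \<in> Cc \<Omega>"
  shows "(\<lambda>x. \<phi> x + \<psi> x) \<in> Cc \<Omega>"
proof -
  obtain K L where "compact K" "K \<subseteq> \<Omega>" "\<forall>x\<in>\<Omega> - K. \<phi> x = 0" "compact L" "L \<subseteq> \<Omega>" "\<forall>x\<in>\<Omega> - L. \<psi> x = 0"
    using assms by (auto simp: Cc_def)
  then show ?thesis using assms
    unfolding Cc_def by (auto intro!: continuous_intros exI[of _ "K \<union> L"])
qed

lemma Cc_cmult: "\<phi> \<in> Cc \<Omega> \<Longrightarrow> (\<lambda>x. c * \<phi> x) \<in> Cc \<Omega>"
  unfolding Cc_def by (auto intro!: continuous_intros)

lemma Cc_diff: "\<phi> \<in> Cc \<Omega> \<Longrightarrow> \<psi> \<in> Cc \<Omega> \<Longrightarrow> (\<lambda>x. \<phi> x - \<psi> x) \<in> Cc \<Omega>"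
  using Cc_add[of \<phi> \<Omega> "\<lambda>x. (-1) * \<psi> x"] Cc_cmult[of \<psi> \<Omega> "-1"] by simp

lemma Cc_zero: "(\<lambda>x. 0) \<in> Cc \<Omega>"
  unfolding Cc_def by auto

lemma Cc_bounded:
  assumes "\<phi> \<in> Cc \<Omega>"
  obtains t where "t \<ge> 0" "\<And>x. x \<in> \<Omega> \<Longrightarrow> cmod (\<phi> x) \<le> t"
proof -
  obtain K where K: "compact K" "K \<subseteq> \<Omega>" "\<forall>x\<in>\<Omega> - K. \<phi> x = 0" and c: "continuous_on \<Omega> \<phi>"
    using assms by (auto simp: Cc_def)
  have "bounded (\<phi> ` K)"
    using K c by (intro compact_imp_bounded compact_continuous_image continuous_on_subset[OF c])
  then obtain t where t: "\<And>x. x \<in> K \<Longrightarrow> cmod (\<phi> x) \<le> t" by (auto simp: bounded_iff)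
  show thesis
  proof (rule that[of "max 0 t"])
    show "cmod (\<phi> x) \<le> max 0 t" if "x \<in> \<Omega>" for x
      using t[of x] K(3) that by (cases "x \<in> K") (auto simp: le_max_iff_disj)
  qed simp
qed

section \<open>The BMO seminorm and its pairing with atoms\<close>

context uitc_domain
begin

lemma Cc_measurable: "\<phi> \<in> Cc \<Omega> \<Longrightarrow> \<phi> \<in> borel_measurable (lebesgue_on \<Omega>)"
  unfolding Cc_def by (auto intro: continuous_imp_measurable_on_sets_lebesgue)

lemma restrict_measurable:
  "f \<in> borel_measurable (lebesgue_on \<Omega>) \<Longrightarrow> f \<in> borel_measurable (lebesgue_on (B x r))"
  by (rule measurable_restrict_mono) auto

lemma BMO_L2: "f \<in> BMO \<Omega> D \<Longrightarrow> f \<in> L2 (lebesgue_on (B x r))"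
  unfolding L2_def BMO_def using B_sets[of x r] bounded_Int[of "ball x r" \<Omega>]
  by (auto intro: restrict_measurable)

lemma bmo_enorm_alt:
  "bmo_enorm \<Omega> D f = max (SUP b\<in>usual_balls \<Omega> D. ennreal (mean_oscillation (usual_ball_set b) f))
     (SUP b\<in>near_balls \<Omega> D. ennreal (root_mean_square (usual_ball_set b) f))"
  by (simp add: bmo_enorm_def mean_oscillation_def)

lemma bmo_enorm_le:
  assumes "\<And>x r. x \<in> \<Omega> \<Longrightarrow> r > 0 \<Longrightarrow> mean_oscillation (B x r) f \<le> t"
    "\<And>x r. x \<in> \<Omega> \<Longrightarrow> r > 0 \<Longrightarrow> near x r \<Longrightarrow> root_mean_square (B x r) f \<le> t"
  shows "bmo_enorm \<Omega> D f \<le> ennreal t"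
  unfolding bmo_enorm_alt usual_balls_eq near_balls_eq
proof (intro max.boundedI SUP_least)
  fix b :: "'a set \<times> 'a \<times> real" assume "b \<in> {(\<Omega>, x, r) | x r. x \<in> \<Omega> \<and> r > 0}"
  then show "ennreal (mean_oscillation (usual_ball_set b) f) \<le> ennreal t"
    using assms(1) by (auto intro: ennreal_leI)
next
  fix b :: "'a set \<times> 'a \<times> real" assume "b \<in> {(\<Omega>, x, r) | x r. x \<in> \<Omega> \<and> r > 0 \<and> near x r}"
  then obtain x r where "b = (\<Omega>, x, r)" "x \<in> \<Omega>" "r > 0" "near x r" by blast
  then show "ennreal (root_mean_square (usual_ball_set b) f) \<le> ennreal t"
    using assms(2) by (simp add: ennreal_leI)
qed

lemma bmo_norm_le:
  assumes "t \<ge> 0" "\<And>x r. x \<in> \<Omega> \<Longrightarrow> r > 0 \<Longrightarrow> mean_oscillation (B x r) f \<le> t"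
    "\<And>x r. x \<in> \<Omega> \<Longrightarrow> r > 0 \<Longrightarrow> near x r \<Longrightarrow> root_mean_square (B x r) f \<le> t"
  shows "bmo_norm \<Omega> D f \<le> t"
  unfolding bmo_norm_def using enn2real_mono[OF bmo_enorm_le[OF assms(2,3)]] assms(1) by simp

lemma bmo_norm_nonneg [simp]: "0 \<le> bmo_norm \<Omega> D f"
  by (simp add: bmo_norm_def)

lemma bmo_norm_ge:
  assumes f: "f \<in> BMO \<Omega> D" and x: "x \<in> \<Omega>" "r > 0"
  shows "mean_oscillation (B x r) f \<le> bmo_norm \<Omega> D f"
    and "near x r \<Longrightarrow> root_mean_square (B x r) f \<le> bmo_norm \<Omega> D f"
proof -
  \<comment> \<open>Membership in \<open>BMO\<close> matters here: \<open>enn2real\<close> sends an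
    infinite supremum to 0.\<close>
  have fin: "ennreal (bmo_norm \<Omega> D f) = bmo_enorm \<Omega> D f"
    using f unfolding bmo_norm_def BMO_def by (auto simp: ennreal_enn2real_if)
  have "(\<Omega>, x, r) \<in> usual_balls \<Omega> D" using x by (auto simp: usual_balls_eq)
  then have "ennreal (mean_oscillation (usual_ball_set (\<Omega>, x, r)) f) \<le> bmo_enorm \<Omega> D f"
    unfolding bmo_enorm_alt by (intro max.coboundedI1 SUP_upper)
  then show "mean_oscillation (B x r) f \<le> bmo_norm \<Omega> D f"
    by (simp add: ennreal_le_iff flip: fin)
  assume "near x r"
  then have "(\<Omega>, x, r) \<in> near_balls \<Omega> D" using x by (auto simp: near_balls_eq)
  then have "ennreal (root_mean_square (usual_ball_set (\<Omega>, x, r)) f) \<le> bmo_enorm \<Omega> D f"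
    unfolding bmo_enorm_alt by (intro max.coboundedI2 SUP_upper)
  then show "root_mean_square (B x r) f \<le> bmo_norm \<Omega> D f"
    by (simp add: ennreal_le_iff flip: fin)
qed

lemma BMO_I:
  assumes "f \<in> borel_measurable (lebesgue_on \<Omega>)"
    "\<And>A. A \<in> sets lebesgue \<Longrightarrow> A \<subseteq> \<Omega> \<Longrightarrow> bounded A \<Longrightarrow> f \<in> L2 (lebesgue_on A)"
    "\<And>x r. x \<in> \<Omega> \<Longrightarrow> r > 0 \<Longrightarrow> mean_oscillation (B x r) f \<le> t"
    "\<And>x r. x \<in> \<Omega> \<Longrightarrow> r > 0 \<Longrightarrow> near x r \<Longrightarrow> root_mean_square (B x r) f \<le> t"
  shows "f \<in> BMO \<Omega> D"
  unfolding BMO_def using assms(1,2) bmo_enorm_le[OF assms(3,4)]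
  by (auto simp: L2_integrable intro: le_less_trans)

lemma BMO_L2_bounded:
  assumes "f \<in> BMO \<Omega> D" "A \<in> sets lebesgue" "A \<subseteq> \<Omega>" "bounded A"
  shows "f \<in> L2 (lebesgue_on A)"
proof -
  have "f \<in> borel_measurable (lebesgue_on A)"
    by (rule measurable_restrict_mono[OF _ assms(3)]) (use assms(1) in \<open>simp add: BMO_def\<close>)
  then show ?thesis using assms by (simp add: BMO_def L2_def)
qed

lemma BMO_measurable: "f \<in> BMO \<Omega> D \<Longrightarrow> f \<in> borel_measurable (lebesgue_on \<Omega>)"
  by (simp add: BMO_def)

lemma
  assumes f: "f \<in> BMO \<Omega> D" and g: "g \<in> BMO \<Omega> D"
  shows BMO_add: "(\<lambda>x. f x + g x) \<in> BMO \<Omega> D"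
    and bmo_norm_add: "bmo_norm \<Omega> D (\<lambda>x. f x + g x) \<le> bmo_norm \<Omega> D f + bmo_norm \<Omega> D g"
proof -
  have 1: "mean_oscillation (B x r) (\<lambda>x. f x + g x) \<le> bmo_norm \<Omega> D f + bmo_norm \<Omega> D g" if "x \<in> \<Omega>" "r > 0" for x r
    using mean_oscillation_add[OF B_lmeasurable measure_B_pos[OF that] BMO_L2[OF f] BMO_L2[OF g]]
      bmo_norm_ge(1)[OF f that] bmo_norm_ge(1)[OF g that] by linarith
  have 2: "root_mean_square (B x r) (\<lambda>x. f x + g x) \<le> bmo_norm \<Omega> D f + bmo_norm \<Omega> D g" if "x \<in> \<Omega>" "r > 0" "near x r" for x r
    using root_mean_square_add[OF B_lmeasurable measure_B_pos[OF that(1,2)] BMO_L2[OF f] BMO_L2[OF g]]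
      bmo_norm_ge(2)[OF f that] bmo_norm_ge(2)[OF g that] by linarith
  show "(\<lambda>x. f x + g x) \<in> BMO \<Omega> D"
    by (rule BMO_I[OF _ _ 1 2]) (use f g in \<open>auto intro: L2_add BMO_L2_bounded borel_measurable_add BMO_measurable\<close>)
  show "bmo_norm \<Omega> D (\<lambda>x. f x + g x) \<le> bmo_norm \<Omega> D f + bmo_norm \<Omega> D g"
    by (rule bmo_norm_le[OF _ 1 2]) auto
qed

lemma
  assumes f: "f \<in> BMO \<Omega> D"
  shows BMO_cmult: "(\<lambda>x. c * f x) \<in> BMO \<Omega> D"
    and bmo_norm_cmult: "bmo_norm \<Omega> D (\<lambda>x. c * f x) \<le> cmod c * bmo_norm \<Omega> D f"
proof -
  have 1: "mean_oscillation (B x r) (\<lambda>x. c * f x) \<le> cmod c * bmo_norm \<Omega> D f" if "x \<in> \<Omega>" "r > 0" for x r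
    unfolding mean_oscillation_cmult[OF B_lmeasurable measure_B_pos[OF that]]
    by (intro mult_left_mono bmo_norm_ge(1)[OF f that]) simp
  have 2: "root_mean_square (B x r) (\<lambda>x. c * f x) \<le> cmod c * bmo_norm \<Omega> D f" if "x \<in> \<Omega>" "r > 0" "near x r" for x r
    unfolding root_mean_square_cmult[OF B_lmeasurable measure_B_pos[OF that(1,2)]]
    by (intro mult_left_mono bmo_norm_ge(2)[OF f that]) simp
  show "(\<lambda>x. c * f x) \<in> BMO \<Omega> D"
    by (rule BMO_I[OF _ _ 1 2]) (use f in \<open>auto intro: L2_cmult BMO_L2_bounded borel_measurable_times BMO_measurable\<close>)
  show "bmo_norm \<Omega> D (\<lambda>x. c * f x) \<le> cmod c * bmo_norm \<Omega> D f"
    by (rule bmo_norm_le[OF _ 1 2]) auto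
qed

text \<open>Not restricted to compact support, because the constant 1 is also used as a test
  function: pairing with it shows that Hardy functions are integrable.\<close>

lemma BMO_bounded:
  assumes f: "f \<in> borel_measurable (lebesgue_on \<Omega>)" "\<And>x. x \<in> \<Omega> \<Longrightarrow> cmod (f x) \<le> t" "t \<ge> 0"
  shows "f \<in> BMO \<Omega> D"
proof -
  have rms: "f \<in> L2 (lebesgue_on (B x r))" "root_mean_square (B x r) f \<le> t" if "x \<in> \<Omega>" "r > 0" for x r
    using root_mean_square_le_bound[OF B_lmeasurable measure_B_pos[OF that] restrict_measurable[OF f(1)]] f(2,3) by auto
  show ?thesis
  proof (rule BMO_I[OF f(1), of t])
    fix A assume A: "A \<in> sets lebesgue" "A \<subseteq> \<Omega>" "bounded A"
    then have fin: "finite_measure (lebesgue_on A)"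
      by (intro finite_measure_lebesgue_on bounded_set_imp_lmeasurable)
    show "f \<in> L2 (lebesgue_on A)"
      by (rule l2_norm_mono(1)[OF finite_measure.L2_const[OF fin, of "complex_of_real t"]])
        (use A f measurable_restrict_mono[OF f(1) A(2)] in auto)
  next
    fix x r assume "x \<in> \<Omega>" "(r::real) > 0"
    from rms[OF this] mean_oscillation_le[OF B_lmeasurable measure_B_pos[OF this] rms(1)[OF this]]
    show "mean_oscillation (B x r) f \<le> t" by linarith
  qed (use rms in auto)
qed

lemma Cc_BMO: "\<phi> \<in> Cc \<Omega> \<Longrightarrow> \<phi> \<in> BMO \<Omega> D"
  using Cc_bounded[of \<phi> \<Omega>] BMO_bounded Cc_measurable by metis

lemma bmo_norm_zero: "bmo_norm \<Omega> D (\<lambda>x. 0) = 0"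
  using bmo_norm_cmult[OF Cc_BMO[OF Cc_zero], of 0] bmo_norm_nonneg[of "\<lambda>x. 0"] by simp

text \<open>Cauchy-Schwarz on the ball of the atom. If the atom has integral 0, the average of
  \<phi> may be subtracted and the oscillation remains; otherwise the ball is near \<open>D\<close>,
  where the norm controls \<phi> itself. Cauchy-Schwarz against the constant 1 gives the bound on
  the integral of the modulus.\<close>

lemma atom_pairing:
  assumes a: "h1_atom \<Omega> D a" and \<phi>: "\<phi> \<in> BMO \<Omega> D"
  shows "integrable (lebesgue_on \<Omega>) (\<lambda>x. a x * \<phi> x)"
    "cmod (LINT x|lebesgue_on \<Omega>. a x * \<phi> x) \<le> bmo_norm \<Omega> D \<phi>"
    "integrable (lebesgue_on \<Omega>) a" "(LINT x|lebesgue_on \<Omega>. cmod (a x)) \<le> 1"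
proof -
  obtain b where b: "b \<in> usual_balls \<Omega> D"
    and supp': "closure {z \<in> \<Omega>. a z \<noteq> 0} \<subseteq> closure (usual_ball_set b)"
    and int: "integrable (lebesgue_on \<Omega>) (\<lambda>z. (cmod (a z))\<^sup>2)"
    and an': "sqrt (LINT z|lebesgue_on \<Omega>. (cmod (a z))\<^sup>2) \<le> measure lebesgue (usual_ball_set b) powr (- (1/2))"
    and alt': "(LINT z|lebesgue_on \<Omega>. a z) = 0 \<or> b \<in> near_balls \<Omega> D"
    using a unfolding h1_atom_def by blast
  obtain x r where bx: "b = (\<Omega>, x, r)" and x: "x \<in> \<Omega>" "r > 0"
    using b unfolding usual_balls_eq by blast
  have supp: "closure {z \<in> \<Omega>. a z \<noteq> 0} \<subseteq> closure (B x r)" using supp' bx by simp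
  have aL2: "a \<in> L2 (lebesgue_on \<Omega>)" using a int by (simp add: h1_atom_def L2_def)
  have an: "l2_norm (lebesgue_on \<Omega>) a \<le> measure lebesgue (B x r) powr (- (1/2))"
    using an' bx by (simp add: l2_norm_def)
  have alt: "(LINT z|lebesgue_on \<Omega>. a z) = 0 \<or> near x r"
  proof -
    have "near x r" if "b \<in> near_balls \<Omega> D" using that by (simp add: bx near_balls_eq)
    then show ?thesis using alt' by blast
  qed
  define \<mu> where "\<mu> = sqrt (measure lebesgue (B x r))"
  have pos: "measure lebesgue (B x r) > 0" by (rule measure_B_pos[OF x])
  have \<mu>: "\<mu> > 0" using pos by (simp add: \<mu>_def)
  note [measurable] = L2_measurable[OF aL2] BMO_measurable[OF \<phi>]
  have aB: "a \<in> L2 (lebesgue_on (B x r))"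
    by (rule L2_lebesgue_on_subset(1)[OF \<Omega>_sets B_sets _ aL2]) simp
  have "l2_norm (lebesgue_on (B x r)) a \<le> l2_norm (lebesgue_on \<Omega>) a"
    by (rule L2_lebesgue_on_subset(2)[OF \<Omega>_sets B_sets _ aL2]) simp
  also have "l2_norm (lebesgue_on \<Omega>) a \<le> 1 / \<mu>"
  proof -
    have "measure lebesgue (B x r) powr (- (1/2)) = 1 / \<mu>"
      using pos by (simp only: powr_minus_divide \<mu>_def powr_half_sqrt[OF less_imp_le])
    then show ?thesis using an by linarith
  qed
  finally have aBn: "l2_norm (lebesgue_on (B x r)) a \<le> 1 / \<mu>" .
  have \<phi>B: "\<phi> \<in> L2 (lebesgue_on (B x r))" by (rule BMO_L2[OF \<phi>])
  \<comment> \<open>The support condition allows the closed ball. Its bounding sphere is a null set,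
    so integrals reduce to the open ball.\<close>
  have az: "AE z in lebesgue_on \<Omega>. z \<notin> B x r \<longrightarrow> a z = 0"
  proof -
    have "AE z in lebesgue. z \<notin> sphere x r"
      by (rule AE_not_in[OF negligible_sphere[unfolded negligible_iff_null_sets]])
    moreover have inside: "z \<in> cball x r" if "z \<in> \<Omega>" "a z \<noteq> 0" for z
    proof -
      have "z \<in> closure {z \<in> \<Omega>. a z \<noteq> 0}" by (rule subsetD[OF closure_subset]) (use that in simp)
      also have "\<dots> \<subseteq> closure (B x r)" by (rule supp)
      also have "\<dots> \<subseteq> cball x r" by (rule closure_minimal) auto
      finally show ?thesis .
    qed
    ultimately have "AE z in lebesgue. z \<in> \<Omega> \<longrightarrow> z \<notin> B x r \<longrightarrow> a z = 0"
    proof (elim eventually_mono, intro impI)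
      fix z assume "z \<notin> sphere x r" "z \<in> \<Omega>" "z \<notin> B x r"
      then show "a z = 0" using inside[of z] by (cases "a z = 0") auto
    qed
    then show ?thesis by (subst AE_restrict_space_iff) simp_all
  qed
  note vanish = lebesgue_on_vanishing_outside[OF \<Omega>_sets B_sets]
  have ia: "integrable (lebesgue_on \<Omega>) a" "(LINT z|lebesgue_on \<Omega>. a z) = (LINT z|lebesgue_on (B x r). a z)"
    using vanish[of x r a] az L2_on_integrable[OF B_lmeasurable pos aB] by auto
  then show "integrable (lebesgue_on \<Omega>) a" by simp
  have "AE z in lebesgue_on \<Omega>. z \<notin> B x r \<longrightarrow> cmod (a z) = 0"
    using az by eventually_elim auto
  then have "(LINT z|lebesgue_on \<Omega>. cmod (a z)) = (LINT z|lebesgue_on (B x r). cmod (a z))"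
    by (intro vanish) auto
  also have "\<dots> = l2_inner (lebesgue_on (B x r)) (\<lambda>z. cmod (a z)) (\<lambda>z. 1)"
    by (simp add: l2_inner_def)
  also have "\<dots> \<le> l2_norm (lebesgue_on (B x r)) (\<lambda>z. cmod (a z)) * l2_norm (lebesgue_on (B x r)) (\<lambda>z. 1::real)"
    using l2_cauchy_schwarz[OF L2_norm_fun[OF aB] L2_on_const[OF B_lmeasurable pos, of "1::real"]] by linarith
  also have "l2_norm (lebesgue_on (B x r)) (\<lambda>z. 1::real) = \<mu>"
    using finite_measure.l2_norm_const[OF finite_measure_on[OF B_lmeasurable pos], of "1::real"]
      measure_on_space[OF B_lmeasurable pos] by (simp add: \<mu>_def)
  also have "l2_norm (lebesgue_on (B x r)) (\<lambda>z. cmod (a z)) * \<mu> \<le> 1"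
    using aBn \<mu> by (simp add: l2_norm_def field_simps)
  finally show "(LINT z|lebesgue_on \<Omega>. cmod (a z)) \<le> 1" .
  have "AE z in lebesgue_on \<Omega>. z \<notin> B x r \<longrightarrow> a z * \<phi> z = 0"
    using az by eventually_elim auto
  then have ip: "integrable (lebesgue_on \<Omega>) (\<lambda>z. a z * \<phi> z)"
    "(LINT z|lebesgue_on \<Omega>. a z * \<phi> z) = (LINT z|lebesgue_on (B x r). a z * \<phi> z)"
    using vanish[of x r "\<lambda>z. a z * \<phi> z"] integrable_mult_L2(1)[OF aB \<phi>B] by auto
  show "integrable (lebesgue_on \<Omega>) (\<lambda>z. a z * \<phi> z)" by (rule ip)
  have est: "cmod (LINT z|lebesgue_on (B x r). a z * h z) \<le> root_mean_square (B x r) h"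
    if h: "h \<in> L2 (lebesgue_on (B x r))" for h
  proof -
    have "cmod (LINT z|lebesgue_on (B x r). a z * h z) \<le> l2_norm (lebesgue_on (B x r)) a * l2_norm (lebesgue_on (B x r)) h"
      by (rule integrable_mult_L2(2)[OF aB h])
    also have "\<dots> \<le> 1 / \<mu> * l2_norm (lebesgue_on (B x r)) h"
      using aBn by (intro mult_right_mono) auto
    finally show ?thesis by (simp add: root_mean_square_eq \<mu>_def)
  qed
  show "cmod (LINT z|lebesgue_on \<Omega>. a z * \<phi> z) \<le> bmo_norm \<Omega> D \<phi>"
    using alt
  proof
    assume "near x r"
    then show ?thesis unfolding ip(2) using est[OF \<phi>B] bmo_norm_ge(2)[OF \<phi> x] by linarith
  next
    let ?m = "average (B x r) \<phi>"
    assume 0: "(LINT z|lebesgue_on \<Omega>. a z) = 0"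
    have "(LINT z|lebesgue_on (B x r). a z * (\<phi> z - ?m))
        = (LINT z|lebesgue_on (B x r). a z * \<phi> z) - (LINT z|lebesgue_on (B x r). a z) * ?m"
      unfolding right_diff_distrib
      using integrable_mult_L2(1)[OF aB \<phi>B] L2_on_integrable[OF B_lmeasurable pos aB] by simp
    then have "(LINT z|lebesgue_on \<Omega>. a z * \<phi> z) = (LINT z|lebesgue_on (B x r). a z * (\<phi> z - ?m))"
      using 0 ia ip by simp
    then show ?thesis
      using est[OF L2_sub_average[OF B_lmeasurable pos \<phi>B]] bmo_norm_ge(1)[OF \<phi> x]
      by (simp add: mean_oscillation_def)
  qed
qed

text \<open>Atoms have L1 norm at most 1, so against a function bounded by \<open>t\<close> the j-th
  term has L1 norm at most \<open>t\<close> times the modulus of its coefficient. This allows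
  termwise integration.\<close>

lemma H1_pairing_sums:
  assumes f: "atomic_representation \<Omega> D f c a"
    and \<phi>: "\<phi> \<in> borel_measurable (lebesgue_on \<Omega>)" "\<And>x. x \<in> \<Omega> \<Longrightarrow> cmod (\<phi> x) \<le> t" "t \<ge> 0"
  shows "integrable (lebesgue_on \<Omega>) (\<lambda>x. f x * \<phi> x)"
    "(\<lambda>j. c j * (LINT x|lebesgue_on \<Omega>. a j x * \<phi> x)) sums (LINT x|lebesgue_on \<Omega>. f x * \<phi> x)"
proof -
  let ?M = "lebesgue_on \<Omega>"
  have at: "h1_atom \<Omega> D (a j)" for j using f by (simp add: atomic_representation_def)
  have sc: "summable (\<lambda>j. cmod (c j))" using f by (simp add: atomic_representation_def)
  note \<phi>BMO = BMO_bounded[OF \<phi>]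
  let ?g = "\<lambda>j x. c j * (a j x * \<phi> x)"
  have ig: "integrable ?M (?g j)" for j
    by (intro integrable_mult_right atom_pairing(1)[OF at \<phi>BMO])
  have "(LINT x|?M. norm (?g j x)) \<le> cmod (c j) * t" for j
  proof -
    have "(LINT x|?M. norm (?g j x)) \<le> (LINT x|?M. (cmod (c j) * t) * cmod (a j x))"
    proof (rule integral_mono)
      fix x assume "x \<in> space ?M"
      then have "cmod (\<phi> x) \<le> t" using \<phi>(2) by simp
      then have "(cmod (c j) * cmod (a j x)) * cmod (\<phi> x) \<le> (cmod (c j) * cmod (a j x)) * t"
        by (intro mult_left_mono) auto
      then show "norm (?g j x) \<le> (cmod (c j) * t) * cmod (a j x)" by (simp add: norm_mult mult_ac)
    qed (use ig atom_pairing(3)[OF at \<phi>BMO] in auto)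
    also have "\<dots> = (cmod (c j) * t) * (LINT x|?M. cmod (a j x))" by simp
    also have "\<dots> \<le> (cmod (c j) * t) * 1"
      using \<phi>(3) by (intro mult_left_mono atom_pairing(4)[OF at \<phi>BMO]) auto
    finally show ?thesis by simp
  qed
  then have ss: "summable (\<lambda>j. LINT x|?M. norm (?g j x))"
    by (intro summable_comparison_test'[OF summable_mult2[OF sc, of t], of 0]) auto
  note ae = AE_summable_norm[OF ig ss]
  have eq: "AE x in ?M. (\<Sum>j. ?g j x) = f x * \<phi> x"
  proof -
    have "AE x in ?M. (\<lambda>j. c j * a j x) sums f x" using f by (simp add: atomic_representation_def)
    then show ?thesis
    proof eventually_elim
      fix x assume "(\<lambda>j. c j * a j x) sums f x"
      from sums_mult2[OF this, of "\<phi> x"] show "(\<Sum>j. ?g j x) = f x * \<phi> x"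
        by (simp add: sums_iff mult.assoc)
    qed
  qed
  have int: "integrable ?M (\<lambda>x. \<Sum>j. ?g j x)" by (rule integrable_suminf[OF ig ae ss])
  have meas: "(\<lambda>x. f x * \<phi> x) \<in> borel_measurable ?M"
    by (rule lebesgue_on_measurable_AE[OF \<Omega>_sets _ eq]) (use int in auto)
  show "integrable ?M (\<lambda>x. f x * \<phi> x)"
    using int integrable_cong_AE[OF _ meas eq] by auto
  have "(LINT x|?M. f x * \<phi> x) = (LINT x|?M. (\<Sum>j. ?g j x))"
    by (rule integral_cong_AE[symmetric]) (use int meas eq in auto)
  then show "(\<lambda>j. c j * (LINT x|?M. a j x * \<phi> x)) sums (LINT x|?M. f x * \<phi> x)"
    using sums_integral[OF ig ae ss] by simp
qed

lemma H1_integrable: "f \<in> H1 \<Omega> D \<Longrightarrow> integrable (lebesgue_on \<Omega>) f"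
  using H1_pairing_sums(1)[of f _ _ "\<lambda>x. 1" 1] by (auto simp: H1_def)

lemma H1_Cc_integrable:
  assumes f: "f \<in> H1 \<Omega> D" and \<phi>: "\<phi> \<in> Cc \<Omega>"
  shows "integrable (lebesgue_on \<Omega>) (\<lambda>x. f x * \<phi> x)"
  using f Cc_bounded[OF \<phi>] H1_pairing_sums(1)[OF _ Cc_measurable[OF \<phi>]] by (auto simp: H1_def) metis

text \<open>Each atomic representation gives the estimate with its own coefficient sum; the infimum
  over all of them gives the norm.\<close>

lemma H1_pairing_le:
  assumes f: "f \<in> H1 \<Omega> D" and \<phi>: "\<phi> \<in> Cc \<Omega>"
  shows "cmod (LINT x|lebesgue_on \<Omega>. f x * \<phi> x) \<le> h1_norm \<Omega> D f * bmo_norm \<Omega> D \<phi>"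
proof -
  let ?I = "LINT x|lebesgue_on \<Omega>. f x * \<phi> x"
  let ?S = "{\<Sum>j. cmod (c j) |c a. atomic_representation \<Omega> D f c a}"
  have le: "cmod ?I \<le> s * bmo_norm \<Omega> D \<phi>" if sS: "s \<in> ?S" for s
  proof -
    obtain c a where s: "s = (\<Sum>j. cmod (c j))" and r: "atomic_representation \<Omega> D f c a" using sS by blast
    obtain t where "t \<ge> 0" "\<And>x. x \<in> \<Omega> \<Longrightarrow> cmod (\<phi> x) \<le> t" using Cc_bounded[OF \<phi>] by blast
    then have sums: "(\<lambda>j. c j * (LINT x|lebesgue_on \<Omega>. a j x * \<phi> x)) sums ?I"
      by (intro H1_pairing_sums(2)[OF r Cc_measurable[OF \<phi>]])
    have sc: "summable (\<lambda>j. cmod (c j) * bmo_norm \<Omega> D \<phi>)"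
      using r by (intro summable_mult2) (simp add: atomic_representation_def)
    have b: "norm (c j * (LINT x|lebesgue_on \<Omega>. a j x * \<phi> x)) \<le> cmod (c j) * bmo_norm \<Omega> D \<phi>" for j
      unfolding norm_mult using r
      by (intro mult_left_mono atom_pairing(2) Cc_BMO \<phi>) (auto simp: atomic_representation_def)
    have "cmod ?I \<le> (\<Sum>j. cmod (c j) * bmo_norm \<Omega> D \<phi>)"
      using norm_suminf_le[OF b sc] sums by (simp add: sums_iff)
    also have "\<dots> = s * bmo_norm \<Omega> D \<phi>"
      unfolding s using r by (intro suminf_mult2[symmetric]) (simp add: atomic_representation_def)
    finally show ?thesis .
  qed
  obtain s where s: "s \<in> ?S" using f by (auto simp: H1_def)
  show ?thesis
  \<comment> \<open>The infimum is taken after dividing by the seminorm, hence the separate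
    case.\<close>
  proof (cases "bmo_norm \<Omega> D \<phi> = 0")
    case True
    then show ?thesis using le[OF s] by simp
  next
    case False
    then have p: "bmo_norm \<Omega> D \<phi> > 0" using bmo_norm_nonneg[of \<phi>] by linarith
    have "cmod ?I / bmo_norm \<Omega> D \<phi> \<le> h1_norm \<Omega> D f"
      unfolding h1_norm_def using s le p by (intro cInf_greatest) (auto simp: divide_le_eq)
    then show ?thesis using p by (simp add: divide_le_eq)
  qed
qed

lemma h1_norm_le:
  assumes "atomic_representation \<Omega> D f c a"
  shows "h1_norm \<Omega> D f \<le> (\<Sum>j. cmod (c j))"
  unfolding h1_norm_def
  by (rule cInf_lower) (use assms in \<open>auto intro!: bdd_belowI[of _ 0] suminf_nonneg simp: atomic_representation_def\<close>)

lemma h1_norm_nonneg: "f \<in> H1 \<Omega> D \<Longrightarrow> 0 \<le> h1_norm \<Omega> D f"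
  unfolding h1_norm_def
  by (rule cInf_greatest) (auto intro!: suminf_nonneg simp: H1_def atomic_representation_def)

end

section \<open>Compactly supported test functions\<close>

lemma compact_neighbourhood:
  fixes K :: "'a::euclidean_space set"
  assumes "compact K" "K \<noteq> {}" "open S" "K \<subseteq> S"
  obtains e where "e > 0" "{x. infdist x K \<le> e} \<subseteq> S" "compact {x. infdist x K \<le> e}"
proof -
  obtain e where e: "e > 0" "{x. infdist x K \<le> e} \<subseteq> S"
    using compact_in_open_separated[OF assms(2,1,3,4)] by blast
  moreover have "compact {x. infdist x K \<le> e}"
    using compact_infdist_le[OF assms(2,1) e(1)] .
  ultimately show thesis by (rule that)
qed

context uitc_domain
begin

lemma Cc_support:
  assumes "\<phi> \<in> Cc \<Omega>"
  obtains K e where "compact K" "K \<noteq> {}" "K \<subseteq> \<Omega>" "\<And>x. x \<in> \<Omega> \<Longrightarrow> x \<notin> K \<Longrightarrow> \<phi> x = 0"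
    "e > 0" "{x. infdist x K \<le> e} \<subseteq> \<Omega>" "compact {x. infdist x K \<le> e}"
proof -
  obtain L where L: "compact L" "L \<subseteq> \<Omega>" "\<forall>x\<in>\<Omega> - L. \<phi> x = 0"
    using assms by (auto simp: Cc_def)
  \<comment> \<open>A point is added so that the set is nonempty: \<open>infdist\<close> to the
    empty set is 0 everywhere, and the neighbourhood would be the whole space.\<close>
  obtain z where z: "z \<in> \<Omega>" using \<Omega>_nonempty by blast
  have K: "compact (insert z L)" "insert z L \<noteq> {}" "insert z L \<subseteq> \<Omega>" using L z by auto
  show thesis
    by (rule compact_neighbourhood[OF K(1,2) open_\<Omega> K(3)]) (rule that[OF K], use L in auto)
qed

lemma integral_indicator_compact:
  assumes h: "integrable (lebesgue_on \<Omega>) h"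
    and z: "\<And>\<phi>. \<phi> \<in> Cc \<Omega> \<Longrightarrow> (LINT x|lebesgue_on \<Omega>. h x * \<phi> x) = 0"
    and K: "compact K" "K \<subseteq> \<Omega>"
  shows "(LINT x|lebesgue_on \<Omega>. h x * indicator K x) = 0"
proof (cases "K = {}")
  case False
  obtain e where e: "e > 0" "{x. infdist x K \<le> e} \<subseteq> \<Omega>" "compact {x. infdist x K \<le> e}"
    by (rule compact_neighbourhood[OF K(1) False open_\<Omega> K(2)])
  \<comment> \<open>Cut-offs equal to 1 on \<open>K\<close> whose slope grows with \<open>n\<close>.
    They vanish beyond distance \<open>e\<close> already for \<open>n = 0\<close>, and they converge
    pointwise to the indicator of \<open>K\<close>.\<close>
  define \<phi> where "\<phi> n x = complex_of_real (max 0 (1 - real (Suc n) / e * infdist x K))" for n x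
  have Cc: "\<phi> n \<in> Cc \<Omega>" for n
  proof -
    have "continuous_on \<Omega> (\<phi> n)" unfolding \<phi>_def by (intro continuous_intros)
    moreover have "\<phi> n x = 0" if "\<not> infdist x K \<le> e" for x
    proof -
      have "1 * 1 \<le> real (Suc n) * (infdist x K / e)"
        using that e by (intro mult_mono) auto
      then show ?thesis by (simp add: \<phi>_def max_def)
    qed
    ultimately show ?thesis unfolding Cc_def using e by blast
  qed
  have bnd: "cmod (\<phi> n x) \<le> 1" for n x
    using e by (auto simp: \<phi>_def infdist_nonneg)
  have lim: "(\<lambda>n. \<phi> n x) \<longlonglongrightarrow> indicator K x" for x
  proof (cases "x \<in> K")
    case True
    then show ?thesis by (simp add: \<phi>_def)
  next
    case False
    then have pos: "infdist x K > 0"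
      using in_closed_iff_infdist_zero[OF compact_imp_closed[OF K(1)] \<open>K \<noteq> {}\<close>] infdist_nonneg[of x K]
      by (metis less_eq_real_def)
    obtain N :: nat where N: "e / infdist x K < N" using reals_Archimedean2 by blast
    have "\<phi> n x = 0" if "n \<ge> N" for n
    proof -
      have "e / infdist x K < real (Suc n)" using N that by linarith
      then have "1 \<le> real (Suc n) / e * infdist x K" using pos e by (simp add: field_simps)
      then show ?thesis by (simp add: \<phi>_def max_def)
    qed
    then have "(\<lambda>n. \<phi> n x) \<longlonglongrightarrow> 0"
      by (intro tendsto_eventually) (auto simp: eventually_sequentially)
    then show ?thesis using False by simp
  qed
  have hm: "h \<in> borel_measurable (lebesgue_on \<Omega>)" using h by auto
  have \<phi>m: "\<phi> n \<in> borel_measurable (lebesgue_on \<Omega>)" for n by (rule Cc_measurable[OF Cc])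
  have "(\<lambda>n. LINT x|lebesgue_on \<Omega>. h x * \<phi> n x) \<longlonglongrightarrow> (LINT x|lebesgue_on \<Omega>. h x * indicator K x)"
  proof (rule integral_dominated_convergence)
    show "(\<lambda>x. h x * indicator K x) \<in> borel_measurable (lebesgue_on \<Omega>)"
      by (rule borel_measurable_LIMSEQ_metric[where f = "\<lambda>n x. h x * \<phi> n x"])
        (intro borel_measurable_times hm \<phi>m tendsto_intros lim)+
    show "(\<lambda>x. h x * \<phi> n x) \<in> borel_measurable (lebesgue_on \<Omega>)" for n
      by (intro borel_measurable_times hm \<phi>m)
    show "integrable (lebesgue_on \<Omega>) (\<lambda>x. cmod (h x))" using h by auto
    show "AE x in lebesgue_on \<Omega>. (\<lambda>n. h x * \<phi> n x) \<longlonglongrightarrow> h x * indicator K x"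
      by (intro AE_I2 tendsto_intros lim)
    show "AE x in lebesgue_on \<Omega>. cmod (h x * \<phi> n x) \<le> cmod (h x)" for n
      using bnd by (intro AE_I2) (simp add: norm_mult mult_left_le)
  qed
  then show ?thesis using z[OF Cc] by (simp add: LIMSEQ_const_iff)
qed simp

text \<open>Test functions approximate indicators of compact sets, so the real part of
  \<open>c\<close> times \<open>h\<close> has integral 0 over each of them. The choices 1, -1, \<i>
  and -\<i> for \<open>c\<close> make both parts of \<open>h\<close> vanish.\<close>

lemma Cc_determines_AE:
  assumes h: "integrable (lebesgue_on \<Omega>) h"
    and z: "\<And>\<phi>. \<phi> \<in> Cc \<Omega> \<Longrightarrow> (LINT x|lebesgue_on \<Omega>. h x * \<phi> x) = 0"
  shows "AE x in lebesgue_on \<Omega>. h x = 0"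
proof -
  have "AE x in lebesgue_on \<Omega>. Re (c * h x) \<le> 0" for c
  proof (rule integral_zero_on_compacts[OF \<Omega>_sets])
    show "integrable (lebesgue_on \<Omega>) (\<lambda>x. Re (c * h x))" using h by auto
    fix K :: "'a set" assume K: "compact K" "K \<subseteq> \<Omega>"
    have KS: "K \<in> sets (lebesgue_on \<Omega>)"
      using K by (auto simp: sets_restrict_space_iff compact_imp_closed)
    have "integrable (lebesgue_on \<Omega>) (\<lambda>x. indicator K x *\<^sub>R h x)"
      by (rule integrable_mult_indicator[OF KS h])
    moreover have eq: "indicator K x *\<^sub>R h x = h x * indicator K x" for x
      by (auto simp: indicator_def)
    ultimately have i: "integrable (lebesgue_on \<Omega>) (\<lambda>x. c * (h x * indicator K x))"
      by (intro integrable_mult_right) simp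
    have "(LINT x|lebesgue_on \<Omega>. indicator K x * Re (c * h x)) = (LINT x|lebesgue_on \<Omega>. Re (c * (h x * indicator K x)))"
      by (intro Bochner_Integration.integral_cong) (auto simp: indicator_def)
    also have "\<dots> = Re (LINT x|lebesgue_on \<Omega>. c * (h x * indicator K x))"
      by (rule integral_Re[OF i])
    also have "\<dots> = 0" using integral_indicator_compact[OF h z K] by simp
    finally show "(LINT x|lebesgue_on \<Omega>. indicator K x * Re (c * h x)) = 0" .
  qed
  from this[of 1] this[of "-1"] this[of "\<i>"] this[of "-\<i>"] show ?thesis
    by eventually_elim (simp add: complex_eq_iff)
qed

lemma Cc_L2: "\<phi> \<in> Cc \<Omega> \<Longrightarrow> \<phi> \<in> L2 (lebesgue_on \<Omega>)"
proof -
  assume \<phi>: "\<phi> \<in> Cc \<Omega>"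
  obtain K where K: "compact K" "K \<subseteq> \<Omega>" "\<And>x. x \<in> \<Omega> \<Longrightarrow> x \<notin> K \<Longrightarrow> \<phi> x = 0"
    using Cc_support[OF \<phi>] by metis
  have Ks: "K \<in> sets lebesgue" using K(1) by (simp add: compact_imp_closed)
  have m: "\<phi> \<in> borel_measurable (lebesgue_on \<Omega>)" by (rule Cc_measurable[OF \<phi>])
  have "integrable (lebesgue_on K) (\<lambda>x. (cmod (\<phi> x))\<^sup>2)"
    using L2_integrable[OF BMO_L2_bounded[OF Cc_BMO[OF \<phi>] Ks K(2) compact_imp_bounded[OF K(1)]]] .
  moreover have "AE x in lebesgue_on \<Omega>. x \<notin> K \<longrightarrow> (cmod (\<phi> x))\<^sup>2 = 0"
    using K(3) by (intro AE_I2) auto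
  ultimately have "integrable (lebesgue_on \<Omega>) (\<lambda>x. (cmod (\<phi> x))\<^sup>2)"
    using m by (subst lebesgue_on_vanishing_outside(1)[OF \<Omega>_sets Ks K(2)]) auto
  then show ?thesis by (simp add: L2_def m)
qed

text \<open>Three regimes. A small ball that meets the support of \<phi> is not near
  \<open>D\<close>, and uniform continuity bounds its oscillation. A large ball has large volume
  against the fixed L2 norm of \<phi>. Between the two, local finiteness leaves only finitely many
  balls that meet the support.\<close>

lemma oscillation_decay:
  assumes \<phi>: "\<phi> \<in> Cc \<Omega>" and X: "\<And>n. X n \<in> \<Omega>" and R: "\<And>n. R n > 0"
    and fin: "\<And>S a b. bounded S \<Longrightarrow> a > 0 \<Longrightarrow> finite {n. a \<le> R n \<and> R n \<le> b \<and> ball (X n) (R n) \<inter> S \<noteq> {}}"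
    and bdd: "bounded \<Omega> \<Longrightarrow> \<exists>b. \<forall>n::nat. R n \<le> b"
  shows "(\<lambda>n. if near (X n) (R n) then root_mean_square (B (X n) (R n)) \<phi>
      else mean_oscillation (B (X n) (R n)) \<phi>) \<longlonglongrightarrow> 0" (is "?q \<longlonglongrightarrow> 0")
proof (rule LIMSEQ_I)
  fix \<epsilon> :: real assume \<epsilon>: "\<epsilon> > 0"
  obtain K e where K: "compact K" "K \<noteq> {}" "K \<subseteq> \<Omega>" "\<And>x. x \<in> \<Omega> \<Longrightarrow> x \<notin> K \<Longrightarrow> \<phi> x = 0"
    and e: "e > 0" "{x. infdist x K \<le> e} \<subseteq> \<Omega>" "compact {x. infdist x K \<le> e}"
    using Cc_support[OF \<phi>] by metis
  note lm = B_lmeasurable measure_B_pos[OF X R]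
  note \<phi>L = BMO_L2[OF Cc_BMO[OF \<phi>]]
  have qnn: "0 \<le> ?q n" for n by simp
  have qrms: "?q n \<le> root_mean_square (B (X n) (R n)) \<phi>" for n
    using mean_oscillation_le[OF lm \<phi>L] by simp
  have miss: "?q n = 0" if "ball (X n) (R n) \<inter> K = {}" for n
  proof -
    have "\<phi> x = 0" if "x \<in> B (X n) (R n)" for x
      using that \<open>ball (X n) (R n) \<inter> K = {}\<close> by (intro K(4)) blast+
    then have "root_mean_square (B (X n) (R n)) \<phi> \<le> 0"
      by (intro root_mean_square_le_bound(2)[OF lm] restrict_measurable Cc_measurable \<phi>) auto
    then show ?thesis using qrms[of n] qnn[of n] by linarith
  qed
  have "uniformly_continuous_on {x. infdist x K \<le> e} \<phi>"
    using \<phi> e by (intro compact_uniformly_continuous) (auto simp: Cc_def intro: continuous_on_subset)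
  then obtain \<delta> where \<delta>: "\<delta> > 0" "\<And>x y. infdist x K \<le> e \<Longrightarrow> infdist y K \<le> e \<Longrightarrow> dist x y < \<delta> \<Longrightarrow> dist (\<phi> x) (\<phi> y) < \<epsilon> / 2"
    using \<epsilon> unfolding uniformly_continuous_on_def by (metis half_gt_zero mem_Collect_eq)
  \<comment> \<open>A ball of radius below \<open>e / 4\<close> that meets \<open>K\<close> has its
    double within distance \<open>3 * e / 4\<close> of \<open>K\<close>, hence inside \<Omega>,
    which \<open>D\<close> does not meet.\<close>
  define a where "a = min \<delta> (e / 4)"
  have a: "a > 0" using \<delta> e by (simp add: a_def)
  have small: "?q n < \<epsilon>" if n: "R n < a" for n
  proof (cases "ball (X n) (R n) \<inter> K = {}")
    case True
    then show ?thesis using miss \<epsilon> by simp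
  next
    case False
    then obtain p where p: "p \<in> K" "dist (X n) p < R n" by auto
    have close: "infdist z K \<le> e" if "dist (X n) z < 2 * R n" for z
    proof -
      have "infdist z K \<le> dist z p" by (rule infdist_le[OF p(1)])
      also have "\<dots> \<le> dist (X n) z + dist (X n) p" by (metis dist_commute dist_triangle)
      also have "\<dots> \<le> e" using that p n e(1) by (simp add: a_def)
      finally show ?thesis .
    qed
    have "\<not> near (X n) (R n)"
      using close e(2) D_disjoint by (fastforce simp: disjoint_iff)
    moreover have "mean_oscillation (B (X n) (R n)) \<phi> \<le> \<epsilon> / 2"
    proof -
      have "mean_oscillation (B (X n) (R n)) \<phi> \<le> root_mean_square (B (X n) (R n)) (\<lambda>x. \<phi> x - \<phi> (X n))"
        by (rule mean_oscillation_le_const[OF lm \<phi>L])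
      also have "\<dots> \<le> \<epsilon> / 2"
      proof (intro root_mean_square_le_bound(2)[OF lm])
        show "(\<lambda>x. \<phi> x - \<phi> (X n)) \<in> borel_measurable (lebesgue_on (B (X n) (R n)))"
          using restrict_measurable[OF Cc_measurable[OF \<phi>]] by auto
        fix z assume "z \<in> B (X n) (R n)"
        then have z: "dist (X n) z < R n" by simp
        have "dist (\<phi> z) (\<phi> (X n)) < \<epsilon> / 2"
          using z n R[of n] by (intro \<delta>(2) close) (auto simp: a_def dist_commute)
        then show "cmod (\<phi> z - \<phi> (X n)) \<le> \<epsilon> / 2" by (simp add: dist_norm)
      qed (use \<epsilon> in simp)
      finally show ?thesis .
    qed
    ultimately show ?thesis using \<epsilon> by auto
  qed
  obtain b where b: "\<And>n. R n > b \<Longrightarrow> ?q n < \<epsilon>"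
  proof -
    \<comment> \<open>In a bounded domain \<open>b0\<close> bounds all radii, so the volume estimate
      covers the whole family. In an unbounded one that estimate has no upper limit on the radius,
      and 1 is arbitrary.\<close>
    obtain b0 where b0: "b0 > 0" "bounded \<Omega> \<Longrightarrow> \<forall>n. R n \<le> b0"
    proof (cases "bounded \<Omega>")
      case True
      then obtain b where "\<forall>n. R n \<le> b" using bdd by blast
      moreover from this have "b > 0" using R[of 0] by (metis less_le_trans)
      ultimately show ?thesis using that by blast
    next
      case False
      then show ?thesis using that[of 1] by simp
    qed
    obtain c where c: "c > 0" "\<And>x r. x \<in> \<Omega> \<Longrightarrow> r > 0 \<Longrightarrow> (bounded \<Omega> \<Longrightarrow> r \<le> b0) \<Longrightarrow> c * r ^ DIM('a) \<le> measure lebesgue (B x r)"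
      using measure_B_ge[OF b0(1)] by blast
    define N where "N = l2_norm (lebesgue_on \<Omega>) \<phi>"
    show thesis
    \<comment> \<open>Radii above 1 satisfy \<open>R n \<le> R n ^ DIM('a)\<close>, so the volume is
      at least \<open>c * R n\<close>; the other bound makes \<open>N\<^sup>2 / (c * R n)\<close>
      smaller than \<epsilon> squared.\<close>
    proof (rule that[of "max 1 (N\<^sup>2 / (c * \<epsilon>\<^sup>2))"])
      fix n assume n: "max 1 (N\<^sup>2 / (c * \<epsilon>\<^sup>2)) < R n"
      have low: "c * R n \<le> measure lebesgue (B (X n) (R n))"
      proof -
        have "R n ^ 1 \<le> R n ^ DIM('a)" using n by (intro power_increasing) auto
        then have "c * R n \<le> c * R n ^ DIM('a)" using c by simp
        also have "\<dots> \<le> measure lebesgue (B (X n) (R n))" using X R b0 by (intro c(2)) auto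
        finally show ?thesis .
      qed
      have "(root_mean_square (B (X n) (R n)) \<phi>)\<^sup>2 = (l2_norm (lebesgue_on (B (X n) (R n))) \<phi>)\<^sup>2 / measure lebesgue (B (X n) (R n))"
        by (simp add: root_mean_square_eq power_divide)
      also have "\<dots> \<le> N\<^sup>2 / (c * R n)"
        using c(1) R[of n] low unfolding N_def
        by (intro frac_le power_mono L2_lebesgue_on_subset(2)[OF \<Omega>_sets B_sets _ Cc_L2[OF \<phi>]]) auto
      also have "\<dots> < \<epsilon>\<^sup>2"
      proof -
        have "N\<^sup>2 / (c * \<epsilon>\<^sup>2) < R n" using n by simp
        then show ?thesis using c(1) R[of n] \<epsilon> by (simp add: field_simps)
      qed
      finally have "root_mean_square (B (X n) (R n)) \<phi> < \<epsilon>"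
        by (rule power2_less_imp_less) (use \<epsilon> in simp)
      then show "?q n < \<epsilon>" using qrms[of n] by linarith
    qed
  qed
  have "{n. \<not> ?q n < \<epsilon>} \<subseteq> {n. a \<le> R n \<and> R n \<le> b \<and> ball (X n) (R n) \<inter> K \<noteq> {}}"
    using small b miss \<epsilon> by (force simp: not_less[symmetric])
  then have "finite {n. \<not> ?q n < \<epsilon>}"
    using fin[OF compact_imp_bounded[OF K(1)] a] by (rule finite_subset)
  then have "eventually (\<lambda>n. ?q n < \<epsilon>) sequentially"
    by (simp add: eventually_cofinite flip: cofinite_eq_sequentially)
  then show "\<exists>no. \<forall>n\<ge>no. norm (?q n - 0) < \<epsilon>"
    using qnn by (simp add: eventually_sequentially)
qed

end

section \<open>Atomic representation of functionals\<close>

text \<open>Subtracting the mean is symmetric for the bilinear pairing: both sides equal the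
  integral of \<open>u x * h x\<close> minus the total mass times \<open>m * k\<close>.\<close>

lemma (in finite_measure) integral_sub_mean_swap:
  fixes u h :: "'a \<Rightarrow> complex"
  assumes u: "u \<in> L2 M" and h: "h \<in> L2 M"
    and m: "complex_of_real (measure M (space M)) * m = (LINT x|M. u x)"
    and k: "complex_of_real (measure M (space M)) * k = (LINT x|M. h x)"
  shows "(LINT x|M. u x * (h x - k)) = (LINT x|M. (u x - m) * h x)"
proof -
  have "(LINT x|M. u x * (h x - k)) = (LINT x|M. u x * h x) - (LINT x|M. u x) * k"
    unfolding right_diff_distrib
    using integrable_mult_L2(1)[OF u h] L2_imp_integrable[OF u] by simp
  moreover have "(LINT x|M. (u x - m) * h x) = (LINT x|M. u x * h x) - m * (LINT x|M. h x)"
    unfolding left_diff_distrib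
    using integrable_mult_L2(1)[OF u h] L2_imp_integrable[OF h] by simp
  ultimately show ?thesis unfolding m[symmetric] k[symmetric] by simp
qed

context uitc_domain
begin

lemma zero_atom: "h1_atom \<Omega> D (\<lambda>x. 0)"
proof -
  obtain x where "x \<in> \<Omega>" using \<Omega>_nonempty by blast
  then have "(\<Omega>, x, 1) \<in> usual_balls \<Omega> D" by (simp add: usual_balls_eq)
  then show ?thesis unfolding h1_atom_def by (intro conjI bexI[of _ "(\<Omega>, x, 1)"]) auto
qed

text \<open>Turns one component of the dual of the sum into a multiple of an atom. The conclusion
  concerns pairings instead of values because for \<open>\<kappa> = 0\<close> the function
  \<open>g\<close> is only almost everywhere 0.\<close>

lemma scaled_atom:
  assumes x: "x \<in> \<Omega>" "r > 0" and g: "g \<in> L2 (lebesgue_on (B x r))"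
    and le: "l2_norm (lebesgue_on (B x r)) g \<le> \<kappa> / sqrt (measure lebesgue (B x r))"
    and alt: "(LINT z|lebesgue_on (B x r). g z) = 0 \<or> near x r"
  obtains a where "h1_atom \<Omega> D a"
    "\<And>\<phi>. \<phi> \<in> BMO \<Omega> D \<Longrightarrow>
      complex_of_real \<kappa> * (LINT z|lebesgue_on \<Omega>. a z * \<phi> z) = (LINT z|lebesgue_on (B x r). g z * \<phi> z)"
proof (cases "\<kappa> > 0")
  case False
  have "l2_norm (lebesgue_on (B x r)) g = 0" and \<kappa>: "\<kappa> = 0"
  proof -
    have "0 \<le> \<kappa> / sqrt (measure lebesgue (B x r))" using le l2_norm_nonneg order_trans by blast
    then show "\<kappa> = 0" using False measure_B_pos[OF x] by (simp add: zero_le_divide_iff)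
    then show "l2_norm (lebesgue_on (B x r)) g = 0" using le by (simp add: antisym)
  qed
  show thesis
  proof (rule that[OF zero_atom])
    fix \<phi> assume "\<phi> \<in> BMO \<Omega> D"
    from integrable_mult_L2(2)[OF g BMO_L2[OF this]]
    show "complex_of_real \<kappa> * (LINT z|lebesgue_on \<Omega>. 0 * \<phi> z) = (LINT z|lebesgue_on (B x r). g z * \<phi> z)"
      using \<open>l2_norm (lebesgue_on (B x r)) g = 0\<close> by simp
  qed
next
  case True
  define \<mu> where "\<mu> = sqrt (measure lebesgue (B x r))"
  have pos: "measure lebesgue (B x r) > 0" by (rule measure_B_pos[OF x])
  have \<mu>: "\<mu> > 0" using pos by (simp add: \<mu>_def)
  \<comment> \<open>Cut off outside the ball, where nothing is known about \<open>g\<close>.\<close>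
  define a where "a z = (if z \<in> B x r then g z / of_real \<kappa> else 0)" for z
  note vanish = lebesgue_on_vanishing_outside[OF \<Omega>_sets B_sets]
  have cong: "(LINT z|lebesgue_on (B x r). F (a z) z) = (LINT z|lebesgue_on (B x r). F (g z / of_real \<kappa>) z)"
    for F :: "complex \<Rightarrow> 'a \<Rightarrow> 'z::{banach, second_countable_topology}"
    by (rule Bochner_Integration.integral_cong) (auto simp: a_def)
  have gk: "(\<lambda>z. g z / of_real \<kappa>) \<in> L2 (lebesgue_on (B x r))"
    using L2_cmult[OF g, of "inverse (of_real \<kappa>)"] by (simp add: divide_inverse mult.commute)
  have am: "a \<in> borel_measurable (lebesgue_on \<Omega>)"
    unfolding a_def by (subst borel_measurable_if_lebesgue_on[OF B_sets \<Omega>_sets]) (use L2_measurable[OF gk] in auto)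
  have i2: "integrable (lebesgue_on (B x r)) (\<lambda>z. (cmod (a z))\<^sup>2)"
  proof -
    have "integrable (lebesgue_on (B x r)) (\<lambda>z. (cmod (a z))\<^sup>2)
        \<longleftrightarrow> integrable (lebesgue_on (B x r)) (\<lambda>z. (cmod (g z / of_real \<kappa>))\<^sup>2)"
      by (rule Bochner_Integration.integrable_cong) (auto simp: a_def)
    then show ?thesis using L2_integrable[OF gk] by simp
  qed
  have am2: "(\<lambda>z. (cmod (a z))\<^sup>2) \<in> borel_measurable (lebesgue_on \<Omega>)" using am by measurable
  have az: "AE z in lebesgue_on \<Omega>. z \<notin> B x r \<longrightarrow> a z = 0"
    unfolding a_def by (intro AE_I2) simp
  have az2: "AE z in lebesgue_on \<Omega>. z \<notin> B x r \<longrightarrow> (cmod (a z))\<^sup>2 = 0"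
    unfolding a_def by (intro AE_I2) simp
  have "h1_atom \<Omega> D a"
    unfolding h1_atom_def
  proof (intro conjI am bexI[of _ "(\<Omega>, x, r)"])
    show "closure {z \<in> \<Omega>. a z \<noteq> 0} \<subseteq> closure (usual_ball_set (\<Omega>, x, r))"
      by (rule closure_mono) (auto simp: a_def split: if_splits)
    show "integrable (lebesgue_on \<Omega>) (\<lambda>z. (cmod (a z))\<^sup>2)"
      using i2 by (subst vanish(1)[OF _ am2 az2]) auto
    have "sqrt (LINT z|lebesgue_on \<Omega>. (cmod (a z))\<^sup>2) = l2_norm (lebesgue_on (B x r)) a"
      by (subst vanish(2)[OF _ am2 az2]) (auto simp: l2_norm_def)
    also have "\<dots> = l2_norm (lebesgue_on (B x r)) g / \<kappa>"
      unfolding l2_norm_def cong[of "\<lambda>w z. (cmod w)\<^sup>2"] using True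
      by (simp add: norm_divide power_divide real_sqrt_divide)
    also have "\<dots> \<le> 1 / \<mu>"
      using le True \<mu> by (simp add: \<mu>_def[symmetric] field_simps)
    also have "1 / \<mu> = measure lebesgue (B x r) powr (- (1/2))"
      using pos by (simp only: powr_minus_divide \<mu>_def powr_half_sqrt[OF less_imp_le])
    finally show "sqrt (LINT z|lebesgue_on \<Omega>. (cmod (a z))\<^sup>2) \<le> measure lebesgue (usual_ball_set (\<Omega>, x, r)) powr (- (1/2))"
      by simp
    have "(LINT z|lebesgue_on \<Omega>. a z) = (LINT z|lebesgue_on (B x r). g z) / of_real \<kappa>"
      by (subst vanish(2)[OF _ am az]) (auto simp: cong[of "\<lambda>w z. w"])
    moreover have "near x r \<Longrightarrow> (\<Omega>, x, r) \<in> near_balls \<Omega> D"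
      unfolding near_balls_eq using x by blast
    ultimately show "(LINT z|lebesgue_on \<Omega>. a z) = 0 \<or> (\<Omega>, x, r) \<in> near_balls \<Omega> D"
      using alt by auto
    show "(\<Omega>, x, r) \<in> usual_balls \<Omega> D" using x by (simp add: usual_balls_eq)
  qed
  then show thesis
  proof (rule that)
    fix \<phi> assume \<phi>: "\<phi> \<in> BMO \<Omega> D"
    have "(\<lambda>z. a z * \<phi> z) \<in> borel_measurable (lebesgue_on \<Omega>)"
      using am BMO_measurable[OF \<phi>] by measurable
    moreover have "AE z in lebesgue_on \<Omega>. z \<notin> B x r \<longrightarrow> a z * \<phi> z = 0"
      unfolding a_def by (intro AE_I2) simp
    ultimately have "(LINT z|lebesgue_on \<Omega>. a z * \<phi> z) = (LINT z|lebesgue_on (B x r). g z / of_real \<kappa> * \<phi> z)"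
      by (subst vanish(2)) (auto simp: cong[of "\<lambda>w z. w * \<phi> z"])
    then show "complex_of_real \<kappa> * (LINT z|lebesgue_on \<Omega>. a z * \<phi> z) = (LINT z|lebesgue_on (B x r). g z * \<phi> z)"
      using True by simp
  qed
qed

lemma atomic_representation_suminf:
  assumes c: "summable (\<lambda>j. cmod (c j))" and a: "\<And>j. h1_atom \<Omega> D (a j)"
  shows "atomic_representation \<Omega> D (\<lambda>x. \<Sum>j. c j * a j x) c a"
proof -
  let ?M = "lebesgue_on \<Omega>"
  note at = atom_pairing[OF a Cc_BMO[OF Cc_zero]]
  have ig: "integrable ?M (\<lambda>x. c j * a j x)" for j by (intro integrable_mult_right at(3))
  have "(LINT x|?M. norm (c j * a j x)) \<le> cmod (c j)" for j
    using mult_left_mono[OF at(4)[of j], of "cmod (c j)"] by (simp add: norm_mult)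
  then have ss: "summable (\<lambda>j. LINT x|?M. norm (c j * a j x))"
    by (intro summable_comparison_test'[OF c, of 0]) auto
  have "AE x in ?M. (\<lambda>j. c j * a j x) sums (\<Sum>j. c j * a j x)"
    using AE_summable_norm[OF ig ss] by eventually_elim (rule summable_sums[OF summable_norm_cancel])
  then show ?thesis using c a by (simp add: atomic_representation_def)
qed

text \<open>The constant \<open>A\<close> is \<open>sqrt M\<close>, the loss in passing from an
  arbitrary ball to a member of the family; it depends on neither the functional nor its
  bound.\<close>

theorem Cc_functional_representation:
  obtains A where "A > 0"
    "\<And>l K. (\<And>\<phi> \<psi>. \<phi> \<in> Cc \<Omega> \<Longrightarrow> \<psi> \<in> Cc \<Omega> \<Longrightarrow> l (\<lambda>x. \<phi> x + \<psi> x) = l \<phi> + l \<psi>) \<Longrightarrow>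
      (\<And>c \<phi>. \<phi> \<in> Cc \<Omega> \<Longrightarrow> l (\<lambda>x. c * \<phi> x) = c * l \<phi>) \<Longrightarrow>
      (\<And>\<phi>. \<phi> \<in> Cc \<Omega> \<Longrightarrow> cmod (l \<phi>) \<le> K * bmo_norm \<Omega> D \<phi>) \<Longrightarrow> 0 \<le> K \<Longrightarrow>
      \<exists>f c a. atomic_representation \<Omega> D f c a \<and> (\<Sum>j. cmod (c j)) \<le> A * K \<and>
        (\<forall>\<phi>\<in>Cc \<Omega>. l \<phi> = (LINT x|lebesgue_on \<Omega>. f x * \<phi> x))"
proof -
  obtain X R M where X: "\<And>n::nat. X n \<in> \<Omega>" and R: "\<And>n. R n > 0" and M: "M > 0"
    and cover: "\<And>x r. x \<in> \<Omega> \<Longrightarrow> r > 0 \<Longrightarrow> \<exists>n. B x r \<subseteq> B (X n) (R n) \<and>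
       measure lebesgue (B (X n) (R n)) \<le> M * measure lebesgue (B x r) \<and> (near x r \<longrightarrow> near (X n) (R n))"
    and fin: "\<And>S a b. bounded S \<Longrightarrow> a > 0 \<Longrightarrow> finite {n. a \<le> R n \<and> R n \<le> b \<and> ball (X n) (R n) \<inter> S \<noteq> {}}"
    and bdd: "bounded \<Omega> \<Longrightarrow> \<exists>b. \<forall>n. R n \<le> b"
    by (rule ball_family) (rule that)
  define U where "U n = B (X n) (R n)" for n
  define M' where "M' n = lebesgue_on (U n)" for n
  define nr where "nr n = near (X n) (R n)" for n
  \<comment> \<open>The value 0 for balls near \<open>D\<close> lets one formula serve both kinds of
    balls. Together with the factor \<open>inverse (\<mu> n)\<close> it makes the norm of the n-th
    entry of \<open>y \<phi>\<close> equal to \<open>q \<phi> n\<close>.\<close>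
  define m where "m n \<phi> = (if nr n then 0 else average (U n) \<phi>)" for n and \<phi> :: "'a \<Rightarrow> complex"
  define \<mu> where "\<mu> n = sqrt (measure lebesgue (U n))" for n
  define y where "y \<phi> = (\<lambda>(n, x). inverse (\<mu> n) *\<^sub>R (\<phi> x - m n \<phi>))" for \<phi> :: "'a \<Rightarrow> complex"
  define q where "q \<phi> n = (if nr n then root_mean_square (U n) \<phi> else mean_oscillation (U n) \<phi>)" for \<phi> n
  have lm: "U n \<in> lmeasurable" and pos: "measure lebesgue (U n) > 0" for n
    using measure_B_pos[OF X R] by (auto simp: U_def)
  have \<mu>: "\<mu> n > 0" for n using pos by (simp add: \<mu>_def)
  have finM: "finite_measure (M' n)" for n unfolding M'_def by (rule finite_measure_lebesgue_on[OF lm])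
  have \<phi>L: "\<phi> \<in> L2 (M' n)" if "\<phi> \<in> Cc \<Omega>" for \<phi> n
    unfolding M'_def U_def by (rule BMO_L2[OF Cc_BMO[OF that]])
  have Pq: "(\<lambda>x. \<phi> x - m n \<phi>) \<in> L2 (M' n)" "l2_norm (M' n) (\<lambda>x. inverse (\<mu> n) *\<^sub>R (\<phi> x - m n \<phi>)) = q \<phi> n"
    if "\<phi> \<in> Cc \<Omega>" for \<phi> n
  proof -
    show "(\<lambda>x. \<phi> x - m n \<phi>) \<in> L2 (M' n)"
      by (intro L2_diff \<phi>L that finite_measure.L2_const[OF finM])
    show "l2_norm (M' n) (\<lambda>x. inverse (\<mu> n) *\<^sub>R (\<phi> x - m n \<phi>)) = q \<phi> n"
      unfolding l2_norm_scaleR using \<mu>[of n]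
      by (simp add: q_def m_def root_mean_square_eq mean_oscillation_def M'_def \<mu>_def divide_inverse)
  qed
  \<comment> \<open>The embedding is bounded below. This turns the bound on the functional into the
    domination that Hahn-Banach requires.\<close>
  have bmo_le: "bmo_norm \<Omega> D \<phi> \<le> sqrt M * t" if \<phi>: "\<phi> \<in> Cc \<Omega>" and t: "\<And>n. q \<phi> n \<le> t" for \<phi> t
  proof -
    have "0 \<le> q \<phi> 0" by (simp add: q_def)
    then have t0: "0 \<le> t" using t[of 0] by linarith
    show ?thesis
    proof (rule bmo_norm_le)
      show "0 \<le> sqrt M * t" using t0 M by simp
    next
      fix x r assume xr: "x \<in> \<Omega>" "(r::real) > 0"
      obtain n where n: "B x r \<subseteq> U n" "measure lebesgue (U n) \<le> M * measure lebesgue (B x r)"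
        using cover[OF xr] unfolding U_def by blast
      have "mean_oscillation (U n) \<phi> \<le> q \<phi> n"
        using mean_oscillation_le[OF lm pos \<phi>L[OF \<phi>, unfolded M'_def]] by (simp add: q_def)
      also have "\<dots> \<le> t" by (rule t)
      finally have "sqrt M * mean_oscillation (U n) \<phi> \<le> sqrt M * t" using M by simp
      with mean_oscillation_enlarge[OF B_lmeasurable measure_B_pos[OF xr] lm n \<phi>L[OF \<phi>, unfolded M'_def]]
      show "mean_oscillation (B x r) \<phi> \<le> sqrt M * t" by linarith
    next
      fix x r assume xr: "x \<in> \<Omega>" "(r::real) > 0" and nrx: "near x r"
      obtain n where n: "B x r \<subseteq> U n" "measure lebesgue (U n) \<le> M * measure lebesgue (B x r)" and "nr n"
        using cover[OF xr] nrx unfolding U_def nr_def by blast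
      then have "root_mean_square (U n) \<phi> \<le> t" using t[of n] by (simp add: q_def)
      then have "sqrt M * root_mean_square (U n) \<phi> \<le> sqrt M * t" using M by simp
      with root_mean_square_enlarge[OF B_lmeasurable measure_B_pos[OF xr] lm n \<phi>L[OF \<phi>, unfolded M'_def]]
      show "root_mean_square (B x r) \<phi> \<le> sqrt M * t" by linarith
    qed
  qed
  have qlim: "q \<phi> \<longlonglongrightarrow> 0" if "\<phi> \<in> Cc \<Omega>" for \<phi>
    unfolding q_def[abs_def] U_def nr_def by (rule oscillation_decay[OF that X R fin bdd])
  show thesis
  proof (rule that[of "sqrt M"])
    show "sqrt M > 0" using M by simp
    fix l :: "('a \<Rightarrow> complex) \<Rightarrow> complex" and K :: real
    assume ladd: "\<And>\<phi> \<psi>. \<phi> \<in> Cc \<Omega> \<Longrightarrow> \<psi> \<in> Cc \<Omega> \<Longrightarrow> l (\<lambda>x. \<phi> x + \<psi> x) = l \<phi> + l \<psi>"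
      and lsc: "\<And>c \<phi>. \<phi> \<in> Cc \<Omega> \<Longrightarrow> l (\<lambda>x. c * \<phi> x) = c * l \<phi>"
      and lle: "\<And>\<phi>. \<phi> \<in> Cc \<Omega> \<Longrightarrow> cmod (l \<phi>) \<le> K * bmo_norm \<Omega> D \<phi>" and K: "0 \<le> K"
    \<comment> \<open>Only the real part is extended. Different test functions with the same image
      cause no difficulty, because domination makes the graph single valued.\<close>
    define G where "G = {(y \<phi>, Re (l \<phi>)) | \<phi>. \<phi> \<in> Cc \<Omega>}"
    have yn: "(\<lambda>x. y \<phi> (n, x)) = (\<lambda>x. inverse (\<mu> n) *\<^sub>R (\<phi> x - m n \<phi>))" for \<phi> n
      by (simp add: y_def)
    have madd: "m n (\<lambda>x. \<phi> x + \<psi> x) = m n \<phi> + m n \<psi>" if "\<phi> \<in> Cc \<Omega>" "\<psi> \<in> Cc \<Omega>" for \<phi> \<psi> n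
      using average_add[OF lm pos \<phi>L[OF that(1), unfolded M'_def] \<phi>L[OF that(2), unfolded M'_def]]
      by (simp add: m_def)
    have mscale: "m n (\<lambda>x. c * \<phi> x) = c * m n \<phi>" for c \<phi> n
      using average_cmult[OF lm pos, of n c \<phi>] by (simp add: m_def)
    have G: "graph_subspace G"
      unfolding graph_subspace_def
    proof (intro conjI allI impI)
      show "G \<noteq> {}" unfolding G_def using Cc_zero by blast
    next
      fix a r b s assume "(a, r) \<in> G" "(b, s) \<in> G"
      then obtain \<phi> \<psi> where *: "\<phi> \<in> Cc \<Omega>" "\<psi> \<in> Cc \<Omega>" "a = y \<phi>" "b = y \<psi>" "r = Re (l \<phi>)" "s = Re (l \<psi>)"
        unfolding G_def by blast
      have "(\<lambda>i. a i + b i) = y (\<lambda>x. \<phi> x + \<psi> x)"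
        by (auto simp: * y_def madd scaleR_diff_right scaleR_add_right)
      moreover have "r + s = Re (l (\<lambda>x. \<phi> x + \<psi> x))" using ladd[OF *(1,2)] * by simp
      ultimately show "(\<lambda>i. a i + b i, r + s) \<in> G"
        unfolding G_def using Cc_add[OF *(1,2)] by blast
    next
      fix c a r assume "(a, r) \<in> G"
      then obtain \<phi> where *: "\<phi> \<in> Cc \<Omega>" "a = y \<phi>" "r = Re (l \<phi>)" unfolding G_def by blast
      have "(\<lambda>i. c *\<^sub>R a i) = y (\<lambda>x. complex_of_real c * \<phi> x)"
        by (auto simp: * y_def mscale scaleR_conv_of_real algebra_simps)
      moreover have "c * r = Re (l (\<lambda>x. complex_of_real c * \<phi> x))" using lsc[OF *(1)] * by simp
      ultimately show "(\<lambda>i. c *\<^sub>R a i, c * r) \<in> G"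
        unfolding G_def using Cc_cmult[OF *(1)] by blast
    qed
    have sK: "0 \<le> K * sqrt M" using K M by simp
    obtain g where g: "\<And>n. g n \<in> L2 (M' n)" and gsum: "\<And>N. (\<Sum>n<N. l2_norm (M' n) (g n)) \<le> K * sqrt M"
      and gG: "\<And>y r. (y, r) \<in> G \<Longrightarrow> (\<lambda>n. l2_inner (M' n) (g n) (\<lambda>x. y (n, x))) sums r"
    proof (rule c0_sum_dual[OF G sK, of M'])
      fix z r n assume "(z, r) \<in> G"
      then obtain \<phi> where *: "\<phi> \<in> Cc \<Omega>" "z = y \<phi>" unfolding G_def by blast
      show "(\<lambda>x. z (n, x)) \<in> L2 (M' n)"
        unfolding *(2) yn by (intro L2_scaleR Pq *)
    next
      fix z r assume "(z, r) \<in> G"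
      then obtain \<phi> where *: "\<phi> \<in> Cc \<Omega>" "z = y \<phi>" unfolding G_def by blast
      show "(\<lambda>n. l2_norm (M' n) (\<lambda>x. z (n, x))) \<longlonglongrightarrow> 0"
        unfolding *(2) yn Pq(2)[OF *(1)] by (rule qlim[OF *(1)])
    next
      fix z r t assume zr: "(z, r) \<in> G" and t: "\<And>n. l2_norm (M' n) (\<lambda>x. z (n, x)) \<le> t"
      obtain \<phi> where *: "\<phi> \<in> Cc \<Omega>" "z = y \<phi>" "r = Re (l \<phi>)" using zr unfolding G_def by blast
      have "r \<le> cmod (l \<phi>)" using * complex_Re_le_cmod by simp
      also have "\<dots> \<le> K * bmo_norm \<Omega> D \<phi>" by (rule lle[OF *(1)])
      also have "\<dots> \<le> K * (sqrt M * t)"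
        using t unfolding *(2) yn Pq(2)[OF *(1)] by (intro mult_left_mono bmo_le *(1) K)
      finally show "r \<le> K * sqrt M * t" by (simp add: mult.assoc)
    qed blast
    define \<kappa> where "\<kappa> n = l2_norm (M' n) (g n)" for n
    have \<kappa>0: "0 \<le> \<kappa> n" for n by (simp add: \<kappa>_def)
    have \<kappa>s: "summable \<kappa>"
      by (rule summableI_nonneg_bounded[OF \<kappa>0 gsum[folded \<kappa>_def]])
    have \<kappa>le: "(\<Sum>n. \<kappa> n) \<le> K * sqrt M"
      by (rule suminf_le_const[OF \<kappa>s gsum[folded \<kappa>_def]])
    \<comment> \<open>The transpose of \<phi> \<mapsto>
      \<open>inverse (\<mu> n) *\<^sub>R (\<phi> - m n \<phi>)\<close>, applied to the conjugate of
      \<open>g n\<close>. Away from \<open>D\<close> it has integral 0, as an atom must.\<close>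
    define h where "h n x = inverse (\<mu> n) *\<^sub>R (cnj (g n x) - m n (\<lambda>x. cnj (g n x)))" for n x
    have cg: "(\<lambda>x. cnj (g n x)) \<in> L2 (M' n)" "l2_norm (M' n) (\<lambda>x. cnj (g n x)) = \<kappa> n" for n
      using L2_cnj[OF g[of n]] by (auto simp: \<kappa>_def)
    have hL: "h n \<in> L2 (lebesgue_on (U n))" for n
      using cg(1)[of n] unfolding h_def M'_def[symmetric]
      by (intro L2_scaleR L2_diff finite_measure.L2_const[OF finM])
    have hn: "l2_norm (lebesgue_on (U n)) (h n) \<le> \<kappa> n / \<mu> n" for n
    proof -
      \<comment> \<open>Subtracting the mean does not increase the L2 norm, and the factor
        \<open>inverse (\<mu> n)\<close> is exactly the normalisation of an atom on
        \<open>U n\<close>, with coefficient \<open>\<kappa> n\<close>.\<close>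
      have "root_mean_square (U n) (\<lambda>x. cnj (g n x) - m n (\<lambda>x. cnj (g n x))) \<le> root_mean_square (U n) (\<lambda>x. cnj (g n x))"
        using mean_oscillation_le[OF lm pos cg(1)[unfolded M'_def]] by (simp add: m_def mean_oscillation_def)
      then show ?thesis
        using \<mu>[of n] cg(2)[of n]
        by (simp add: h_def[abs_def] l2_norm_scaleR root_mean_square_eq \<mu>_def M'_def divide_inverse mult.commute)
    qed
    have avg: "complex_of_real (measure (M' n) (space (M' n))) * average (U n) u = (LINT x|M' n. u x)" for u n
      using average_integral[OF lm pos, of n u] measure_on_space[OF lm pos, of n]
      by (simp add: M'_def scaleR_conv_of_real)
    have h0: "(LINT x|lebesgue_on (U n). h n x) = 0 \<or> nr n" for n
    proof (cases "nr n")
      case False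
      have "(LINT x|M' n. cnj (g n x) - average (U n) (\<lambda>x. cnj (g n x)))
          = (LINT x|M' n. cnj (g n x)) - (LINT x|M' n. average (U n) (\<lambda>x. cnj (g n x)))"
        by (rule Bochner_Integration.integral_diff)
          (intro finite_measure.L2_imp_integrable[OF finM] cg(1) finite_measure.L2_const[OF finM])+
      also have "(LINT x|M' n. average (U n) (\<lambda>x. cnj (g n x))) = (LINT x|M' n. cnj (g n x))"
        by (simp add: scaleR_conv_of_real avg)
      finally have "(LINT x|M' n. cnj (g n x) - average (U n) (\<lambda>x. cnj (g n x))) = 0" by simp
      then show ?thesis using False by (simp add: h_def m_def M'_def)
    qed simp
    have pair: "l2_inner (M' n) (g n) (\<lambda>x. y \<phi> (n, x)) = Re (LINT x|lebesgue_on (U n). h n x * \<phi> x)"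
      if \<phi>: "\<phi> \<in> Cc \<Omega>" for \<phi> n
    proof -
      let ?u = "\<lambda>x. cnj (g n x)"
      have "l2_inner (M' n) (g n) (\<lambda>x. y \<phi> (n, x)) = inverse (\<mu> n) * l2_inner (M' n) (g n) (\<lambda>x. \<phi> x - m n \<phi>)"
        unfolding yn by (rule l2_inner_scaleR_right)
      also have "l2_inner (M' n) (g n) (\<lambda>x. \<phi> x - m n \<phi>) = Re (LINT x|M' n. ?u x * (\<phi> x - m n \<phi>))"
        using l2_inner_cnj[OF cg(1) Pq(1)[OF \<phi>], of n] by simp
      also have "(LINT x|M' n. ?u x * (\<phi> x - m n \<phi>)) = (LINT x|M' n. (?u x - m n ?u) * \<phi> x)"
        using finite_measure.integral_sub_mean_swap[OF finM cg(1) \<phi>L[OF \<phi>] avg avg]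
        by (simp add: m_def)
      finally show ?thesis
        by (simp add: h_def M'_def)
    qed
    have "\<exists>a. h1_atom \<Omega> D a \<and> (\<forall>\<phi>\<in>BMO \<Omega> D.
        complex_of_real (\<kappa> n) * (LINT z|lebesgue_on \<Omega>. a z * \<phi> z) = (LINT z|lebesgue_on (U n). h n z * \<phi> z))" for n
      by (rule scaled_atom[OF X R hL[unfolded U_def] hn[unfolded U_def \<mu>_def] h0[unfolded U_def nr_def], of n])
        (auto simp: U_def)
    then obtain a where a: "\<And>n. h1_atom \<Omega> D (a n)"
      and a\<phi>: "\<And>n \<phi>. \<phi> \<in> BMO \<Omega> D \<Longrightarrow>
        complex_of_real (\<kappa> n) * (LINT z|lebesgue_on \<Omega>. a n z * \<phi> z) = (LINT z|lebesgue_on (U n). h n z * \<phi> z)"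
      by metis
    define c where "c n = complex_of_real (\<kappa> n)" for n
    have cmod_c: "cmod (c n) = \<kappa> n" for n using \<kappa>0 by (simp add: c_def)
    define f where "f x = (\<Sum>j. c j * a j x)" for x
    have rep: "atomic_representation \<Omega> D f c a"
      unfolding f_def by (rule atomic_representation_suminf) (simp_all add: cmod_c \<kappa>s a)
    have fH: "f \<in> H1 \<Omega> D" using rep by (auto simp: H1_def)
    have Re_eq: "Re (l \<phi>) = Re (LINT x|lebesgue_on \<Omega>. f x * \<phi> x)" if \<phi>: "\<phi> \<in> Cc \<Omega>" for \<phi>
    proof -
      obtain t where "t \<ge> 0" "\<And>x. x \<in> \<Omega> \<Longrightarrow> cmod (\<phi> x) \<le> t" using Cc_bounded[OF \<phi>] by blast
      then have "(\<lambda>j. c j * (LINT x|lebesgue_on \<Omega>. a j x * \<phi> x)) sums (LINT x|lebesgue_on \<Omega>. f x * \<phi> x)"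
        by (intro H1_pairing_sums(2)[OF rep Cc_measurable[OF \<phi>]])
      then have "(\<lambda>j. Re (LINT x|lebesgue_on (U j). h j x * \<phi> x)) sums Re (LINT x|lebesgue_on \<Omega>. f x * \<phi> x)"
        unfolding c_def a\<phi>[OF Cc_BMO[OF \<phi>]] by (rule sums_Re)
      moreover have "(\<lambda>j. Re (LINT x|lebesgue_on (U j). h j x * \<phi> x)) sums Re (l \<phi>)"
        using gG[of "y \<phi>" "Re (l \<phi>)"] \<phi> unfolding pair[OF \<phi>] G_def by blast
      ultimately show ?thesis by (rule sums_unique2[symmetric])
    qed
    have "l \<phi> = (LINT x|lebesgue_on \<Omega>. f x * \<phi> x)" if \<phi>: "\<phi> \<in> Cc \<Omega>" for \<phi>
    \<comment> \<open>The equality of real parts at \<i> times \<phi> is, up to sign, the equality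
      of imaginary parts at \<phi>.\<close>
    proof (rule complex_eqI[OF Re_eq[OF \<phi>]])
      have "(LINT x|lebesgue_on \<Omega>. f x * (\<i> * \<phi> x)) = (LINT x|lebesgue_on \<Omega>. \<i> * (f x * \<phi> x))"
        by (simp add: mult_ac)
      also have "\<dots> = \<i> * (LINT x|lebesgue_on \<Omega>. f x * \<phi> x)" by simp
      finally show "Im (l \<phi>) = Im (LINT x|lebesgue_on \<Omega>. f x * \<phi> x)"
        using Re_eq[OF Cc_cmult[OF \<phi>, of \<i>]] lsc[OF \<phi>, of \<i>] by simp
    qed
    moreover have "(\<Sum>j. cmod (c j)) \<le> sqrt M * K" using \<kappa>le by (simp add: cmod_c mult.commute)
    ultimately show "\<exists>f c a. atomic_representation \<Omega> D f c a \<and> (\<Sum>j. cmod (c j)) \<le> sqrt M * K \<and>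
        (\<forall>\<phi>\<in>Cc \<Omega>. l \<phi> = (LINT x|lebesgue_on \<Omega>. f x * \<phi> x))"
      using rep by blast
  qed
qed

end

section \<open>Duality\<close>

lemma null_squeeze:
  fixes f g :: "nat \<Rightarrow> real"
  assumes "\<And>n. 0 \<le> f n" "\<And>n. f n \<le> g n" "g \<longlonglongrightarrow> 0"
  shows "f \<longlonglongrightarrow> 0"
  by (rule Lim_null_comparison[OF always_eventually assms(3)]) (use assms(1,2) in simp)

lemma
  assumes "l \<in> dual_space V p"
  shows dual_space_add: "\<phi> \<in> V \<Longrightarrow> \<psi> \<in> V \<Longrightarrow> l (\<lambda>x. \<phi> x + \<psi> x) = l \<phi> + l \<psi>"
    and dual_space_cmult: "\<phi> \<in> V \<Longrightarrow> l (\<lambda>x. c * \<phi> x) = c * l \<phi>"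
  using assms by (simp_all add: dual_space_def)

section \<open>Extension from test functions to VMO by density\<close>

context uitc_domain
begin

lemma VMO_BMO: "\<phi> \<in> VMO \<Omega> D \<Longrightarrow> \<phi> \<in> BMO \<Omega> D"
  by (simp add: VMO_def)

lemma Cc_VMO: "\<phi> \<in> Cc \<Omega> \<Longrightarrow> \<phi> \<in> VMO \<Omega> D"
  unfolding VMO_def using Cc_BMO by (auto intro!: bexI[of _ \<phi>] simp: bmo_norm_zero)

lemma BMO_diff: "f \<in> BMO \<Omega> D \<Longrightarrow> g \<in> BMO \<Omega> D \<Longrightarrow> (\<lambda>x. f x - g x) \<in> BMO \<Omega> D"
  using BMO_add[of f "\<lambda>x. (-1) * g x"] BMO_cmult[of g "-1"] by simp

lemma bmo_norm_minus_commute: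
  assumes f: "f \<in> BMO \<Omega> D" and g: "g \<in> BMO \<Omega> D"
  shows "bmo_norm \<Omega> D (\<lambda>x. f x - g x) = bmo_norm \<Omega> D (\<lambda>x. g x - f x)"
  using bmo_norm_cmult[OF BMO_diff[OF f g], of "-1"] bmo_norm_cmult[OF BMO_diff[OF g f], of "-1"] by simp

lemma bmo_norm_triangle_diff:
  assumes f: "f \<in> BMO \<Omega> D" and g: "g \<in> BMO \<Omega> D" and h: "h \<in> BMO \<Omega> D"
  shows "bmo_norm \<Omega> D (\<lambda>x. f x - h x) \<le> bmo_norm \<Omega> D (\<lambda>x. f x - g x) + bmo_norm \<Omega> D (\<lambda>x. g x - h x)"
  using bmo_norm_add[OF BMO_diff[OF f g] BMO_diff[OF g h]] by simp

definition Cc_approximates :: "(nat \<Rightarrow> 'a \<Rightarrow> complex) \<Rightarrow> ('a \<Rightarrow> complex) \<Rightarrow> bool" where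
  "Cc_approximates s \<phi> \<longleftrightarrow> (\<forall>n. s n \<in> Cc \<Omega>) \<and> (\<lambda>n. bmo_norm \<Omega> D (\<lambda>x. \<phi> x - s n x)) \<longlonglongrightarrow> 0"

lemma VMO_approximation:
  assumes "\<phi> \<in> VMO \<Omega> D"
  obtains s where "Cc_approximates s \<phi>"
proof -
  have "\<exists>\<psi>\<in>Cc \<Omega>. bmo_norm \<Omega> D (\<lambda>x. \<phi> x - \<psi> x) < inverse (Suc n)" for n
    using assms unfolding VMO_def by (auto simp del: of_nat_Suc)
  then obtain s where s: "\<And>n. s n \<in> Cc \<Omega>" "\<And>n. bmo_norm \<Omega> D (\<lambda>x. \<phi> x - s n x) < inverse (Suc n)"
    by metis
  have "(\<lambda>n. bmo_norm \<Omega> D (\<lambda>x. \<phi> x - s n x)) \<longlonglongrightarrow> 0"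
    by (rule null_squeeze[OF bmo_norm_nonneg less_imp_le[OF s(2)] LIMSEQ_inverse_real_of_nat])
  with s(1) show thesis by (intro that[of s]) (simp add: Cc_approximates_def)
qed

lemma Cc_approximates_VMO:
  assumes "\<phi> \<in> BMO \<Omega> D" "Cc_approximates s \<phi>"
  shows "\<phi> \<in> VMO \<Omega> D"
  unfolding VMO_def
proof (intro CollectI conjI allI impI assms(1))
  fix \<epsilon> :: real assume "\<epsilon> > 0"
  then obtain n where "bmo_norm \<Omega> D (\<lambda>x. \<phi> x - s n x) < \<epsilon>"
    using LIMSEQ_D[of "\<lambda>n. bmo_norm \<Omega> D (\<lambda>x. \<phi> x - s n x)" 0 \<epsilon>] assms(2)
    by (auto simp: Cc_approximates_def)
  then show "\<exists>\<psi>\<in>Cc \<Omega>. bmo_norm \<Omega> D (\<lambda>x. \<phi> x - \<psi> x) < \<epsilon>"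
    using assms(2) by (auto simp: Cc_approximates_def)
qed

lemma Cc_approximates_add:
  assumes \<phi>: "\<phi> \<in> BMO \<Omega> D" "Cc_approximates s \<phi>" and \<psi>: "\<psi> \<in> BMO \<Omega> D" "Cc_approximates t \<psi>"
  shows "Cc_approximates (\<lambda>n x. s n x + t n x) (\<lambda>x. \<phi> x + \<psi> x)"
  unfolding Cc_approximates_def
proof (intro conjI allI)
  have st: "s n \<in> Cc \<Omega>" "t n \<in> Cc \<Omega>" for n using \<phi> \<psi> by (auto simp: Cc_approximates_def)
  show "(\<lambda>x. s n x + t n x) \<in> Cc \<Omega>" for n by (intro Cc_add st)
  have "bmo_norm \<Omega> D (\<lambda>x. \<phi> x + \<psi> x - (s n x + t n x))
      \<le> bmo_norm \<Omega> D (\<lambda>x. \<phi> x - s n x) + bmo_norm \<Omega> D (\<lambda>x. \<psi> x - t n x)" for n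
    using bmo_norm_add[OF BMO_diff[OF \<phi>(1) Cc_BMO[OF st(1)]] BMO_diff[OF \<psi>(1) Cc_BMO[OF st(2)]], of n n]
    by (simp add: algebra_simps)
  moreover have "(\<lambda>n. bmo_norm \<Omega> D (\<lambda>x. \<phi> x - s n x) + bmo_norm \<Omega> D (\<lambda>x. \<psi> x - t n x)) \<longlonglongrightarrow> 0"
    using tendsto_add[of "\<lambda>n. bmo_norm \<Omega> D (\<lambda>x. \<phi> x - s n x)" 0] \<phi> \<psi> by (auto simp: Cc_approximates_def)
  ultimately show "(\<lambda>n. bmo_norm \<Omega> D (\<lambda>x. \<phi> x + \<psi> x - (s n x + t n x))) \<longlonglongrightarrow> 0"
    by (rule null_squeeze[OF bmo_norm_nonneg])
qed

lemma Cc_approximates_cmult: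
  assumes \<phi>: "\<phi> \<in> BMO \<Omega> D" "Cc_approximates s \<phi>"
  shows "Cc_approximates (\<lambda>n x. c * s n x) (\<lambda>x. c * \<phi> x)"
  unfolding Cc_approximates_def
proof (intro conjI allI)
  have s: "s n \<in> Cc \<Omega>" for n using \<phi> by (auto simp: Cc_approximates_def)
  show "(\<lambda>x. c * s n x) \<in> Cc \<Omega>" for n by (intro Cc_cmult s)
  have "bmo_norm \<Omega> D (\<lambda>x. c * \<phi> x - c * s n x) \<le> cmod c * bmo_norm \<Omega> D (\<lambda>x. \<phi> x - s n x)" for n
    using bmo_norm_cmult[OF BMO_diff[OF \<phi>(1) Cc_BMO[OF s]], of c n] by (simp add: algebra_simps)
  moreover have "(\<lambda>n. cmod c * bmo_norm \<Omega> D (\<lambda>x. \<phi> x - s n x)) \<longlonglongrightarrow> 0"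
    using \<phi> by (intro tendsto_mult_right_zero) (auto simp: Cc_approximates_def)
  ultimately show "(\<lambda>n. bmo_norm \<Omega> D (\<lambda>x. c * \<phi> x - c * s n x)) \<longlonglongrightarrow> 0"
    by (rule null_squeeze[OF bmo_norm_nonneg])
qed

lemma Cc_approximates_const: "\<phi> \<in> Cc \<Omega> \<Longrightarrow> Cc_approximates (\<lambda>n. \<phi>) \<phi>"
  by (simp add: Cc_approximates_def bmo_norm_zero)

lemma VMO_add: "\<phi> \<in> VMO \<Omega> D \<Longrightarrow> \<psi> \<in> VMO \<Omega> D \<Longrightarrow> (\<lambda>x. \<phi> x + \<psi> x) \<in> VMO \<Omega> D"
  by (metis BMO_add Cc_approximates_VMO Cc_approximates_add VMO_BMO VMO_approximation)

lemma VMO_cmult: "\<phi> \<in> VMO \<Omega> D \<Longrightarrow> (\<lambda>x. c * \<phi> x) \<in> VMO \<Omega> D"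
  by (metis BMO_cmult Cc_approximates_VMO Cc_approximates_cmult VMO_BMO VMO_approximation)

text \<open>The bound is an explicit parameter because the norm equivalence has to follow it through
  representation and extension.\<close>

definition bounded_on_Cc :: "(('a \<Rightarrow> complex) \<Rightarrow> complex) \<Rightarrow> real \<Rightarrow> bool" where
  "bounded_on_Cc u K \<longleftrightarrow> 0 \<le> K \<and>
     (\<forall>\<phi>\<in>Cc \<Omega>. \<forall>\<psi>\<in>Cc \<Omega>. u (\<lambda>x. \<phi> x + \<psi> x) = u \<phi> + u \<psi>) \<and>
     (\<forall>c. \<forall>\<phi>\<in>Cc \<Omega>. u (\<lambda>x. c * \<phi> x) = c * u \<phi>) \<and>
     (\<forall>\<phi>\<in>Cc \<Omega>. cmod (u \<phi>) \<le> K * bmo_norm \<Omega> D \<phi>)"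

lemma
  assumes "bounded_on_Cc u K"
  shows bounded_on_Cc_nonneg: "0 \<le> K"
    and bounded_on_Cc_add: "\<phi> \<in> Cc \<Omega> \<Longrightarrow> \<psi> \<in> Cc \<Omega> \<Longrightarrow> u (\<lambda>x. \<phi> x + \<psi> x) = u \<phi> + u \<psi>"
    and bounded_on_Cc_cmult: "\<phi> \<in> Cc \<Omega> \<Longrightarrow> u (\<lambda>x. c * \<phi> x) = c * u \<phi>"
    and bounded_on_Cc_le: "\<phi> \<in> Cc \<Omega> \<Longrightarrow> cmod (u \<phi>) \<le> K * bmo_norm \<Omega> D \<phi>"
  using assms by (simp_all add: bounded_on_Cc_def)

text \<open>Any approximating sequence gives the same limit, so the choice by \<open>SOME\<close> is
  harmless. The value 0 elsewhere is the normalisation in \<open>dual_space\<close>.\<close>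

definition VMO_extension :: "(('a \<Rightarrow> complex) \<Rightarrow> complex) \<Rightarrow> ('a \<Rightarrow> complex) \<Rightarrow> complex" where
  "VMO_extension u \<phi> = (if \<phi> \<in> VMO \<Omega> D then lim (\<lambda>n. u ((SOME s. Cc_approximates s \<phi>) n)) else 0)"

context
  fixes u K
  assumes u: "bounded_on_Cc u K"
begin

lemma bounded_on_Cc_diff_le:
  assumes "\<phi> \<in> Cc \<Omega>" "\<psi> \<in> Cc \<Omega>"
  shows "cmod (u \<phi> - u \<psi>) \<le> K * bmo_norm \<Omega> D (\<lambda>x. \<phi> x - \<psi> x)"
proof -
  have "u (\<lambda>x. \<phi> x + (-1) * \<psi> x) = u \<phi> + u (\<lambda>x. (-1) * \<psi> x)"
    by (rule bounded_on_Cc_add[OF u assms(1) Cc_cmult[OF assms(2)]])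
  also have "u (\<lambda>x. (-1) * \<psi> x) = (-1) * u \<psi>"
    by (rule bounded_on_Cc_cmult[OF u assms(2)])
  finally have "u \<phi> - u \<psi> = u (\<lambda>x. \<phi> x - \<psi> x)" by simp
  then show ?thesis
    using bounded_on_Cc_le[OF u Cc_diff[OF assms]] by simp
qed

text \<open>Well-definedness of the extension: two approximations of the same function approach each
  other in the seminorm, hence so do their values under \<open>u\<close>.\<close>

lemma approximations_agree:
  assumes \<phi>: "\<phi> \<in> BMO \<Omega> D" and s: "Cc_approximates s \<phi>" and t: "Cc_approximates t \<phi>"
  shows "(\<lambda>n. u (s n) - u (t n)) \<longlonglongrightarrow> 0"
proof (rule Lim_null_comparison)
  have st: "s n \<in> Cc \<Omega>" "t n \<in> Cc \<Omega>" for n using s t by (auto simp: Cc_approximates_def)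
  have K: "0 \<le> K" by (rule bounded_on_Cc_nonneg[OF u])
  have "norm (u (s n) - u (t n)) \<le> K * (bmo_norm \<Omega> D (\<lambda>x. \<phi> x - s n x) + bmo_norm \<Omega> D (\<lambda>x. \<phi> x - t n x))" for n
  proof -
    note le = bounded_on_Cc_diff_le[OF st(1)[of n] st(2)[of n]]
    also have "bmo_norm \<Omega> D (\<lambda>x. s n x - t n x)
        \<le> bmo_norm \<Omega> D (\<lambda>x. \<phi> x - s n x) + bmo_norm \<Omega> D (\<lambda>x. \<phi> x - t n x)"
      using bmo_norm_triangle_diff[OF Cc_BMO[OF st(1)] \<phi> Cc_BMO[OF st(2)], of n n]
        bmo_norm_minus_commute[OF Cc_BMO[OF st(1)] \<phi>, of n] by simp
    finally show ?thesis using K by (simp add: mult_left_mono)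
  qed
  then show "eventually (\<lambda>n. norm (u (s n) - u (t n)) \<le> K * (bmo_norm \<Omega> D (\<lambda>x. \<phi> x - s n x) + bmo_norm \<Omega> D (\<lambda>x. \<phi> x - t n x))) sequentially"
    by (intro always_eventually allI)
  have "(\<lambda>n. K * (bmo_norm \<Omega> D (\<lambda>x. \<phi> x - s n x) + bmo_norm \<Omega> D (\<lambda>x. \<phi> x - t n x))) \<longlonglongrightarrow> K * (0 + 0)"
    using s t by (intro tendsto_intros) (auto simp: Cc_approximates_def)
  then show "(\<lambda>n. K * (bmo_norm \<Omega> D (\<lambda>x. \<phi> x - s n x) + bmo_norm \<Omega> D (\<lambda>x. \<phi> x - t n x))) \<longlonglongrightarrow> 0"
    by simp
qed

lemma approximations_converge:
  assumes \<phi>: "\<phi> \<in> BMO \<Omega> D" and s: "Cc_approximates s \<phi>"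
  shows "convergent (\<lambda>n. u (s n))"
proof (rule Cauchy_convergent, rule metric_CauchyI)
  fix e :: real assume e: "e > 0"
  have sC: "s n \<in> Cc \<Omega>" for n using s by (auto simp: Cc_approximates_def)
  have K: "0 \<le> K" by (rule bounded_on_Cc_nonneg[OF u])
  define \<delta> where "\<delta> = e / (2 * (K + 1))"
  have \<delta>: "\<delta> > 0" "K * (2 * \<delta>) < e" using e K by (auto simp: \<delta>_def field_simps add_nonneg_pos)
  obtain N where N: "\<And>n. n \<ge> N \<Longrightarrow> bmo_norm \<Omega> D (\<lambda>x. \<phi> x - s n x) < \<delta>"
    using LIMSEQ_D[of "\<lambda>n. bmo_norm \<Omega> D (\<lambda>x. \<phi> x - s n x)" 0 \<delta>] s \<delta>(1)
    by (auto simp: Cc_approximates_def)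
  show "\<exists>M. \<forall>m\<ge>M. \<forall>n\<ge>M. dist (u (s m)) (u (s n)) < e"
  proof (intro exI[of _ N] allI impI)
    fix m n assume mn: "N \<le> m" "N \<le> n"
    have "dist (u (s m)) (u (s n)) \<le> K * bmo_norm \<Omega> D (\<lambda>x. s m x - s n x)"
      using bounded_on_Cc_diff_le[OF sC sC] by (simp add: dist_norm)
    also have "\<dots> \<le> K * (2 * \<delta>)"
      using bmo_norm_triangle_diff[OF Cc_BMO[OF sC] \<phi> Cc_BMO[OF sC], of m n]
        bmo_norm_minus_commute[OF Cc_BMO[OF sC] \<phi>, of m] N[OF mn(1)] N[OF mn(2)]
      by (intro mult_left_mono K) linarith
    finally show "dist (u (s m)) (u (s n)) < e" using \<delta> by linarith
  qed
qed

lemma VMO_extension_lim: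
  assumes \<phi>: "\<phi> \<in> VMO \<Omega> D" and s: "Cc_approximates s \<phi>"
  shows "(\<lambda>n. u (s n)) \<longlonglongrightarrow> VMO_extension u \<phi>"
proof -
  define t where "t = (SOME s. Cc_approximates s \<phi>)"
  have t: "Cc_approximates t \<phi>" unfolding t_def by (rule someI[of "\<lambda>s. Cc_approximates s \<phi>", OF s])
  have "(\<lambda>n. u (t n)) \<longlonglongrightarrow> VMO_extension u \<phi>"
    using approximations_converge[OF VMO_BMO[OF \<phi>] t] \<phi>
    by (simp add: VMO_extension_def t_def[symmetric] convergent_LIMSEQ_iff)
  from tendsto_add[OF this approximations_agree[OF VMO_BMO[OF \<phi>] s t]] show ?thesis by simp
qed

lemma VMO_extension_Cc: "\<phi> \<in> Cc \<Omega> \<Longrightarrow> VMO_extension u \<phi> = u \<phi>"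
  using LIMSEQ_unique[OF VMO_extension_lim[OF Cc_VMO Cc_approximates_const] tendsto_const] by blast

lemma VMO_extension_le:
  assumes \<phi>: "\<phi> \<in> VMO \<Omega> D"
  shows "cmod (VMO_extension u \<phi>) \<le> K * bmo_norm \<Omega> D \<phi>"
proof -
  obtain s where s: "Cc_approximates s \<phi>" by (rule VMO_approximation[OF \<phi>])
  have sC: "s n \<in> Cc \<Omega>" for n using s by (auto simp: Cc_approximates_def)
  have K: "0 \<le> K" by (rule bounded_on_Cc_nonneg[OF u])
  have "(\<lambda>n. K * (bmo_norm \<Omega> D \<phi> + bmo_norm \<Omega> D (\<lambda>x. \<phi> x - s n x))) \<longlonglongrightarrow> K * (bmo_norm \<Omega> D \<phi> + 0)"
    using s by (intro tendsto_intros) (auto simp: Cc_approximates_def)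
  then have "cmod (VMO_extension u \<phi>) \<le> K * (bmo_norm \<Omega> D \<phi> + 0)"
  proof (rule LIMSEQ_le[OF tendsto_norm[OF VMO_extension_lim[OF \<phi> s]]], intro exI allI impI)
    fix n
    have "norm (u (s n)) \<le> K * bmo_norm \<Omega> D (s n)" by (rule bounded_on_Cc_le[OF u sC])
    also have "bmo_norm \<Omega> D (s n) \<le> bmo_norm \<Omega> D \<phi> + bmo_norm \<Omega> D (\<lambda>x. \<phi> x - s n x)"
      using bmo_norm_add[OF VMO_BMO[OF \<phi>] BMO_diff[OF Cc_BMO[OF sC] VMO_BMO[OF \<phi>]], of n]
        bmo_norm_minus_commute[OF Cc_BMO[OF sC] VMO_BMO[OF \<phi>], of n] by simp
    finally show "norm (u (s n)) \<le> K * (bmo_norm \<Omega> D \<phi> + bmo_norm \<Omega> D (\<lambda>x. \<phi> x - s n x))"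
      using K by (simp add: mult_left_mono)
  qed
  then show ?thesis by simp
qed

lemma VMO_extension_dual: "VMO_extension u \<in> dual_space (VMO \<Omega> D) (bmo_norm \<Omega> D)"
  unfolding dual_space_def
proof (intro CollectI conjI ballI allI impI)
  fix \<phi> \<psi> assume \<phi>: "\<phi> \<in> VMO \<Omega> D" and \<psi>: "\<psi> \<in> VMO \<Omega> D"
  obtain s t where s: "Cc_approximates s \<phi>" and t: "Cc_approximates t \<psi>"
    using VMO_approximation[OF \<phi>] VMO_approximation[OF \<psi>] by metis
  have "u (\<lambda>x. s n x + t n x) = u (s n) + u (t n)" for n
    using s t by (intro bounded_on_Cc_add[OF u]) (simp_all add: Cc_approximates_def)
  then have "(\<lambda>n. u (s n) + u (t n)) \<longlonglongrightarrow> VMO_extension u (\<lambda>x. \<phi> x + \<psi> x)"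
    using VMO_extension_lim[OF VMO_add[OF \<phi> \<psi>] Cc_approximates_add[OF VMO_BMO[OF \<phi>] s VMO_BMO[OF \<psi>] t]] by simp
  then show "VMO_extension u (\<lambda>x. \<phi> x + \<psi> x) = VMO_extension u \<phi> + VMO_extension u \<psi>"
    by (rule LIMSEQ_unique[OF _ tendsto_add[OF VMO_extension_lim[OF \<phi> s] VMO_extension_lim[OF \<psi> t]]])
next
  fix c \<phi> assume \<phi>: "\<phi> \<in> VMO \<Omega> D"
  obtain s where s: "Cc_approximates s \<phi>" by (rule VMO_approximation[OF \<phi>])
  have "u (\<lambda>x. c * s n x) = c * u (s n)" for n
    using s by (intro bounded_on_Cc_cmult[OF u]) (simp add: Cc_approximates_def)
  then have "(\<lambda>n. c * u (s n)) \<longlonglongrightarrow> VMO_extension u (\<lambda>x. c * \<phi> x)"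
    using VMO_extension_lim[OF VMO_cmult[OF \<phi>, of c] Cc_approximates_cmult[OF VMO_BMO[OF \<phi>] s]] by simp
  then show "VMO_extension u (\<lambda>x. c * \<phi> x) = c * VMO_extension u \<phi>"
    by (rule LIMSEQ_unique[OF _ tendsto_mult_left[OF VMO_extension_lim[OF \<phi> s]]])
next
  show "\<exists>K. \<forall>\<phi>\<in>VMO \<Omega> D. cmod (VMO_extension u \<phi>) \<le> K * bmo_norm \<Omega> D \<phi>"
    using VMO_extension_le by blast
next
  fix \<phi> assume "\<phi> \<notin> VMO \<Omega> D"
  then show "VMO_extension u \<phi> = 0" by (simp add: VMO_extension_def)
qed

end

lemma VMO_extension_add:
  assumes u: "bounded_on_Cc u K" and v: "bounded_on_Cc v L" and w: "bounded_on_Cc w N"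
    and eq: "\<And>\<phi>. \<phi> \<in> Cc \<Omega> \<Longrightarrow> w \<phi> = u \<phi> + v \<phi>"
  shows "VMO_extension w = (\<lambda>\<phi>. VMO_extension u \<phi> + VMO_extension v \<phi>)"
proof
  fix \<phi>
  show "VMO_extension w \<phi> = VMO_extension u \<phi> + VMO_extension v \<phi>"
  proof (cases "\<phi> \<in> VMO \<Omega> D")
    case True
    obtain s where s: "Cc_approximates s \<phi>" by (rule VMO_approximation[OF True])
    have "w (s n) = u (s n) + v (s n)" for n using s by (intro eq) (simp add: Cc_approximates_def)
    then show ?thesis
      using LIMSEQ_unique[OF VMO_extension_lim[OF w True s]]
        tendsto_add[OF VMO_extension_lim[OF u True s] VMO_extension_lim[OF v True s]] by simp
  qed (simp add: VMO_extension_def)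
qed

lemma VMO_extension_cmult:
  assumes u: "bounded_on_Cc u K" and w: "bounded_on_Cc w N"
    and eq: "\<And>\<phi>. \<phi> \<in> Cc \<Omega> \<Longrightarrow> w \<phi> = c * u \<phi>"
  shows "VMO_extension w = (\<lambda>\<phi>. c * VMO_extension u \<phi>)"
proof
  fix \<phi>
  show "VMO_extension w \<phi> = c * VMO_extension u \<phi>"
  proof (cases "\<phi> \<in> VMO \<Omega> D")
    case True
    obtain s where s: "Cc_approximates s \<phi>" by (rule VMO_approximation[OF True])
    have "w (s n) = c * u (s n)" for n using s by (intro eq) (simp add: Cc_approximates_def)
    then show ?thesis
      using LIMSEQ_unique[OF VMO_extension_lim[OF w True s]]
        tendsto_mult_left[OF VMO_extension_lim[OF u True s], of c] by simp
  qed (simp add: VMO_extension_def)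
qed

lemma dual_bounded_on_Cc:
  assumes l: "l \<in> dual_space (VMO \<Omega> D) (bmo_norm \<Omega> D)"
    and K: "0 \<le> K" "\<And>\<phi>. \<phi> \<in> Cc \<Omega> \<Longrightarrow> cmod (l \<phi>) \<le> K * bmo_norm \<Omega> D \<phi>"
  shows "bounded_on_Cc l K"
  using l K Cc_VMO unfolding bounded_on_Cc_def dual_space_def by simp

text \<open>Test functions are dense and \<open>l\<close> is bounded, so \<open>l\<close> is
  determined on VMO by its values on \<open>Cc\<close>; elsewhere both sides are normalised to
  0.\<close>

lemma dual_eq_VMO_extension:
  assumes l: "l \<in> dual_space (VMO \<Omega> D) (bmo_norm \<Omega> D)" and u: "bounded_on_Cc u K"
    and eq: "\<And>\<phi>. \<phi> \<in> Cc \<Omega> \<Longrightarrow> l \<phi> = u \<phi>"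
  shows "l = VMO_extension u"
proof
  fix \<phi>
  show "l \<phi> = VMO_extension u \<phi>"
  proof (cases "\<phi> \<in> VMO \<Omega> D")
    case False
    then show ?thesis using l by (simp add: VMO_extension_def dual_space_def)
  next
    case True
    obtain s where s: "Cc_approximates s \<phi>" by (rule VMO_approximation[OF True])
    have sV: "s n \<in> VMO \<Omega> D" for n using s Cc_VMO by (simp add: Cc_approximates_def)
    obtain L where L: "\<And>\<phi>. \<phi> \<in> VMO \<Omega> D \<Longrightarrow> cmod (l \<phi>) \<le> L * bmo_norm \<Omega> D \<phi>"
      using l unfolding dual_space_def by blast
    have "l \<phi> - u (s n) = l (\<lambda>x. \<phi> x - s n x)" for n
    proof -
      have "l (\<lambda>x. \<phi> x + (-1) * s n x) = l \<phi> + l (\<lambda>x. (-1) * s n x)"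
        by (rule dual_space_add[OF l True VMO_cmult[OF sV]])
      also have "l (\<lambda>x. (-1) * s n x) = (-1) * l (s n)"
        by (rule dual_space_cmult[OF l sV])
      also have "l (s n) = u (s n)" using s by (intro eq) (simp add: Cc_approximates_def)
      finally show ?thesis by simp
    qed
    moreover have "(\<lambda>x. \<phi> x - s n x) \<in> VMO \<Omega> D" for n
      using VMO_add[OF True VMO_cmult[OF sV, of "-1"]] by simp
    ultimately have "norm (l \<phi> - u (s n)) \<le> L * bmo_norm \<Omega> D (\<lambda>x. \<phi> x - s n x)" for n
      using L by simp
    moreover have "(\<lambda>n. L * bmo_norm \<Omega> D (\<lambda>x. \<phi> x - s n x)) \<longlonglongrightarrow> 0"
      using s by (intro tendsto_mult_right_zero) (simp add: Cc_approximates_def)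
    ultimately have "(\<lambda>n. l \<phi> - u (s n)) \<longlonglongrightarrow> 0"
      by (intro Lim_null_comparison[of "\<lambda>n. l \<phi> - u (s n)"]) (auto intro: always_eventually)
    moreover have "(\<lambda>n. l \<phi> - u (s n)) \<longlonglongrightarrow> l \<phi> - VMO_extension u \<phi>"
      by (intro tendsto_intros VMO_extension_lim[OF u True s])
    ultimately show ?thesis using LIMSEQ_unique by fastforce
  qed
qed

section \<open>The map from the Hardy space to the dual, and its norm bounds\<close>

definition pairing :: "('a \<Rightarrow> complex) \<Rightarrow> ('a \<Rightarrow> complex) \<Rightarrow> complex" where
  "pairing f \<phi> = (LINT x|lebesgue_on \<Omega>. f x * \<phi> x)"

lemma pairing_bounded:
  assumes f: "f \<in> H1 \<Omega> D"
  shows "bounded_on_Cc (pairing f) (h1_norm \<Omega> D f)"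
  unfolding bounded_on_Cc_def pairing_def
proof (intro conjI ballI allI h1_norm_nonneg[OF f] H1_pairing_le[OF f])
  fix \<phi> \<psi> assume *: "\<phi> \<in> Cc \<Omega>" "\<psi> \<in> Cc \<Omega>"
  show "(LINT x|lebesgue_on \<Omega>. f x * (\<phi> x + \<psi> x))
      = (LINT x|lebesgue_on \<Omega>. f x * \<phi> x) + (LINT x|lebesgue_on \<Omega>. f x * \<psi> x)"
    using H1_Cc_integrable[OF f *(1)] H1_Cc_integrable[OF f *(2)] by (simp add: distrib_left)
next
  fix c \<phi> assume "\<phi> \<in> Cc \<Omega>"
  have "(LINT x|lebesgue_on \<Omega>. f x * (c * \<phi> x)) = (LINT x|lebesgue_on \<Omega>. c * (f x * \<phi> x))"
    by (simp add: mult_ac)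
  then show "(LINT x|lebesgue_on \<Omega>. f x * (c * \<phi> x)) = c * (LINT x|lebesgue_on \<Omega>. f x * \<phi> x)" by simp
qed

lemma pairing_eq_iff:
  assumes f: "f \<in> H1 \<Omega> D" and g: "g \<in> H1 \<Omega> D"
  shows "(\<forall>\<phi>\<in>Cc \<Omega>. pairing f \<phi> = pairing g \<phi>) \<longleftrightarrow> (AE x in lebesgue_on \<Omega>. f x = g x)"
proof
  assume eq: "\<forall>\<phi>\<in>Cc \<Omega>. pairing f \<phi> = pairing g \<phi>"
  have "AE x in lebesgue_on \<Omega>. f x - g x = 0"
  proof (rule Cc_determines_AE)
    show "integrable (lebesgue_on \<Omega>) (\<lambda>x. f x - g x)" using H1_integrable[OF f] H1_integrable[OF g] by simp
    fix \<phi> assume \<phi>: "\<phi> \<in> Cc \<Omega>"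
    then show "(LINT x|lebesgue_on \<Omega>. (f x - g x) * \<phi> x) = 0"
      using eq H1_Cc_integrable[OF f \<phi>] H1_Cc_integrable[OF g \<phi>] by (simp add: left_diff_distrib pairing_def)
  qed
  then show "AE x in lebesgue_on \<Omega>. f x = g x" by simp
next
  assume eq: "AE x in lebesgue_on \<Omega>. f x = g x"
  show "\<forall>\<phi>\<in>Cc \<Omega>. pairing f \<phi> = pairing g \<phi>"
  proof
    fix \<phi> assume \<phi>: "\<phi> \<in> Cc \<Omega>"
    have "AE x in lebesgue_on \<Omega>. f x * \<phi> x = g x * \<phi> x" using eq by eventually_elim simp
    then show "pairing f \<phi> = pairing g \<phi>"
      unfolding pairing_def using H1_Cc_integrable[OF f \<phi>] H1_Cc_integrable[OF g \<phi>]
      by (intro integral_cong_AE) auto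
  qed
qed

lemma pairing_extension_eq_iff:
  assumes f: "f \<in> H1 \<Omega> D" and g: "g \<in> H1 \<Omega> D"
  shows "VMO_extension (pairing f) = VMO_extension (pairing g) \<longleftrightarrow> (AE x in lebesgue_on \<Omega>. f x = g x)"
proof
  assume eq: "VMO_extension (pairing f) = VMO_extension (pairing g)"
  have "\<forall>\<phi>\<in>Cc \<Omega>. pairing f \<phi> = pairing g \<phi>"
    using VMO_extension_Cc[OF pairing_bounded[OF f]] VMO_extension_Cc[OF pairing_bounded[OF g]] eq by metis
  then show "AE x in lebesgue_on \<Omega>. f x = g x" by (simp only: pairing_eq_iff[OF f g])
next
  assume "AE x in lebesgue_on \<Omega>. f x = g x"
  then have "\<forall>\<phi>\<in>Cc \<Omega>. pairing f \<phi> = pairing g \<phi>" by (simp only: pairing_eq_iff[OF f g])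
  then show "VMO_extension (pairing f) = VMO_extension (pairing g)"
    using VMO_extension_Cc[OF pairing_bounded[OF f]]
    by (intro dual_eq_VMO_extension[OF VMO_extension_dual[OF pairing_bounded[OF f]] pairing_bounded[OF g]]) simp
qed

text \<open>Replaces the given bound of \<open>u\<close> by the optimal one. A test function of
  seminorm 0 cannot be normalised, but \<open>u\<close> vanishes on it.\<close>

lemma VMO_extension_le_dual_norm:
  assumes u: "bounded_on_Cc u K" and \<phi>: "\<phi> \<in> Cc \<Omega>"
  shows "cmod (u \<phi>) \<le> dual_norm (VMO \<Omega> D) (bmo_norm \<Omega> D) (VMO_extension u) * bmo_norm \<Omega> D \<phi>"
proof (cases "bmo_norm \<Omega> D \<phi> = 0")
  case True
  then show ?thesis using bounded_on_Cc_le[OF u \<phi>] by simp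
next
  case False
  define p where "p = bmo_norm \<Omega> D \<phi>"
  have p: "p > 0" using False bmo_norm_nonneg[of \<phi>] by (simp add: p_def less_le)
  define \<psi> where "\<psi> = (\<lambda>x. complex_of_real (inverse p) * \<phi> x)"
  have \<psi>: "\<psi> \<in> Cc \<Omega>" unfolding \<psi>_def by (rule Cc_cmult[OF \<phi>])
  have "bmo_norm \<Omega> D \<psi> \<le> inverse p * p"
    using bmo_norm_cmult[OF Cc_BMO[OF \<phi>], of "complex_of_real (inverse p)"] p
    by (simp add: \<psi>_def p_def[symmetric] norm_inverse)
  then have \<psi>1: "\<psi> \<in> {\<phi> \<in> VMO \<Omega> D. bmo_norm \<Omega> D \<phi> \<le> 1}" using p Cc_VMO[OF \<psi>] by simp
  have K: "0 \<le> K" by (rule bounded_on_Cc_nonneg[OF u])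
  have "bdd_above ((\<lambda>\<phi>. cmod (VMO_extension u \<phi>)) ` {\<phi> \<in> VMO \<Omega> D. bmo_norm \<Omega> D \<phi> \<le> 1})"
    using VMO_extension_le[OF u] K by (intro bdd_aboveI2[of _ _ K]) (smt (verit) mem_Collect_eq mult_left_le)
  then have "cmod (VMO_extension u \<psi>) \<le> dual_norm (VMO \<Omega> D) (bmo_norm \<Omega> D) (VMO_extension u)"
    unfolding dual_norm_def by (rule cSUP_upper[OF \<psi>1])
  moreover have "VMO_extension u \<psi> = complex_of_real (inverse p) * u \<phi>"
    unfolding VMO_extension_Cc[OF u \<psi>] unfolding \<psi>_def by (rule bounded_on_Cc_cmult[OF u \<phi>])
  ultimately have "inverse p * cmod (u \<phi>) \<le> dual_norm (VMO \<Omega> D) (bmo_norm \<Omega> D) (VMO_extension u)"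
    using p by (simp add: norm_mult norm_inverse)
  then show ?thesis using p by (simp add: p_def[symmetric] field_simps)
qed

lemma dual_norm_VMO_extension:
  assumes u: "bounded_on_Cc u K"
  shows "0 \<le> dual_norm (VMO \<Omega> D) (bmo_norm \<Omega> D) (VMO_extension u)"
    "dual_norm (VMO \<Omega> D) (bmo_norm \<Omega> D) (VMO_extension u) \<le> K"
proof -
  have K: "0 \<le> K" by (rule bounded_on_Cc_nonneg[OF u])
  have le: "cmod (VMO_extension u \<phi>) \<le> K" if "\<phi> \<in> {\<phi> \<in> VMO \<Omega> D. bmo_norm \<Omega> D \<phi> \<le> 1}" for \<phi>
  proof -
    have "cmod (VMO_extension u \<phi>) \<le> K * bmo_norm \<Omega> D \<phi>" using that by (intro VMO_extension_le[OF u]) simp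
    also have "\<dots> \<le> K" using that K by (intro mult_left_le) auto
    finally show ?thesis .
  qed
  have z: "(\<lambda>x. 0) \<in> {\<phi> \<in> VMO \<Omega> D. bmo_norm \<Omega> D \<phi> \<le> 1}"
    using Cc_VMO[OF Cc_zero] by (simp add: bmo_norm_zero)
  show "dual_norm (VMO \<Omega> D) (bmo_norm \<Omega> D) (VMO_extension u) \<le> K"
    unfolding dual_norm_def using z le by (intro cSUP_least) blast+
  have "cmod (VMO_extension u (\<lambda>x. 0)) \<le> dual_norm (VMO \<Omega> D) (bmo_norm \<Omega> D) (VMO_extension u)"
    unfolding dual_norm_def using le by (intro cSUP_upper[OF z] bdd_aboveI2)
  then show "0 \<le> dual_norm (VMO \<Omega> D) (bmo_norm \<Omega> D) (VMO_extension u)"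
    using norm_ge_zero order_trans by blast
qed

text \<open>The upper constant is 1, from the estimate for atoms. The lower one is
  \<open>inverse A\<close>, from applying the representation of functionals to \<open>T f\<close>
  itself.\<close>

theorem VMO_dual:
  fixes T defines "T \<equiv> \<lambda>f. VMO_extension (pairing f)"
  shows "T ` H1 \<Omega> D = dual_space (VMO \<Omega> D) (bmo_norm \<Omega> D)"
    "\<exists>c>0. \<exists>C>0. \<forall>f\<in>H1 \<Omega> D.
        c * h1_norm \<Omega> D f \<le> dual_norm (VMO \<Omega> D) (bmo_norm \<Omega> D) (T f) \<and>
        dual_norm (VMO \<Omega> D) (bmo_norm \<Omega> D) (T f) \<le> C * h1_norm \<Omega> D f"
proof -
  obtain A where A: "A > 0" and rep: "\<And>u K. bounded_on_Cc u K \<Longrightarrow>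
      \<exists>f c a. atomic_representation \<Omega> D f c a \<and> (\<Sum>j. cmod (c j)) \<le> A * K \<and> (\<forall>\<phi>\<in>Cc \<Omega>. u \<phi> = pairing f \<phi>)"
    by (rule Cc_functional_representation) (simp add: bounded_on_Cc_def pairing_def)
  show "T ` H1 \<Omega> D = dual_space (VMO \<Omega> D) (bmo_norm \<Omega> D)"
  proof (intro equalityI subsetI)
    fix l assume "l \<in> T ` H1 \<Omega> D"
    then show "l \<in> dual_space (VMO \<Omega> D) (bmo_norm \<Omega> D)"
      unfolding T_def using VMO_extension_dual[OF pairing_bounded] by blast
  next
    fix l assume l: "l \<in> dual_space (VMO \<Omega> D) (bmo_norm \<Omega> D)"
    then obtain K where K: "\<And>\<phi>. \<phi> \<in> VMO \<Omega> D \<Longrightarrow> cmod (l \<phi>) \<le> K * bmo_norm \<Omega> D \<phi>"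
      unfolding dual_space_def by blast
    \<comment> \<open>\<open>dual_space\<close> does not require its constant to be
      nonnegative.\<close>
    have "cmod (l \<phi>) \<le> max K 0 * bmo_norm \<Omega> D \<phi>" if "\<phi> \<in> Cc \<Omega>" for \<phi>
      using K[OF Cc_VMO[OF that]] mult_right_mono[OF max.cobounded1[of K 0] bmo_norm_nonneg[of \<phi>]] by linarith
    then have "bounded_on_Cc l (max K 0)" by (intro dual_bounded_on_Cc[OF l]) auto
    from rep[OF this] obtain f c a where f: "atomic_representation \<Omega> D f c a" "\<forall>\<phi>\<in>Cc \<Omega>. l \<phi> = pairing f \<phi>"
      by blast
    have fH: "f \<in> H1 \<Omega> D" using f(1) by (auto simp: H1_def)
    have "l = T f" unfolding T_def by (rule dual_eq_VMO_extension[OF l pairing_bounded[OF fH]]) (use f in blast)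
    then show "l \<in> T ` H1 \<Omega> D" using fH by blast
  qed
  have "inverse A * h1_norm \<Omega> D f \<le> dual_norm (VMO \<Omega> D) (bmo_norm \<Omega> D) (T f) \<and>
      dual_norm (VMO \<Omega> D) (bmo_norm \<Omega> D) (T f) \<le> 1 * h1_norm \<Omega> D f" if f: "f \<in> H1 \<Omega> D" for f
  proof
    let ?K = "dual_norm (VMO \<Omega> D) (bmo_norm \<Omega> D) (T f)"
    note pb = pairing_bounded[OF f]
    show "?K \<le> 1 * h1_norm \<Omega> D f" unfolding T_def using dual_norm_VMO_extension(2)[OF pb] by simp
    have "bounded_on_Cc (pairing f) ?K"
      unfolding T_def bounded_on_Cc_def
    proof (intro conjI ballI dual_norm_VMO_extension(1)[OF pb] VMO_extension_le_dual_norm[OF pb])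
    qed (use pb in \<open>auto simp: bounded_on_Cc_def\<close>)
    \<comment> \<open>The functional of \<open>f\<close> is represented by some \<open>g\<close>
      whose coefficients are controlled by the dual norm. Test functions separate Hardy functions,
      so \<open>g\<close> equals \<open>f\<close> almost everywhere and its representation is one of
      \<open>f\<close>.\<close>
    from rep[OF this] obtain g c a where g: "atomic_representation \<Omega> D g c a" "(\<Sum>j. cmod (c j)) \<le> A * ?K"
      "\<forall>\<phi>\<in>Cc \<Omega>. pairing f \<phi> = pairing g \<phi>" by blast
    have gH: "g \<in> H1 \<Omega> D" using g(1) by (auto simp: H1_def)
    have ae: "AE x in lebesgue_on \<Omega>. g x = f x"
      using g(3) pairing_eq_iff[OF gH f] by simp
    have "h1_norm \<Omega> D f \<le> (\<Sum>j. cmod (c j))"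
      by (rule h1_norm_le[OF atomic_representation_cong_AE[OF g(1) ae]])
    then show "inverse A * h1_norm \<Omega> D f \<le> ?K" using g(2) A by (simp add: field_simps)
  qed
  then show "\<exists>c>0. \<exists>C>0. \<forall>f\<in>H1 \<Omega> D.
        c * h1_norm \<Omega> D f \<le> dual_norm (VMO \<Omega> D) (bmo_norm \<Omega> D) (T f) \<and>
        dual_norm (VMO \<Omega> D) (bmo_norm \<Omega> D) (T f) \<le> C * h1_norm \<Omega> D f"
    using A by (intro exI[of _ "inverse A"] exI[of _ 1] conjI) auto
qed

end

theorem theorem4p13:
  fixes \<Omega> D :: "'a::euclidean_space set"
  assumes "DIM('a) \<ge> 2"
    and "open \<Omega>"
    and "D \<subseteq> frontier \<Omega>"
    and "closed D"
    and "UITC \<Omega>"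
    and "\<exists>!C. C \<in> sigma_components \<Omega> D"
  shows "\<exists>T :: ('a \<Rightarrow> complex) \<Rightarrow> (('a \<Rightarrow> complex) \<Rightarrow> complex).
      (\<forall>f\<in>H1 \<Omega> D. \<forall>\<phi>\<in>Cc \<Omega>.
          integrable (lebesgue_on \<Omega>) (\<lambda>x. f x * \<phi> x) \<and>
          T f \<phi> = (LINT x|lebesgue_on \<Omega>. f x * \<phi> x)) \<and>
      (\<forall>f\<in>H1 \<Omega> D. \<forall>g\<in>H1 \<Omega> D.
          (\<lambda>x. f x + g x) \<in> H1 \<Omega> D \<and> T (\<lambda>x. f x + g x) = (\<lambda>\<phi>. T f \<phi> + T g \<phi>)) \<and>
      (\<forall>c. \<forall>f\<in>H1 \<Omega> D.
          (\<lambda>x. c * f x) \<in> H1 \<Omega> D \<and> T (\<lambda>x. c * f x) = (\<lambda>\<phi>. c * T f \<phi>)) \<and>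
      (\<forall>f\<in>H1 \<Omega> D. \<forall>g\<in>H1 \<Omega> D. T f = T g \<longleftrightarrow> (AE x in lebesgue_on \<Omega>. f x = g x)) \<and>
      T ` H1 \<Omega> D = dual_space (VMO \<Omega> D) (bmo_norm \<Omega> D) \<and>
      (\<exists>c>0. \<exists>C>0. \<forall>f\<in>H1 \<Omega> D.
          c * h1_norm \<Omega> D f \<le> dual_norm (VMO \<Omega> D) (bmo_norm \<Omega> D) (T f) \<and>
          dual_norm (VMO \<Omega> D) (bmo_norm \<Omega> D) (T f) \<le> C * h1_norm \<Omega> D f)"
proof -
  interpret uitc_domain \<Omega> D
    using assms by unfold_locales (simp_all add: sigma_components_eq)
  show ?thesis
  proof (intro exI[of _ "\<lambda>f. VMO_extension (pairing f)"] conjI ballI allI VMO_dual pairing_extension_eq_iff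
      H1_add H1_cmult H1_Cc_integrable)
    fix f \<phi> assume f: "f \<in> H1 \<Omega> D" and \<phi>: "\<phi> \<in> Cc \<Omega>"
    show "VMO_extension (pairing f) \<phi> = (LINT x|lebesgue_on \<Omega>. f x * \<phi> x)"
      using VMO_extension_Cc[OF pairing_bounded[OF f] \<phi>] by (simp add: pairing_def)
  next
    fix f g assume f: "f \<in> H1 \<Omega> D" and g: "g \<in> H1 \<Omega> D"
    show "VMO_extension (pairing (\<lambda>x. f x + g x)) = (\<lambda>\<phi>. VMO_extension (pairing f) \<phi> + VMO_extension (pairing g) \<phi>)"
    proof (rule VMO_extension_add[OF pairing_bounded[OF f] pairing_bounded[OF g] pairing_bounded[OF H1_add[OF f g]]])
      fix \<phi> assume \<phi>: "\<phi> \<in> Cc \<Omega>"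
      show "pairing (\<lambda>x. f x + g x) \<phi> = pairing f \<phi> + pairing g \<phi>"
        using H1_Cc_integrable[OF f \<phi>] H1_Cc_integrable[OF g \<phi>] by (simp add: pairing_def distrib_right)
    qed
  next
    fix c f assume f: "f \<in> H1 \<Omega> D"
    show "VMO_extension (pairing (\<lambda>x. c * f x)) = (\<lambda>\<phi>. c * VMO_extension (pairing f) \<phi>)"
      by (rule VMO_extension_cmult[OF pairing_bounded[OF f] pairing_bounded[OF H1_cmult[OF f]]])
        (simp add: pairing_def mult.assoc)
  qed
qed

end
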